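(* Let $\Omega\subset\mathbb{R}^2$ be a bounded domain, let $2<p<\infty$, and let $\lambda<\lambda_p$, where $$\lambda_p=\inf_{u\in C_0^1(\Omega^\star):\,\|u\|_{L^p(\Omega^\star)}=1}\int_{\Omega^\star}|\nabla u|^2\,\mathrm{d}x$$ and $\Omega^\star$ is the open ball in $\mathbb{R}^2$ of radius $\sqrt{|\Omega|/\pi}$ centered at the origin. Then $$\sup\left\{\int_\Omega e^{4\pi u^2}\,\mathrm{d}x:\ u\in C_0^\infty(\Omega),\ \int_\Omega|\nabla u|^2\,\mathrm{d}x-\lambda\|u\|_{L^p(\Omega)}^2\le1\right\}<\infty.$$
   Context: $|\Omega|$ denotes the Lebesgue measure of $\Omega$. *)

theory Defs
  imports "HOL-Analysis.Analysis"
begin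

type_synonym plane = "real ^ 2"

(* On the whole plane, by recursion on the order: C^(k+1) means differentiable with
   all first partial derivatives of class C^k. *)
fun C_class :: "nat \<Rightarrow> (plane \<Rightarrow> real) \<Rightarrow> bool" where
  "C_class 0 u \<longleftrightarrow> continuous_on UNIV u"
| "C_class (Suc k) u \<longleftrightarrow> u differentiable_on UNIV \<and>
     (\<forall>b\<in>Basis. C_class k (\<lambda>x. frechet_derivative u (at x) b))"

(* Elements of C_0^k(S), S open, are represented by their extension by zero to the plane;
   the support is the closure of the set where the function is nonzero. *)
definition C0 :: "nat \<Rightarrow> plane set \<Rightarrow> (plane \<Rightarrow> real) set" where
  "C0 k S = {u. C_class k u \<and> compact (closure {x. u x \<noteq> 0}) \<and> closure {x. u x \<noteq> 0} \<subseteq> S}"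

definition C0_infinity :: "plane set \<Rightarrow> (plane \<Rightarrow> real) set" where
  "C0_infinity S = (\<Inter>k. C0 k S)"

definition grad :: "(plane \<Rightarrow> real) \<Rightarrow> plane \<Rightarrow> plane" where
  "grad u x = (\<Sum>b\<in>Basis. frechet_derivative u (at x) b *\<^sub>R b)"

definition dirichlet_energy :: "plane set \<Rightarrow> (plane \<Rightarrow> real) \<Rightarrow> real" where
  "dirichlet_energy S u = (LINT x:S|lborel. (norm (grad u x))\<^sup>2)"

definition Lp_norm :: "real \<Rightarrow> plane set \<Rightarrow> (plane \<Rightarrow> real) \<Rightarrow> real" where
  "Lp_norm p S u = (LINT x:S|lborel. \<bar>u x\<bar> powr p) powr (1 / p)"

definition symm_ball :: "plane set \<Rightarrow> plane set" where
  "symm_ball S = ball 0 (sqrt (measure lborel S / pi))"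

definition lambda_p :: "real \<Rightarrow> plane set \<Rightarrow> real" where
  "lambda_p p S =
     (INF u \<in> {u \<in> C0 1 (symm_ball S). Lp_norm p (symm_ball S) u = 1}.
        dirichlet_energy (symm_ball S) u)"

end

theory Submission
  imports Defs
begin

text \<open>The isoperimetric inequality enters through Brunn--Minkowski for a set and a small disc. Integrated
  over the levels of \<open>u\<close> it bounds the integral of \<open>\<bar>\<nabla>u\<bar>\<close> over a layer \<open>a < \<bar>u\<bar> < b\<close> from below, and with the
  weight \<open>1 / sqrt \<nu>\<close>, \<open>\<nu>(l) = measure {\<bar>u\<bar> \<ge> l}\<close>, and Cauchy--Schwarz this becomes the condenser inequality
  \<open>4 \<pi> (b - a)\<^sup>2 \<le> (\<integral> \<bar>\<nabla>u\<bar>\<^sup>2) * ln (\<mu>(a) / \<nu>(b))\<close>. Hence the decreasing rearrangement \<open>w\<close> of \<open>sqrt (4 \<pi>) \<bar>u\<bar>\<close>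
  in the variable \<open>t = ln (measure \<Omega> / measure of the superlevel set)\<close> satisfies
  \<open>(w t - w s)\<^sup>2 \<le> (t - s) (F t - F s)\<close>, where \<open>F t\<close> is the Dirichlet energy of \<open>u\<close> below the level \<open>w t\<close>.

  It remains to bound \<open>\<integral> exp (w\<^sup>2 - t) dt\<close>. Testing \<open>\<lambda>_p\<close> with the radial functions given by averages of
  \<open>min w (w T)\<close>, the hypothesis \<open>\<lambda> < \<lambda>_p\<close> and \<open>p > 2\<close> give
  \<open>F \<infinity> - F T \<le> 1 - \<sigma> F T + c N(w - min w (w T))\<close> with \<open>N\<close> the squared \<open>L\<^sup>p\<close> norm for \<open>exp (- t) dt\<close>.
  Let \<open>T\<close> nearly maximise \<open>F t exp (- t / (2 p))\<close> over \<open>t \<ge> T\<^sub>0\<close>. The growth of \<open>F\<close> after \<open>T\<close> is then so slow that the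
  last term is at most \<open>\<sigma> F T / 2\<close>, and its growth before \<open>T\<close> so fast that \<open>(w T)\<^sup>2 \<le> A F T\<close>. The energy
  left after \<open>T\<close> is thus smaller than 1 by a multiple of \<open>(w T)\<^sup>2\<close>, which is exactly what Moser's inequality
  for \<open>w - w T\<close> needs.\<close>

section \<open>Brunn--Minkowski inequality in the plane\<close>

text \<open>A fixed \<open>T\<close> would not do. The tail term \<open>N(w - min w (w T))\<close>
  must be absorbed by a fraction of \<open>F T\<close>, yet it can be of order one while
  \<open>F T\<close> is tiny, namely when most of the energy is spent far out. Hence
  \<open>T\<close> depends on \<open>w\<close>. The rate \<open>1 / (2 * p)\<close> is dictated by
  the tail: beyond \<open>T\<close> it lets the square of \<open>w t - w T\<close> grow at most like
  \<open>exp ((t - T) / p)\<close>, and the power \<open>p / 2\<close> of this,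
  \<open>exp ((t - T) / 2)\<close>, is still integrable against \<open>exp (- t)\<close>. The
  outcome is \<open>F T\<close> times a factor decaying in \<open>T\<close>, and \<open>T0\<close>
  marks where that factor has become small.

  Level sets of \<open>\<bar>u\<bar>\<close> may have positive measure. This forces two distribution
  functions, and the rearranged problem is phrased through increments of two monotone functions
  instead of a derivative of \<open>w\<close>. Derivatives return only in the test functions for
  \<open>lambda_p\<close>, which are obtained by averaging.

  The \<open>4 * pi\<close> of the planar isoperimetric inequality is also the exponent in the
  theorem. Absorbed into \<open>w\<close>, it turns the one-dimensional inequality into the critical
  one with constant 1.\<close>

lemma nn_integral_layer_cake:
  fixes f :: "'a \<Rightarrow> real"
  assumes "sigma_finite_measure M" and [measurable]: "f \<in> borel_measurable M"
  shows "(\<integral>\<^sup>+x. ennreal (f x) \<partial>M) =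
    (\<integral>\<^sup>+s. emeasure M {x \<in> space M. s < f x} * indicator {0..} s \<partial>lborel)"
proof -
  interpret M: sigma_finite_measure M by fact
  interpret P: pair_sigma_finite M lborel ..
  have "(\<integral>\<^sup>+x. ennreal (f x) \<partial>M) =
      (\<integral>\<^sup>+x. \<integral>\<^sup>+s. indicator {0..} s * indicator {x \<in> space M. s < f x} x \<partial>lborel \<partial>M)"
  proof (rule nn_integral_cong)
    fix x assume x: "x \<in> space M"
    have "ennreal (f x) = emeasure lborel {0..<f x}"
      by (cases "0 \<le> f x") (auto simp: ennreal_neg)
    also have "\<dots> = (\<integral>\<^sup>+s. indicator {0..<f x} s \<partial>lborel)" by simp
    also have "\<dots> = (\<integral>\<^sup>+s. indicator {0..} s * indicator {x \<in> space M. s < f x} x \<partial>lborel)"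
      using x by (intro nn_integral_cong) (auto simp: indicator_def)
    finally show "ennreal (f x) = \<dots>" .
  qed
  also have "\<dots> = (\<integral>\<^sup>+s. \<integral>\<^sup>+x. indicator {0..} s * indicator {x \<in> space M. s < f x} x \<partial>M \<partial>lborel)"
    by (rule P.Fubini'[symmetric]) measurable
  also have "\<dots> = (\<integral>\<^sup>+s. emeasure M {x \<in> space M. s < f x} * indicator {0..} s \<partial>lborel)"
    by (intro nn_integral_cong) (subst nn_integral_cmult, simp_all add: mult.commute)
  finally show ?thesis .
qed

text \<open>Translates of both sets lie in \<open>S\<close> and meet only near their ends:
  \<open>P'\<close> is \<open>P\<close> shifted by \<open>q\<close> and \<open>Q'\<close> is
  \<open>Q\<close> shifted by \<open>p\<close>. Taking for \<open>S\<close> any Borel set that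
  contains the sums avoids the question whether a sumset is measurable.\<close>

lemma brunn_minkowski_real:
  fixes P Q S :: "real set"
  assumes [measurable]: "P \<in> sets borel" "Q \<in> sets borel" "S \<in> sets borel"
    and ne: "P \<noteq> {}" "Q \<noteq> {}" and bd: "bounded P" "bounded Q"
    and sub: "\<And>x y. x \<in> P \<Longrightarrow> y \<in> Q \<Longrightarrow> x + y \<in> S"
  shows "emeasure lborel P + emeasure lborel Q \<le> emeasure lborel S"
proof (rule ennreal_le_epsilon)
  fix e :: real assume e: "0 < e"
  have bP: "bdd_above P" and bQ: "bdd_below Q"
    using bd by (auto simp: bounded_imp_bdd_above bounded_imp_bdd_below)
  obtain p where p: "p \<in> P" "Sup P - e / 2 < p"
    using less_cSup_iff[OF ne(1) bP, of "Sup P - e/2"] e by auto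
  obtain q where q: "q \<in> Q" "q < Inf Q + e / 2"
    using cInf_less_iff[OF ne(2) bQ, of "Inf Q + e/2"] e by auto
  define P' where "P' = (\<lambda>x. - q + x) -` P"
  define Q' where "Q' = (\<lambda>x. - p + x) -` Q"
  have [measurable]: "P' \<in> sets borel" "Q' \<in> sets borel"
    unfolding P'_def Q'_def by (rule measurable_sets_borel; measurable)+
  have tr: "emeasure lborel ((\<lambda>x. c + x) -` A) = emeasure lborel A"
    if [measurable]: "A \<in> sets borel" for A and c :: real
  proof -
    have "emeasure lborel A = emeasure (distr lborel borel ((+) c)) A"
      by (subst lborel_distr_plus) simp
    also have "\<dots> = emeasure lborel ((\<lambda>x. c + x) -` A)"
      by (subst emeasure_distr) auto
    finally show ?thesis by simp
  qed
  have eq: "emeasure lborel P' = emeasure lborel P" "emeasure lborel Q' = emeasure lborel Q"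
    unfolding P'_def Q'_def by (rule tr; simp)+
  \<comment> \<open>As \<open>p\<close> is nearly the supremum of \<open>P\<close> and
    \<open>q\<close> nearly the infimum of \<open>Q\<close>, this interval is shorter than
    \<open>e\<close>.\<close>
  have int: "P' \<inter> Q' \<subseteq> {p + Inf Q .. q + Sup P}"
    using bP bQ cSup_upper[OF _ bP] cInf_lower[OF _ bQ] unfolding P'_def Q'_def by fastforce
  have inte: "emeasure lborel (P' \<inter> Q') \<le> ennreal e"
  proof -
    have "emeasure lborel (P' \<inter> Q') \<le> emeasure lborel {p + Inf Q .. q + Sup P}"
      by (rule emeasure_mono[OF int]) auto
    also have "\<dots> \<le> ennreal e" using p q by (auto simp: emeasure_lborel_Icc_eq intro!: ennreal_leI)
    finally show ?thesis .
  qed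
  have "emeasure lborel P + emeasure lborel Q = emeasure lborel P' + emeasure lborel Q'" by (simp add: eq)
  also have "\<dots> = emeasure lborel (P' \<union> Q') + emeasure lborel (P' \<inter> Q')"
    by (rule emeasure_Un_Int) auto
  also have "\<dots> \<le> emeasure lborel S + ennreal e"
  proof (rule add_mono[OF _ inte], rule emeasure_mono)
    show "P' \<union> Q' \<subseteq> S" 
    proof
      fix x assume "x \<in> P' \<union> Q'"
      then show "x \<in> S" using sub[of "- q + x" q] sub[of p "- p + x"] p q by (auto simp: P'_def Q'_def)
    qed
  qed auto
  finally show "emeasure lborel P + emeasure lborel Q \<le> emeasure lborel S + ennreal e" .
qed

text \<open>Rescaling the levels to the unit interval allows section lengths with different suprema
  to be compared at the same fraction of their maxima.\<close>

lemma layer_cake_lborel_bounded: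
  fixes f :: "real \<Rightarrow> real"
  assumes [measurable]: "f \<in> borel_measurable borel" and m: "0 < m" and le: "\<And>x. f x \<le> m"
  shows "(\<integral>\<^sup>+x. ennreal (f x) \<partial>lborel) =
    ennreal m * (\<integral>\<^sup>+s. emeasure lborel {x. s * m < f x} * indicator {0..<1} s \<partial>lborel)"
proof -
  have "(\<integral>\<^sup>+x. ennreal (f x) \<partial>lborel) = (\<integral>\<^sup>+s. emeasure lborel {x. s < f x} * indicator {0..} s \<partial>lborel)"
    using nn_integral_layer_cake[of lborel f] by (simp add: sigma_finite_lborel)
  also have "\<dots> = ennreal \<bar>m\<bar> * (\<integral>\<^sup>+s. emeasure lborel {x. 0 + m * s < f x} * indicator {0..} (0 + m * s) \<partial>lborel)"
    by (rule nn_integral_real_affine) (use m in auto)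
  also have "(\<integral>\<^sup>+s. emeasure lborel {x. 0 + m * s < f x} * indicator {0..} (0 + m * s) \<partial>lborel) = 
     (\<integral>\<^sup>+s. emeasure lborel {x. s * m < f x} * indicator {0..<1} s \<partial>lborel)"
  proof (rule nn_integral_cong)
    fix s :: real
    show "emeasure lborel {x. 0 + m * s < f x} * indicator {0..} (0 + m * s) = emeasure lborel {x. s * m < f x} * indicator {0..<1} s"
    proof (cases "s < 1")
      case True then show ?thesis using m by (auto simp: indicator_def mult.commute zero_le_mult_iff)
    next
      case False
      then have "m \<le> s * m" using m by simp
      then have "{x. s * m < f x} = {}" using le by (auto simp: not_less intro: order_trans)
      then show ?thesis using False by (simp add: mult.commute)
    qed
  qed
  finally show ?thesis using m by simp
qed

text \<open>Let \<alpha> and \<beta> be the largest section lengths of \<open>A\<close> and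
  \<open>B\<close>. The one-dimensional inequality is used twice: on sections it shows that points
  whose sections exceed the fraction \<open>s\<close> of \<alpha> and of \<beta> add up to a point
  whose section in \<open>C\<close> exceeds \<open>s * (\<alpha> + \<beta>)\<close>; on the sets of
  such points it compares their lengths. Integration over \<open>s\<close> gives \<open>a / \<alpha>
  + b / \<beta> \<le> measure lborel C / (\<alpha> + \<beta>)\<close>, where \<open>a\<close> and
  \<open>b\<close> are the areas.\<close>

lemma brunn_minkowski_prod:
  fixes A B C :: "(real \<times> real) set"
  assumes [measurable]: "A \<in> sets borel" "B \<in> sets borel" "C \<in> sets borel"
    and bd: "bounded A" "bounded B" "bounded C"
    and pos: "0 < measure lborel A" "0 < measure lborel B"
    and sub: "\<And>x y. x \<in> A \<Longrightarrow> y \<in> B \<Longrightarrow> x + y \<in> C"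
  shows "measure lborel A + measure lborel B + 2 * sqrt (measure lborel A * measure lborel B) \<le> measure lborel C"
proof -
  define sec where "sec D x = {y. (x, y) \<in> D}" for D :: "(real \<times> real) set" and x
  define len where "len D x = measure lborel (sec D x)" for D x
  have sec_m[measurable]: "sec D x \<in> sets borel" if [measurable]: "D \<in> sets borel" for D x
  proof -
    have "sec D x = (\<lambda>y. (x, y)) -` D \<inter> space borel" by (auto simp: sec_def)
    also have "\<dots> \<in> sets borel" by (rule measurable_sets[of _ borel borel]) auto
    finally show ?thesis .
  qed
  have bnd: "\<exists>K>0. \<forall>x. sec D x \<subseteq> {-K..K}" if D: "bounded D" for D :: "(real \<times> real) set"
  proof -
    obtain K where K: "K > 0" "\<And>z. z \<in> D \<Longrightarrow> norm z \<le> K" using D bounded_pos by metis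
    have "y \<in> {-K..K}" if "(x,y) \<in> D" for x y
    proof -
      have "\<bar>y\<bar> \<le> norm (x,y)" using norm_snd_le[of y x] by simp
      then show ?thesis using K(2)[OF that] by auto
    qed
    then show ?thesis using K(1) unfolding sec_def by blast
  qed
  have secb: "bounded (sec D x)" if "bounded D" for D x
    using bnd[OF that] bounded_subset[OF bounded_closed_interval] by blast
  have fin: "emeasure lborel (sec D x) = ennreal (len D x)" if "bounded D" "D \<in> sets borel" for D x
    unfolding len_def using emeasure_bounded_finite[OF secb[OF that(1)], of x] by (intro emeasure_eq_ennreal_measure) (auto simp: less_top)
  have len_m[measurable]: "len D \<in> borel_measurable borel" if [measurable]: "D \<in> sets borel" for D
  proof -
    have "D \<in> sets (lborel \<Otimes>\<^sub>M lborel)" unfolding lborel_prod by simp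
    from lborel.measurable_emeasure_Pair[OF this]
    have "(\<lambda>x. emeasure lborel (Pair x -` D)) \<in> borel_measurable lborel" by simp
    moreover have "Pair x -` D = sec D x" for x by (auto simp: sec_def)
    ultimately show ?thesis unfolding len_def measure_def by simp
  qed
  have tot: "emeasure lborel D = (\<integral>\<^sup>+x. ennreal (len D x) \<partial>lborel)" if "bounded D" "D \<in> sets borel" for D
  proof -
    have "D \<in> sets (lborel \<Otimes>\<^sub>M lborel)" unfolding lborel_prod using that by simp
    from lborel.emeasure_pair_measure_alt[OF this]
    have "emeasure lborel D = (\<integral>\<^sup>+x. emeasure lborel (Pair x -` D) \<partial>lborel)" by (simp add: lborel_prod)
    moreover have "Pair x -` D = sec D x" for x by (auto simp: sec_def)
    ultimately show ?thesis using fin[OF that] by simp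
  qed
  have bddl: "bdd_above (range (len D))" if D: "bounded D" "D \<in> sets borel" for D
  proof -
    obtain K where K: "K > 0" "\<And>x. sec D x \<subseteq> {-K..K}" using bnd[OF D(1)] by blast
    have "len D x \<le> 2 * K" for x
    proof -
      have "emeasure lborel (sec D x) \<le> emeasure lborel {-K..K}" by (rule emeasure_mono[OF K(2)]) auto
      then show ?thesis using K(1) by (simp add: fin[OF D])
    qed
    then show ?thesis by (intro bdd_aboveI) auto
  qed
  define top where "top D = (SUP x. len D x)" for D
  have len_le: "len D x \<le> top D" if "bounded D" "D \<in> sets borel" for D x
    unfolding top_def by (rule cSUP_upper[OF _ bddl[OF that]]) auto
  have len_0: "0 \<le> len D x" for D x by (simp add: len_def)
  have finm: "emeasure lborel D = ennreal (measure lborel D)" if "bounded D" for D :: "(real \<times> real) set"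
    using emeasure_bounded_finite[OF that] by (intro emeasure_eq_ennreal_measure) (auto simp: less_top)
  have top_pos: "0 < top D" if D: "bounded D" "D \<in> sets borel" "0 < measure lborel D" for D
  proof (rule ccontr)
    assume "\<not> 0 < top D"
    then have "len D x = 0" for x using len_le[OF D(1,2), of x] len_0[of D x] by linarith
    then have "emeasure lborel D = 0" using tot[OF D(1,2)] by simp
    then show False using D(3) by (simp add: measure_def)
  qed
  define \<alpha> \<beta> where "\<alpha> = top A" and "\<beta> = top B"
  have al: "0 < \<alpha>" "0 < \<beta>" using top_pos pos bd by (auto simp: \<alpha>_def \<beta>_def)
  define I where "I D m = (\<integral>\<^sup>+s. emeasure lborel {x. s * m < len D x} * indicator {0..<1} s \<partial>lborel)" for D m
  have IA: "ennreal (measure lborel A) = ennreal \<alpha> * I A \<alpha>"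
    unfolding I_def finm[OF bd(1), symmetric] tot[OF bd(1) assms(1)]
    by (rule layer_cake_lborel_bounded) (use al len_le[OF bd(1) assms(1)] in \<open>auto simp: \<alpha>_def\<close>)
  have IB: "ennreal (measure lborel B) = ennreal \<beta> * I B \<beta>"
    unfolding I_def finm[OF bd(2), symmetric] tot[OF bd(2) assms(2)]
    by (rule layer_cake_lborel_bounded) (use al len_le[OF bd(2) assms(2)] in \<open>auto simp: \<beta>_def\<close>)
  define m where "m = \<alpha> + \<beta>"
  have mC: "ennreal m * I C m \<le> ennreal (measure lborel C)"
  proof -
    \<comment> \<open>Sections of \<open>C\<close> may be longer than \<open>m\<close>. Cutting them
      at \<open>m\<close> keeps all levels \<open>s * m\<close> with \<open>s < 1\<close>, the only
      ones to be compared.\<close>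
    have "ennreal (measure lborel C) \<ge> (\<integral>\<^sup>+x. ennreal (min m (len C x)) \<partial>lborel)"
      unfolding finm[OF bd(3), symmetric] tot[OF bd(3) assms(3)] by (intro nn_integral_mono ennreal_leI) simp
    also have "(\<integral>\<^sup>+x. ennreal (min m (len C x)) \<partial>lborel) = 
       ennreal m * (\<integral>\<^sup>+s. emeasure lborel {x. s * m < min m (len C x)} * indicator {0..<1} s \<partial>lborel)"
      by (rule layer_cake_lborel_bounded) (use al in \<open>auto simp: m_def\<close>)
    also have "(\<integral>\<^sup>+s. emeasure lborel {x. s * m < min m (len C x)} * indicator {0..<1} s \<partial>lborel) = I C m"
      unfolding I_def
    proof (rule nn_integral_cong)
      fix s :: real
      have "s * m < m" if "s < 1" using that al by (simp add: m_def)
      then show "emeasure lborel {x. s * m < min m (len C x)} * indicator {0..<1} s = emeasure lborel {x. s * m < len C x} * indicator {0..<1} s"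
        by (auto simp: indicator_def)
    qed
    finally show ?thesis .
  qed
  have key: "I A \<alpha> + I B \<beta> \<le> I C m"
  proof -
    have "I A \<alpha> + I B \<beta> = (\<integral>\<^sup>+s. emeasure lborel {x. s * \<alpha> < len A x} * indicator {0..<1} s + emeasure lborel {x. s * \<beta> < len B x} * indicator {0..<1} s \<partial>lborel)"
      unfolding I_def by (rule nn_integral_add[symmetric]) auto
    also have "\<dots> \<le> I C m" unfolding I_def
    proof (rule nn_integral_mono)
      fix s :: real
      show "emeasure lborel {x. s * \<alpha> < len A x} * indicator {0..<1} s + emeasure lborel {x. s * \<beta> < len B x} * indicator {0..<1} s
        \<le> emeasure lborel {x. s * m < len C x} * indicator {0..<1} s"
      proof (cases "s \<in> {0..<1}")
        case True
        \<comment> \<open>The one-dimensional inequality is false for an empty summand;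
          \<open>s < 1\<close> guarantees that neither superlevel set is empty.\<close>
        have nonempty: "\<exists>x. s * top D < len D x" if "0 < top D" for D
        proof (rule ccontr)
          assume "\<not> (\<exists>x. s * top D < len D x)"
          then have "top D \<le> s * top D" unfolding top_def by (intro cSUP_least) (auto simp: not_less)
          then show False using that True by auto
        qed
        have bounded_set: "bounded {x. s * top D < len D x}" if D: "bounded D" "0 < top D" for D
        proof -
          obtain K where K: "\<And>z. z \<in> D \<Longrightarrow> norm z \<le> K" using D(1) bounded_pos by metis
          have "{x. s * top D < len D x} \<subseteq> {-K..K}"
          proof
            fix x assume "x \<in> {x. s * top D < len D x}"
            moreover have "0 \<le> s * top D" using True D by auto
            ultimately have "len D x > 0" by auto
            then have "sec D x \<noteq> {}" by (auto simp: len_def)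
            then obtain y where "(x,y) \<in> D" by (auto simp: sec_def)
            then have "norm (x,y) \<le> K" using K by auto
            then have "\<bar>x\<bar> \<le> K" using norm_fst_le[of x y] by simp
            then show "x \<in> {-K..K}" by auto
          qed
          then show ?thesis using bounded_subset[OF bounded_closed_interval] by blast
        qed
        have "emeasure lborel {x. s * \<alpha> < len A x} + emeasure lborel {x. s * \<beta> < len B x} \<le> emeasure lborel {x. s * m < len C x}"
        proof (rule brunn_minkowski_real)
          show "{x. s * \<alpha> < len A x} \<noteq> {}" "{x. s * \<beta> < len B x} \<noteq> {}"
            using nonempty al by (auto simp: \<alpha>_def \<beta>_def)
          show "bounded {x. s * \<alpha> < len A x}" "bounded {x. s * \<beta> < len B x}"
            using bounded_set bd al by (auto simp: \<alpha>_def \<beta>_def)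
          fix x y assume xy: "x \<in> {x. s * \<alpha> < len A x}" "y \<in> {x. s * \<beta> < len B x}"
          have "0 \<le> s * \<alpha>" "0 \<le> s * \<beta>" using True al by auto
          then have "0 < len A x" "0 < len B y" using xy by auto
          then have ne: "sec A x \<noteq> {}" "sec B y \<noteq> {}" by (auto simp: len_def)
          have "emeasure lborel (sec A x) + emeasure lborel (sec B y) \<le> emeasure lborel (sec C (x + y))"
            by (rule brunn_minkowski_real) (use ne secb bd sub in \<open>auto simp: sec_def\<close>)
          then have "len A x + len B y \<le> len C (x + y)"
            using bd by (simp add: fin len_0 flip: ennreal_plus)
          then show "x + y \<in> {x. s * m < len C x}" using xy by (auto simp: m_def algebra_simps)
        qed auto
        then show ?thesis using True by simp
      qed simp
    qed
    finally show ?thesis .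
  qed
  define a b where "a = measure lborel A" and "b = measure lborel B"
  have ab: "0 < a" "0 < b" using pos by (auto simp: a_def b_def)
  have div: "I D t = ennreal (d / t)" if "ennreal d = ennreal t * I D t" "0 < t" "0 \<le> d" for D d t
  proof -
    have "ennreal (1 / t) * ennreal d = ennreal (1/t) * ennreal t * I D t" using that(1) by (simp add: mult.assoc)
    also have "ennreal (1/t) * ennreal t = 1" using that(2) by (simp flip: ennreal_mult)
    finally show ?thesis using that(2,3) by (simp flip: ennreal_mult)
  qed
  have "ennreal (m * (a / \<alpha> + b / \<beta>)) = ennreal m * (I A \<alpha> + I B \<beta>)"
    using div[OF IA] div[OF IB] al ab by (simp add: a_def b_def m_def ennreal_mult)
  also have "\<dots> \<le> ennreal m * I C m" by (rule mult_left_mono[OF key]) simp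
  also have "\<dots> \<le> ennreal (measure lborel C)" by (rule mC)
  finally have fin: "m * (a / \<alpha> + b / \<beta>) \<le> measure lborel C"
    by (subst (asm) ennreal_le_iff) auto
  \<comment> \<open>The two cross terms have product \<open>a * b\<close>, so the
    arithmetic-geometric mean inequality eliminates the unknown suprema.\<close>
  have "m * (a / \<alpha> + b / \<beta>) = a + b + (a * (\<beta>/\<alpha>) + b * (\<alpha>/\<beta>))"
    using al by (simp add: m_def field_simps)
  moreover have "2 * sqrt (a * b) \<le> a * (\<beta>/\<alpha>) + b * (\<alpha>/\<beta>)"
  proof -
    have "sqrt ((a * (\<beta>/\<alpha>)) * (b * (\<alpha>/\<beta>))) \<le> (a * (\<beta>/\<alpha>) + b * (\<alpha>/\<beta>)) / 2"
      by (rule arith_geo_mean_sqrt) (use ab al in auto)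
    moreover have "(a * (\<beta>/\<alpha>)) * (b * (\<alpha>/\<beta>)) = a * b" using al by simp
    ultimately show ?thesis by simp
  qed
  ultimately show ?thesis using fin by (simp add: a_def b_def)
qed

text \<open>Slicing needs a product measure and is therefore done on pairs; this identification
  carries the result over to \<open>real ^ 2\<close>.\<close>

lemma distr_vec2_lborel:
  "distr lborel lborel (\<lambda>(x, y). x *\<^sub>R axis 1 1 + y *\<^sub>R axis 2 1 :: real ^ 2) = lborel"
proof (rule lborel_eqI[symmetric])
  have c: "continuous_on UNIV (\<lambda>(x, y). x *\<^sub>R axis 1 1 + y *\<^sub>R axis 2 1 :: real ^ 2)"
    by (auto simp: case_prod_beta intro!: continuous_intros)
  have [measurable]: "(\<lambda>(x, y). x *\<^sub>R axis 1 1 + y *\<^sub>R axis 2 1 :: real ^ 2) \<in> borel_measurable borel"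
    by (rule borel_measurable_continuous_onI[OF c])
  fix l u :: "real ^ 2"
  assume le: "\<And>b. b \<in> Basis \<Longrightarrow> l \<bullet> b \<le> u \<bullet> b"
  have le': "l $ 1 \<le> u $ 1" "l $ 2 \<le> u $ 2"
    using le[of "axis 1 1"] le[of "axis 2 1"] by (auto simp: inner_axis axis_in_Basis_iff)
  have vi: "(\<lambda>(x, y). x *\<^sub>R axis 1 1 + y *\<^sub>R axis 2 1 :: real ^ 2) -` box l u = box (l $ 1, l $ 2) (u $ 1, u $ 2)"
    by (auto simp: mem_box_cart forall_2 box_prod axis_def)
  have "emeasure (distr lborel lborel (\<lambda>(x, y). x *\<^sub>R axis 1 1 + y *\<^sub>R axis 2 1 :: real ^ 2)) (box l u) =
     emeasure lborel (box (l $ 1, l $ 2) (u $ 1, u $ 2))"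
    by (subst emeasure_distr) (auto simp: vi)
  also have "\<dots> = ennreal ((u$1 - l$1) * (u$2 - l$2))"
    using le' by (subst emeasure_lborel_box) (auto simp: Basis_prod_def prod.union_disjoint)
  also have "(u$1 - l$1) * (u$2 - l$2) = (\<Prod>b\<in>Basis. (u - l) \<bullet> b)"
    by (simp add: Basis_vec_def UNIV_2 inner_axis axis_eq_axis)
  finally show "emeasure (distr lborel lborel (\<lambda>(x, y). x *\<^sub>R axis 1 1 + y *\<^sub>R axis 2 1 :: real ^ 2)) (box l u) = \<dots>" .
qed simp

lemma brunn_minkowski_plane:
  fixes A B C :: "(real ^ 2) set"
  assumes [measurable]: "A \<in> sets borel" "B \<in> sets borel" "C \<in> sets borel"
    and bd: "bounded A" "bounded B" "bounded C"
    and pos: "0 < measure lborel A" "0 < measure lborel B"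
    and sub: "\<And>x y. x \<in> A \<Longrightarrow> y \<in> B \<Longrightarrow> x + y \<in> C"
  shows "measure lborel A + measure lborel B + 2 * sqrt (measure lborel A * measure lborel B) \<le> measure lborel C"
proof -
  define f :: "real \<times> real \<Rightarrow> real ^ 2" where "f = (\<lambda>(x, y). x *\<^sub>R axis 1 1 + y *\<^sub>R axis 2 1)"
  have c: "continuous_on UNIV f" unfolding f_def
    by (auto simp: case_prod_beta intro!: continuous_intros)
  have fm[measurable]: "f \<in> borel_measurable borel"
    by (rule borel_measurable_continuous_onI[OF c])
  have add: "f (x + y) = f x + f y" for x y
    by (cases x; cases y) (simp add: f_def vec_eq_iff forall_2 axis_def)
  have nrm: "norm (f x) = norm x" for x
    by (cases x) (simp add: f_def norm_vec_def L2_set_def sum_2 norm_Pair axis_def)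
  have meas: "measure lborel (f -` D) = measure lborel D" if [measurable]: "D \<in> sets borel" for D
  proof -
    have "emeasure lborel D = emeasure (distr lborel lborel f) D"
      unfolding f_def by (subst distr_vec2_lborel) simp
    also have "\<dots> = emeasure lborel (f -` D)" by (subst emeasure_distr) auto
    finally show ?thesis by (simp add: measure_def)
  qed
  have bnd: "bounded (f -` D)" if "bounded D" for D
    using that unfolding bounded_iff by (metis nrm vimageE)
  have mm: "f -` D \<in> sets borel" if "D \<in> sets borel" for D using measurable_sets_borel[OF fm that] .
  have "measure lborel (f -` A) + measure lborel (f -` B) + 2 * sqrt (measure lborel (f -` A) * measure lborel (f -` B)) \<le> measure lborel (f -` C)"
    by (rule brunn_minkowski_prod) (use bd pos sub in \<open>auto simp: meas mm bnd add\<close>)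
  then show ?thesis by (simp add: meas)
qed

text \<open>The first-order part of the Brunn--Minkowski inequality for a set and a small disc; it is the
  isoperimetric inequality in the form in which it can be integrated over level sets.\<close>

lemma measure_enlargement_ge:
  fixes A C :: "(real ^ 2) set"
  assumes [measurable]: "A \<in> sets borel" "C \<in> sets borel"
    and bd: "bounded A" "bounded C" and h: "0 < h"
    and sub: "\<And>x y. x \<in> A \<Longrightarrow> dist x y < h \<Longrightarrow> y \<in> C"
  shows "2 * h * sqrt (pi * measure lborel A) \<le> measure lborel (C - A)"
proof (cases "0 < measure lborel A")
  case True
  have fin: "D \<in> fmeasurable lborel" if "D \<in> sets borel" "bounded D" for D :: "(real ^ 2) set"
    using that emeasure_bounded_finite[of D] by (auto simp: fmeasurable_def)
  have ball: "measure lborel (ball (0 :: real ^ 2) h) = pi * h\<^sup>2"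
    using content_ball[of h "0 :: real ^ 2"] h by (simp add: unit_ball_vol_2)
  have "measure lborel A + measure lborel (ball (0 :: real ^ 2) h) + 2 * sqrt (measure lborel A * measure lborel (ball (0 :: real ^ 2) h)) \<le> measure lborel C"
  proof (rule brunn_minkowski_plane)
    fix x y :: "real ^ 2" assume "x \<in> A" "y \<in> ball 0 h"
    then show "x + y \<in> C" by (intro sub[of x]) (auto simp: dist_norm)
  qed (use bd True h ball in auto)
  moreover have "sqrt (measure lborel A * (pi * h\<^sup>2)) = h * sqrt (pi * measure lborel A)"
    using h by (simp add: real_sqrt_mult algebra_simps)
  moreover have "A \<subseteq> C" using sub[of x x for x] h by auto
  moreover have "measure lborel (C - A) = measure lborel C - measure lborel A"
    using fin bd \<open>A \<subseteq> C\<close> by (intro measurable_measure_Diff) (auto simp: fmeasurableD)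
  \<comment> \<open>The area of the disc itself is of second order in \<open>h\<close> and is
    discarded.\<close>
  moreover have "0 \<le> pi * h\<^sup>2" by simp
  ultimately show ?thesis unfolding ball by linarith
next
  case False
  then have "measure lborel A = 0" by (metis measure_nonneg less_eq_real_def)
  then show ?thesis by simp
qed

section \<open>Isoperimetric and condenser inequalities\<close>

text \<open>No domain is mentioned: the isoperimetric part sees \<open>u\<close> as a function on
  the whole plane whose superlevel sets at positive levels are bounded.\<close>

locale C1_bump =
  fixes u :: "real ^ 2 \<Rightarrow> real" and G :: "real ^ 2 \<Rightarrow> real ^ 2"
  assumes deriv: "\<And>x. (u has_derivative (\<lambda>h. G x \<bullet> h)) (at x)"
    and cont_G: "continuous_on UNIV G"
    and bounded_support: "bounded {x. u x \<noteq> 0}"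
begin

lemma cont_u: "continuous_on UNIV u"
  by (intro continuous_at_imp_continuous_on ballI has_derivative_continuous[OF deriv])

lemma measurable_u[measurable]: "u \<in> borel_measurable borel"
  by (rule borel_measurable_continuous_onI[OF cont_u])

lemma measurable_G[measurable]: "G \<in> borel_measurable borel"
  by (rule borel_measurable_continuous_onI[OF cont_G])

lemma support_radius: obtains R where "0 < R" "\<And>x. R < norm x \<Longrightarrow> u x = 0"
  using bounded_support unfolding bounded_pos by (metis (mono_tags, lifting) mem_Collect_eq not_less)

text \<open>On the open complement of a large disc \<open>u\<close> vanishes, hence so does
  \<open>G\<close> by uniqueness of the derivative; on the disc, compactness bounds it.\<close>

lemma bounded_G: obtains B where "0 < B" "\<And>x. norm (G x) \<le> B"
proof -
  obtain R where R: "0 < R" "\<And>x. R < norm x \<Longrightarrow> u x = 0" using support_radius by blast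
  have "compact (G ` cball 0 R)"
    by (intro compact_continuous_image continuous_on_subset[OF cont_G]) auto
  then obtain B where B: "0 < B" "\<And>x. norm x \<le> R \<Longrightarrow> norm (G x) \<le> B"
    by (auto simp: bounded_pos dest!: compact_imp_bounded)
  have "G x = 0" if x: "R < norm x" for x
  proof -
    have "open {x :: real ^ 2. R < norm x}" by (intro open_Collect_less continuous_intros)
    then have "(u has_derivative (\<lambda>h. 0)) (at x)"
      using x R(2) by (intro has_derivative_transform_within_open[OF has_derivative_const[of 0]]) auto
    then have "(\<lambda>h. G x \<bullet> h) = (\<lambda>h. 0)" using deriv has_derivative_unique by blast
    then show ?thesis by (metis inner_eq_zero_iff)
  qed
  then have "norm (G x) \<le> B" for x using B by (cases "norm x \<le> R") auto
  then show ?thesis using that B(1) by blast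
qed

text \<open>Uniform continuity of \<open>G\<close> on a disc makes the first-order expansion
  uniform, so that \<open>d\<close> is the same for all points. The slope is taken at the base point
  alone, which later allows the width of a layer to be a function of one point.\<close>

lemma abs_u_increment:
  assumes e: "0 < e"
  obtains d where "0 < d" "\<And>x y. dist x y < d \<Longrightarrow> \<bar>u y\<bar> \<le> \<bar>u x\<bar> + dist x y * (norm (G x) + e)"
proof -
  obtain R where R: "0 < R" "\<And>x. R < norm x \<Longrightarrow> u x = 0" using support_radius by blast
  have "uniformly_continuous_on (cball 0 (R + 2)) G"
    by (intro compact_uniformly_continuous continuous_on_subset[OF cont_G]) auto
  then obtain d0 where d0: "0 < d0"
    "\<And>x y. norm x \<le> R + 2 \<Longrightarrow> norm y \<le> R + 2 \<Longrightarrow> dist y x < d0 \<Longrightarrow> dist (G y) (G x) < e"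
    unfolding uniformly_continuous_on_def using e by (metis mem_cball_0)
  have "\<bar>u y\<bar> \<le> \<bar>u x\<bar> + dist x y * (norm (G x) + e)" if xy: "dist x y < min d0 1" for x y
  proof (cases "norm x \<le> R + 1")
    case False
    have "norm x \<le> norm y + dist x y" by (metis dist_norm norm_triangle_sub add.commute)
    then have "u y = 0" using R xy False by auto
    then show ?thesis using e by (simp add: add_nonneg_nonneg)
  next
    case True
    define f where "f z = u z - G x \<bullet> z" for z
    have "norm (f y - f x) \<le> e * norm (y - x)"
    proof (rule differentiable_bound[where S = "closed_segment x y" and f' = "\<lambda>z h. G z \<bullet> h - G x \<bullet> h"])
      fix z assume z: "z \<in> closed_segment x y"
      show "(f has_derivative (\<lambda>h. G z \<bullet> h - G x \<bullet> h)) (at z within closed_segment x y)"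
        unfolding f_def by (auto intro!: derivative_eq_intros has_derivative_at_withinI[OF deriv])
    next
      fix z assume z: "z \<in> closed_segment x y"
      have "dist x z \<le> dist x y" using dist_in_closed_segment[OF z] by (simp add: dist_commute)
      then have dz: "dist z x < d0" "dist x z < 1" using xy by (auto simp: dist_commute)
      have "norm z \<le> norm x + dist x z" by (metis dist_norm norm_triangle_sub dist_commute)
      then have "dist (G z) (G x) < e" using True dz by (intro d0) auto
      then have "onorm (\<lambda>h. (G z - G x) \<bullet> h) \<le> e"
        by (intro onorm_le order_trans[OF Cauchy_Schwarz_ineq2[unfolded real_norm_def[symmetric]]] mult_right_mono) (auto simp: dist_norm)
      then show "onorm (\<lambda>h. G z \<bullet> h - G x \<bullet> h) \<le> e" by (simp add: inner_diff_left)
    qed auto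
    moreover have "f y - f x = u y - u x - G x \<bullet> (y - x)" by (simp add: f_def inner_diff_right)
    moreover have "\<bar>G x \<bullet> (y - x)\<bar> \<le> norm (G x) * norm (y - x)" by (rule Cauchy_Schwarz_ineq2)
    ultimately have "\<bar>u y\<bar> \<le> \<bar>u x\<bar> + norm (y - x) * (norm (G x) + e)" by (simp add: algebra_simps)
    then show ?thesis by (simp add: dist_norm norm_minus_commute)
  qed
  then show ?thesis using that[of "min d0 1"] d0(1) by auto
qed

section \<open>Distribution functions and the isoperimetric inequality integrated over
  levels\<close>

definition nu :: "real \<Rightarrow> real" where "nu l = measure lborel {x. l \<le> \<bar>u x\<bar>}"
text \<open>The two functions differ at a level by the measure of the level set, which may be
  positive. \<open>measure\<close> returns 0 on sets of infinite measure: \<open>nu\<close> is 0 at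
  levels up to 0 and \<open>mu\<close> at negative levels, whence the sign conditions below.\<close>

definition mu :: "real \<Rightarrow> real" where "mu l = measure lborel {x. l < \<bar>u x\<bar>}"

lemma bounded_superlevel:
  "0 < l \<Longrightarrow> bounded {x. l \<le> \<bar>u x\<bar>}" "0 \<le> l \<Longrightarrow> bounded {x. l < \<bar>u x\<bar>}"
  by (auto intro: bounded_subset[OF bounded_support])

lemma emeasure_superlevel:
  shows "0 < l \<Longrightarrow> emeasure lborel {x. l \<le> \<bar>u x\<bar>} = ennreal (nu l)"
    and "0 \<le> l \<Longrightarrow> emeasure lborel {x. l < \<bar>u x\<bar>} = ennreal (mu l)"
  using emeasure_bounded_finite[OF bounded_superlevel(1), of l] emeasure_bounded_finite[OF bounded_superlevel(2), of l]
  by (auto simp: nu_def mu_def less_top intro!: emeasure_eq_ennreal_measure)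

lemma nu_nonneg[simp]: "0 \<le> nu l" and mu_nonneg[simp]: "0 \<le> mu l"
  by (auto simp: nu_def mu_def)

lemma nu_antimono: "0 < l \<Longrightarrow> l \<le> l' \<Longrightarrow> nu l' \<le> nu l"
  by (subst ennreal_le_iff[symmetric], simp, subst (1 2) emeasure_superlevel(1)[symmetric])
    (auto intro!: emeasure_mono)

lemma nu_le_mu: "0 \<le> l \<Longrightarrow> l < l' \<Longrightarrow> nu l' \<le> mu l"
  by (subst ennreal_le_iff[symmetric], simp, subst emeasure_superlevel(1)[symmetric], simp,
      subst emeasure_superlevel(2)[symmetric]) (auto intro!: emeasure_mono)

lemma measurable_nu[measurable]: "nu \<in> borel_measurable borel"
proof -
  have "{z \<in> space (lborel \<Otimes>\<^sub>M lborel). fst z \<le> \<bar>u (snd z)\<bar>} \<in> sets (lborel \<Otimes>\<^sub>M lborel)"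
    by measurable
  from lborel.measurable_emeasure_Pair[OF this]
  have "(\<lambda>l. emeasure lborel (Pair l -` {z \<in> space (lborel \<Otimes>\<^sub>M lborel). fst z \<le> \<bar>u (snd z)\<bar>})) \<in> borel_measurable lborel" .
  moreover have "Pair l -` {z \<in> space (lborel \<Otimes>\<^sub>M lborel). fst z \<le> \<bar>u (snd z)\<bar>} = {x. l \<le> \<bar>u x\<bar>}" for l
    by (auto simp: space_pair_measure)
  ultimately show ?thesis unfolding nu_def measure_def by simp
qed

text \<open>Enlarging the superlevel set of each level by \<open>h\<close> adds the point \<open>x\<close> only for levels in an interval of
  length \<open>h * (norm (G x) + e)\<close> above \<open>\<bar>u x\<bar>\<close>.\<close>

lemma isoperimetric_layer:
  assumes a: "0 \<le> a"
  shows "(\<integral>\<^sup>+l. ennreal (2 * sqrt (pi * nu l)) * indicator {a<..<b} l \<partial>lborel)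
    \<le> (\<integral>\<^sup>+x. ennreal (norm (G x)) * indicator {x. a < \<bar>u x\<bar> \<and> \<bar>u x\<bar> < b} x \<partial>lborel)"
    (is "?L \<le> ?R")
proof -
  define V where "V = mu 0"
  define s where "s l = 2 * sqrt (pi * nu l)" for l
  define X where "X = {x. a < \<bar>u x\<bar> \<and> \<bar>u x\<bar> < b}"
  have [measurable]: "s \<in> borel_measurable borel" "X \<in> sets borel"
    unfolding s_def X_def by measurable
  have s0: "0 \<le> s l" for l by (simp add: s_def)
  have sV: "s l \<le> 2 * sqrt (pi * V)" if "0 < l" for l
    using nu_le_mu[of 0 l] that by (simp add: s_def V_def)
  have XV: "emeasure lborel X \<le> ennreal V"
    unfolding V_def emeasure_superlevel(2)[OF order_refl, symmetric] using a by (intro emeasure_mono) (auto simp: X_def)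
  obtain B where B: "0 < B" "\<And>x. norm (G x) \<le> B" using bounded_G by blast
  have step: "?L \<le> ?R + ennreal (e * (2 * sqrt (pi * V) + V))" if e: "0 < e" for e
  proof -
    obtain d where d: "0 < d" "\<And>x y. dist x y < d \<Longrightarrow> \<bar>u y\<bar> \<le> \<bar>u x\<bar> + dist x y * (norm (G x) + e)"
      using abs_u_increment[OF e] by blast
    \<comment> \<open>The second bound keeps every increment \<open>h * (norm (G x) + e)\<close>
      below \<open>e\<close>. A point that is added at a level above \<open>a + e\<close> then still
      satisfies \<open>a < \<bar>u x\<bar>\<close>.\<close>
    define h where "h = min d (e / (B + e))"
    have h: "0 < h" "h \<le> d" using d e B by (auto simp: h_def)
    have "h * (B + e) \<le> e / (B + e) * (B + e)" using e B by (intro mult_right_mono) (auto simp: h_def)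
    then have hB: "h * (B + e) \<le> e" using e B by simp
    have hG: "h * (norm (G x) + e) \<le> e" for x
      by (rule order_trans[OF mult_left_mono hB]) (use B h in auto)
    \<comment> \<open>Contains all pairs of a level and a point that the enlargement adds at this
      level. Its slices at fixed level are bounded below by the enlargement inequality, those at
      fixed point are bounded above by intervals, and Tonelli compares the two.\<close>
    define E where "E = {z \<in> space (lborel \<Otimes>\<^sub>M lborel). a + e < fst z \<and> fst z < b \<and> \<bar>u (snd z)\<bar> < fst z
      \<and> fst z \<le> \<bar>u (snd z)\<bar> + h * (norm (G (snd z)) + e)}"
    have E_iff: "(l, x) \<in> E \<longleftrightarrow> a + e < l \<and> l < b \<and> \<bar>u x\<bar> < l \<and> l \<le> \<bar>u x\<bar> + h * (norm (G x) + e)" for l x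
      by (simp add: E_def space_pair_measure)
    have [measurable]: "E \<in> sets (lborel \<Otimes>\<^sub>M lborel)" unfolding E_def by measurable
    have slice: "ennreal h * (ennreal (s l) * indicator {a + e<..<b} l) \<le> (\<integral>\<^sup>+x. indicator E (l, x) \<partial>lborel)" for l
    proof (cases "a + e < l \<and> l < b")
      case True
      have l: "0 < l" using a e True by simp
      define A C where "A = {x. l \<le> \<bar>u x\<bar>}" and "C = (\<Union>x\<in>A. ball x h)"
      have [measurable]: "A \<in> sets borel" "C \<in> sets borel"
        unfolding A_def C_def by (measurable, intro borel_open open_UN) auto
      have bA: "bounded A" unfolding A_def by (rule bounded_superlevel(1)[OF l])
      have "C \<subseteq> {x + y | x y. x \<in> A \<and> y \<in> ball 0 h}"
        unfolding C_def by (auto simp: dist_norm) (metis add.commute diff_add_cancel norm_minus_commute)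
      then have bC: "bounded C" using bounded_subset[OF bounded_sums[OF bA bounded_ball]] by blast
      have "2 * h * sqrt (pi * measure lborel A) \<le> measure lborel (C - A)"
        using \<open>A \<in> sets borel\<close> \<open>C \<in> sets borel\<close> bA bC h(1) by (rule measure_enlargement_ge) (auto simp: C_def)
      then have "h * s l \<le> measure lborel (C - A)" by (simp add: s_def nu_def A_def algebra_simps)
      then have "ennreal (h * s l) \<le> emeasure lborel (C - A)"
        using emeasure_bounded_finite[of "C - A"] bC
        by (subst emeasure_eq_ennreal_measure) (auto simp: less_top bounded_diff intro!: ennreal_leI)
      also have "\<dots> \<le> emeasure lborel {x. (l, x) \<in> E}"
      proof (rule emeasure_mono)
        show "C - A \<subseteq> {x. (l, x) \<in> E}"
        proof
          fix y assume "y \<in> C - A"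
          then obtain x where x: "l \<le> \<bar>u x\<bar>" "dist x y < h" and y: "\<bar>u y\<bar> < l"
            by (auto simp: C_def A_def)
          \<comment> \<open>The expansion is based at the added point \<open>y\<close>, so that the
            bound involves \<open>G y\<close> and becomes a condition on the pair of
            \<open>l\<close> and \<open>y\<close>.\<close>
          have "\<bar>u x\<bar> \<le> \<bar>u y\<bar> + dist y x * (norm (G y) + e)" using x h by (intro d) (auto simp: dist_commute)
          also have "dist y x * (norm (G y) + e) \<le> h * (norm (G y) + e)"
            using x e by (intro mult_right_mono) (auto simp: dist_commute add_nonneg_nonneg)
          finally show "y \<in> {x. (l, x) \<in> E}" using x y True by (simp add: E_iff)
        qed
      qed (simp add: E_iff)
      also have "\<dots> = (\<integral>\<^sup>+x. indicator {x. (l, x) \<in> E} x \<partial>lborel)"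
        by (subst nn_integral_indicator) (auto simp: E_iff)
      finally show ?thesis using True h s0 by (simp add: ennreal_mult indicator_def)
    qed (auto simp: indicator_def)
    have "ennreal h * (\<integral>\<^sup>+l. ennreal (s l) * indicator {a + e<..<b} l \<partial>lborel) =
      (\<integral>\<^sup>+l. ennreal h * (ennreal (s l) * indicator {a + e<..<b} l) \<partial>lborel)"
      by (rule nn_integral_cmult[symmetric]) measurable
    also have "\<dots> \<le> (\<integral>\<^sup>+l. \<integral>\<^sup>+x. indicator E (l, x) \<partial>lborel \<partial>lborel)"
      by (rule nn_integral_mono) (rule slice)
    also have "\<dots> = (\<integral>\<^sup>+x. \<integral>\<^sup>+l. indicator E (l, x) \<partial>lborel \<partial>lborel)"
      by (rule lborel_pair.Fubini'[symmetric]) (simp add: case_prod_beta)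
    also have "\<dots> \<le> (\<integral>\<^sup>+x. ennreal h * (ennreal (norm (G x) + e) * indicator X x) \<partial>lborel)"
    proof (rule nn_integral_mono)
      fix x
      define t where "t = h * (norm (G x) + e)"
      have t: "0 \<le> t" "t \<le> e" using h e hG by (auto simp: t_def)
      have "(\<integral>\<^sup>+l. indicator E (l, x) \<partial>lborel) \<le> (\<integral>\<^sup>+l. indicator {\<bar>u x\<bar><..\<bar>u x\<bar> + t} l * indicator X x \<partial>lborel)"
        using t by (intro nn_integral_mono) (auto simp: E_iff X_def indicator_def t_def)
      also have "\<dots> = ennreal t * indicator X x" using t by (subst nn_integral_multc) auto
      also have "\<dots> = ennreal h * (ennreal (norm (G x) + e) * indicator X x)"
        using h e unfolding t_def by (simp add: ennreal_mult mult.assoc)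
      finally show "(\<integral>\<^sup>+l. indicator E (l, x) \<partial>lborel) \<le> \<dots>" .
    qed
    also have "\<dots> = ennreal h * (\<integral>\<^sup>+x. ennreal (norm (G x) + e) * indicator X x \<partial>lborel)"
      by (rule nn_integral_cmult) measurable
    finally have "(\<integral>\<^sup>+l. ennreal (s l) * indicator {a + e<..<b} l \<partial>lborel) \<le> (\<integral>\<^sup>+x. ennreal (norm (G x) + e) * indicator X x \<partial>lborel)"
      using h by (subst (asm) ennreal_mult_le_mult_iff) auto
    also have "\<dots> = (\<integral>\<^sup>+x. ennreal (norm (G x)) * indicator X x + ennreal e * indicator X x \<partial>lborel)"
      using e by (intro nn_integral_cong) (simp add: algebra_simps)
    also have "\<dots> = ?R + ennreal e * emeasure lborel X"
      by (subst nn_integral_add) (auto simp: X_def[symmetric] nn_integral_cmult_indicator)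
    also have "\<dots> \<le> ?R + ennreal (e * V)"
      using mult_left_mono[OF XV, of "ennreal e"] e by (intro add_left_mono) (simp add: ennreal_mult V_def)
    finally have main: "(\<integral>\<^sup>+l. ennreal (s l) * indicator {a + e<..<b} l \<partial>lborel) \<le> ?R + ennreal (e * V)" .
    \<comment> \<open>Levels up to \<open>a + e\<close> were left out above; they contribute at most
      \<open>e\<close> times the bound on \<open>s\<close>.\<close>
    have "?L \<le> (\<integral>\<^sup>+l. ennreal (2 * sqrt (pi * V)) * indicator {a..a + e} l + ennreal (s l) * indicator {a + e<..<b} l \<partial>lborel)"
      unfolding s_def[symmetric]
      using sV a by (intro nn_integral_mono) (auto simp: indicator_def intro!: ennreal_leI)
    also have "\<dots> = ennreal (e * (2 * sqrt (pi * V))) + (\<integral>\<^sup>+l. ennreal (s l) * indicator {a + e<..<b} l \<partial>lborel)"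
    proof (subst nn_integral_add)
      have "(\<integral>\<^sup>+l. ennreal (2 * sqrt (pi * V)) * indicator {a..a + e} l \<partial>lborel) = ennreal (2 * sqrt (pi * V)) * ennreal e"
        using e by (subst nn_integral_cmult_indicator) auto
      also have "\<dots> = ennreal (e * (2 * sqrt (pi * V)))"
        using e by (subst ennreal_mult[symmetric]) (auto simp: V_def mult.commute)
      finally show "(\<integral>\<^sup>+l. ennreal (2 * sqrt (pi * V)) * indicator {a..a + e} l \<partial>lborel) +
          (\<integral>\<^sup>+l. ennreal (s l) * indicator {a + e<..<b} l \<partial>lborel) =
        ennreal (e * (2 * sqrt (pi * V))) + (\<integral>\<^sup>+l. ennreal (s l) * indicator {a + e<..<b} l \<partial>lborel)"
        by simp
    qed measurable
    also have "\<dots> \<le> ennreal (e * (2 * sqrt (pi * V))) + (?R + ennreal (e * V))" by (rule add_left_mono[OF main])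
    also have "\<dots> = ?R + ennreal (e * (2 * sqrt (pi * V) + V))"
      using e by (simp add: V_def distrib_left ennreal_plus ac_simps del: ennreal_plus[symmetric])
    finally show ?thesis .
  qed
  show ?thesis
  proof (rule ennreal_le_epsilon)
    fix e :: real assume e: "0 < e"
    define c where "c = 2 * sqrt (pi * V) + V + 1"
    have c: "0 < c" by (simp add: c_def V_def add_nonneg_pos)
    have "?L \<le> ?R + ennreal (e / c * (2 * sqrt (pi * V) + V))" by (rule step) (use e c in simp)
    also have "e / c * (2 * sqrt (pi * V) + V) \<le> e / c * c"
      using e c by (intro mult_left_mono) (auto simp: c_def)
    then have "?R + ennreal (e / c * (2 * sqrt (pi * V) + V)) \<le> ?R + ennreal e"
      using c by (intro add_left_mono ennreal_leI) simp
    finally show "?L \<le> ?R + ennreal e" .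
  qed
qed

text \<open>This is right continuity of \<open>mu\<close>: the set where
  \<open>c < \<bar>u x\<bar>\<close> is the increasing union of the closed superlevel sets at
  \<open>c + 1 / (n + 1)\<close>.\<close>

lemma mu_le_of_nu_le:
  assumes "0 \<le> c" "\<And>l. c < l \<Longrightarrow> nu l \<le> y"
  shows "mu c \<le> y"
proof -
  define A where "A n = {x. c + 1 / real (Suc n) \<le> \<bar>u x\<bar>}" for n
  have [measurable]: "A n \<in> sets borel" for n unfolding A_def by measurable
  have "{x. c < \<bar>u x\<bar>} = (\<Union>n. A n)"
  proof (intro set_eqI iffI)
    fix x assume "x \<in> {x. c < \<bar>u x\<bar>}"
    then obtain n where "inverse (real (Suc n)) < \<bar>u x\<bar> - c" using reals_Archimedean[of "\<bar>u x\<bar> - c"] by auto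
    then show "x \<in> (\<Union>n. A n)" by (auto simp: A_def inverse_eq_divide intro!: exI[of _ n])
  next
    fix x assume "x \<in> (\<Union>n. A n)"
    then obtain n where "c + 1 / real (Suc n) \<le> \<bar>u x\<bar>" by (auto simp: A_def)
    moreover have "0 < 1 / real (Suc n)" by simp
    ultimately have "c < \<bar>u x\<bar>" by linarith
    then show "x \<in> {x. c < \<bar>u x\<bar>}" by simp
  qed
  moreover have "incseq A"
    unfolding A_def incseq_def by (auto intro: order_trans[rotated] simp: frac_le)
  ultimately have "emeasure lborel {x. c < \<bar>u x\<bar>} = (SUP n. emeasure lborel (A n))"
    by (subst SUP_emeasure_incseq) auto
  also have "\<dots> \<le> ennreal y"
  proof (rule SUP_least)
    fix n
    have "0 < c + 1 / real (Suc n)" "c < c + 1 / real (Suc n)" using assms(1) by (simp_all add: add_nonneg_pos del: of_nat_Suc)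
    then show "emeasure lborel (A n) \<le> ennreal y"
      unfolding A_def using assms(2) by (subst emeasure_superlevel) (auto intro!: ennreal_leI simp del: of_nat_Suc)
  qed
  finally have "ennreal (mu c) \<le> ennreal y" by (simp add: emeasure_superlevel assms)
  moreover have "0 \<le> y" using assms(2)[of "c + 1"] nu_nonneg[of "c + 1"] by linarith
  ultimately show ?thesis by simp
qed

text \<open>Up to its left end \<open>c\<close>, such a set is the interval from \<open>c\<close> to
  \<open>b\<close>. On the left-hand side the single level \<open>c\<close> is a null set; on the
  right-hand side the level set of \<open>c\<close> may carry mass, but there it can only increase
  the integral.\<close>

lemma isoperimetric_up_closed:
  assumes a: "0 \<le> a" and J: "J \<subseteq> {a<..<b}" and [measurable]: "J \<in> sets borel"
    and up: "\<And>l l'. l \<in> J \<Longrightarrow> l \<le> l' \<Longrightarrow> l' < b \<Longrightarrow> l' \<in> J"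
  shows "(\<integral>\<^sup>+l. ennreal (2 * sqrt (pi * nu l)) * indicator J l \<partial>lborel)
    \<le> (\<integral>\<^sup>+x. ennreal (norm (G x)) * indicator J \<bar>u x\<bar> \<partial>lborel)"
proof (cases "J = {}")
  case False
  define c where "c = Inf J"
  have bb: "bdd_below J" using J by (meson bdd_below_mono bdd_below_Ioo)
  have c: "a \<le> c" unfolding c_def using J by (intro cInf_greatest[OF False]) auto
  have sub1: "{c<..<b} \<subseteq> J"
  proof
    fix l assume l: "l \<in> {c<..<b}"
    then obtain l0 where "l0 \<in> J" "l0 < l" using cInf_less_iff[OF False bb] by (auto simp: c_def)
    then show "l \<in> J" using up[of l0 l] l by auto
  qed
  have sub2: "J \<subseteq> {c..<b}" using J cInf_lower[OF _ bb] by (auto simp: c_def)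
  have "(\<integral>\<^sup>+l. ennreal (2 * sqrt (pi * nu l)) * indicator J l \<partial>lborel) = (\<integral>\<^sup>+l. ennreal (2 * sqrt (pi * nu l)) * indicator {c<..<b} l \<partial>lborel)"
  proof (rule nn_integral_cong_AE)
    show "AE l in lborel. ennreal (2 * sqrt (pi * nu l)) * indicator J l = ennreal (2 * sqrt (pi * nu l)) * indicator {c<..<b} l"
      using AE_lborel_singleton[of c]
    proof eventually_elim
      case (elim l)
      then have "l \<in> J \<longleftrightarrow> l \<in> {c<..<b}" using sub1 sub2 by fastforce
      then show ?case by (simp add: indicator_def)
    qed
  qed
  also have "\<dots> \<le> (\<integral>\<^sup>+x. ennreal (norm (G x)) * indicator {x. c < \<bar>u x\<bar> \<and> \<bar>u x\<bar> < b} x \<partial>lborel)"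
    by (rule isoperimetric_layer) (use a c in simp)
  also have "\<dots> \<le> (\<integral>\<^sup>+x. ennreal (norm (G x)) * indicator J \<bar>u x\<bar> \<partial>lborel)"
    using sub1 by (intro nn_integral_mono mult_left_mono) (auto simp: indicator_def)
  finally show ?thesis .
qed simp

text \<open>The weight \<open>1 / sqrt \<circ> nu\<close> is increasing, so by the layer cake formula only up-closed sets of levels
  matter.\<close>

lemma weighted_isoperimetric:
  fixes a b :: real
  defines "X \<equiv> {x. a < \<bar>u x\<bar> \<and> \<bar>u x\<bar> < b}"
  assumes ab: "0 \<le> a" "a < b" and nb: "0 < nu b"
  shows "ennreal (2 * sqrt pi * (b - a)) \<le>
    (\<integral>\<^sup>+x. ennreal (norm (G x)) * indicator X x * ennreal (1 / sqrt (nu \<bar>u x\<bar>)) \<partial>lborel)"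
proof -
  define V where "V = mu 0"
  define g where "g l = 1 / sqrt (nu l)" for l
  define s where "s l = 2 * sqrt (pi * nu l)" for l
  have [measurable]: "g \<in> borel_measurable borel" "s \<in> borel_measurable borel" "X \<in> sets borel"
    unfolding g_def s_def X_def by measurable
  have s0: "0 \<le> s l" for l by (simp add: s_def)
  have nupos: "0 < nu l" if "a < l" "l < b" for l using nu_antimono[of l b] that ab nb by auto
  have gmono: "g l \<le> g l'" if "a < l" "l \<le> l'" "l' < b" for l l'
    unfolding g_def using that ab nupos[of l'] nu_antimono[of l l'] by (intro divide_left_mono) auto
  \<comment> \<open>Both sides become integrals of the same weight \<open>g\<close>, against the
    gradient on the layer and against the isoperimetric lower bound. The layer cake formula reduces
    the comparison to the sets where \<open>t < g\<close>, and \<open>s l * g l\<close> is the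
    constant \<open>2 * sqrt pi\<close>.\<close>
  define M N where "M = density lborel (\<lambda>x. ennreal (norm (G x)) * indicator X x)"
    and "N = density lborel (\<lambda>l. ennreal (s l) * indicator {a<..<b} l)"
  have XV: "emeasure lborel X \<le> ennreal V"
    unfolding V_def emeasure_superlevel(2)[OF order_refl, symmetric] using ab by (intro emeasure_mono) (auto simp: X_def)
  have sV: "s l \<le> 2 * sqrt (pi * V)" if "0 < l" for l
    using nu_le_mu[of 0 l] that by (simp add: s_def V_def)
  obtain B where B: "0 < B" "\<And>x. norm (G x) \<le> B" using bounded_G by blast
  have "finite_measure M"
  proof (rule finite_measureI)
    have "emeasure M (space M) = (\<integral>\<^sup>+x. ennreal (norm (G x)) * indicator X x \<partial>lborel)"
      unfolding M_def by (subst emeasure_density) auto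
    also have "\<dots> \<le> (\<integral>\<^sup>+x. ennreal B * indicator X x \<partial>lborel)"
      using B by (intro nn_integral_mono mult_right_mono ennreal_leI) auto
    also have "\<dots> = ennreal B * emeasure lborel X" by (simp add: nn_integral_cmult_indicator)
    also have "\<dots> \<le> ennreal B * ennreal V" by (intro mult_left_mono XV) simp
    finally show "emeasure M (space M) \<noteq> \<infinity>" by (auto simp: top_unique ennreal_mult_eq_top_iff)
  qed
  moreover have "finite_measure N"
  proof (rule finite_measureI)
    have "emeasure N (space N) = (\<integral>\<^sup>+l. ennreal (s l) * indicator {a<..<b} l \<partial>lborel)"
      unfolding N_def by (subst emeasure_density) auto
    also have "\<dots> \<le> (\<integral>\<^sup>+l. ennreal (2 * sqrt (pi * V)) * indicator {a<..<b} l \<partial>lborel)"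
      using sV ab by (intro nn_integral_mono) (auto simp: indicator_def intro!: ennreal_leI)
    also have "\<dots> = ennreal (2 * sqrt (pi * V)) * emeasure lborel {a<..<b}" by (simp add: nn_integral_cmult_indicator)
    finally show "emeasure N (space N) \<noteq> \<infinity>" using ab by (auto simp: top_unique ennreal_mult_eq_top_iff)
  qed
  ultimately have sf: "sigma_finite_measure M" "sigma_finite_measure N"
    by (auto simp: finite_measure.axioms)
  have "ennreal (2 * sqrt pi * (b - a)) = (\<integral>\<^sup>+l. ennreal (2 * sqrt pi) * indicator {a<..<b} l \<partial>lborel)"
    using ab by (simp add: nn_integral_cmult_indicator ennreal_mult)
  also have "\<dots> = (\<integral>\<^sup>+l. (ennreal (s l) * indicator {a<..<b} l) * ennreal (g l) \<partial>lborel)"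
  proof (rule nn_integral_cong)
    fix l
    have "2 * sqrt pi = s l * g l" if "a < l" "l < b"
      using nupos[OF that] by (simp add: s_def g_def real_sqrt_mult)
    then show "ennreal (2 * sqrt pi) * indicator {a<..<b} l = (ennreal (s l) * indicator {a<..<b} l) * ennreal (g l)"
      using s0 by (auto simp: indicator_def ennreal_mult'[symmetric])
  qed
  also have "\<dots> = (\<integral>\<^sup>+l. ennreal (g l) \<partial>N)"
    unfolding N_def by (subst nn_integral_density) auto
  also have "\<dots> = (\<integral>\<^sup>+t. emeasure N {l \<in> space N. t < g l} * indicator {0..} t \<partial>lborel)"
    by (rule nn_integral_layer_cake[OF sf(2)]) (simp add: N_def)
  also have "\<dots> \<le> (\<integral>\<^sup>+t. emeasure M {x \<in> space M. t < g \<bar>u x\<bar>} * indicator {0..} t \<partial>lborel)"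
  proof (intro nn_integral_mono mult_right_mono)
    fix t :: real
    define J where "J = {l. a < l \<and> l < b \<and> t < g l}"
    have [measurable]: "J \<in> sets borel" unfolding J_def by measurable
    have "emeasure N {l \<in> space N. t < g l} = (\<integral>\<^sup>+l. ennreal (s l) * indicator J l \<partial>lborel)"
      unfolding N_def by (subst emeasure_density) (auto simp: J_def indicator_def intro!: nn_integral_cong)
    also have "\<dots> \<le> (\<integral>\<^sup>+x. ennreal (norm (G x)) * indicator J \<bar>u x\<bar> \<partial>lborel)"
      unfolding s_def by (rule isoperimetric_up_closed[of a J b]) (use ab gmono in \<open>force simp: J_def\<close>)+
    also have "\<dots> = emeasure M {x \<in> space M. t < g \<bar>u x\<bar>}"
      unfolding M_def by (subst emeasure_density) (auto simp: J_def X_def indicator_def intro!: nn_integral_cong)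
    finally show "emeasure N {l \<in> space N. t < g l} \<le> emeasure M {x \<in> space M. t < g \<bar>u x\<bar>}" .
  qed simp
  also have "\<dots> = (\<integral>\<^sup>+x. ennreal (g \<bar>u x\<bar>) \<partial>M)"
    by (rule nn_integral_layer_cake[OF sf(1), symmetric]) (simp add: M_def)
  also have "\<dots> = (\<integral>\<^sup>+x. ennreal (norm (G x)) * indicator X x * ennreal (g \<bar>u x\<bar>) \<partial>lborel)"
    unfolding M_def by (subst nn_integral_density) auto
  finally show ?thesis by (simp add: g_def)
qed

text \<open>With \<open>mu\<close> in place of \<open>nu\<close> in the integrand this fails when some level set has positive measure.\<close>

lemma integral_inverse_nu_le:
  fixes a b :: real
  defines "X \<equiv> {x. a < \<bar>u x\<bar> \<and> \<bar>u x\<bar> < b}"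
  assumes ab: "0 \<le> a" "a < b" and nb: "0 < nu b"
  shows "(\<integral>\<^sup>+x. ennreal (1 / nu \<bar>u x\<bar>) * indicator X x \<partial>lborel) \<le> ennreal (ln (mu a / nu b))"
proof -
  have [measurable]: "X \<in> sets borel" unfolding X_def by measurable
  define m n where "m = mu a" and "n = nu b"
  have mn: "0 < n" "n \<le> m" using nb nu_le_mu[of a b] ab by (auto simp: m_def n_def)
  have nupos: "0 < nu l" if "a < l" "l < b" for l using nu_antimono[of l b] that ab nb by auto
  \<comment> \<open>Upper bound for the part of \<open>X\<close> where
    \<open>s < 1 / nu \<bar>u x\<bar>\<close>. Together with the top set of measure \<open>n\<close>
    this part has measure at most \<open>m\<close> and at most \<open>1 / s\<close>, and it is empty
    once \<open>s\<close> exceeds \<open>1 / n\<close>.\<close>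
  define \<phi> where "\<phi> s = (if s \<le> 1 / m then m - n else if s \<le> 1 / n then 1 / s - n else 0)" for s
  have mn': "1 / m \<le> 1 / n" "0 < 1 / m" using mn by (auto simp: field_simps)
  have disj: "emeasure lborel (Y \<union> {x. b \<le> \<bar>u x\<bar>}) = emeasure lborel Y + ennreal n"
    if "Y \<in> sets borel" "Y \<subseteq> X" for Y
    using that ab by (subst plus_emeasure[symmetric]) (auto simp: emeasure_superlevel n_def X_def)
  have le_of: "emeasure lborel Y \<le> ennreal (t - n)"
    if "Y \<in> sets borel" "Y \<subseteq> X" "emeasure lborel (Y \<union> {x. b \<le> \<bar>u x\<bar>}) \<le> ennreal t" for Y t
  proof -
    have *: "emeasure lborel Y + ennreal n \<le> ennreal t" using disj that by simp
    show ?thesis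
      using * mn by (cases "emeasure lborel Y") (auto simp: ennreal_plus[symmetric] ennreal_le_iff2 top_unique simp del: ennreal_plus intro!: ennreal_leI)
  qed
  have slice: "emeasure lborel {x \<in> X. s < 1 / nu \<bar>u x\<bar>} \<le> ennreal (\<phi> s)" if s: "0 \<le> s" for s
  proof -
    define Y where "Y = {x \<in> X. s < 1 / nu \<bar>u x\<bar>}"
    have [measurable]: "Y \<in> sets borel" unfolding Y_def by measurable
    have Y: "Y \<subseteq> X" by (auto simp: Y_def)
    have Ym: "emeasure lborel Y \<le> ennreal (m - n)"
    proof (rule le_of[OF _ Y])
      have "Y \<union> {x. b \<le> \<bar>u x\<bar>} \<subseteq> {x. a < \<bar>u x\<bar>}" using ab by (auto simp: Y_def X_def)
      then have "emeasure lborel (Y \<union> {x. b \<le> \<bar>u x\<bar>}) \<le> emeasure lborel {x. a < \<bar>u x\<bar>}"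
        by (intro emeasure_mono) auto
      then show "emeasure lborel (Y \<union> {x. b \<le> \<bar>u x\<bar>}) \<le> ennreal m" using ab by (simp add: emeasure_superlevel m_def)
    qed simp
    \<comment> \<open>With the top set added, \<open>Y\<close> lies in a superlevel set at the
      infimum \<open>c\<close> of \<open>\<bar>u\<bar>\<close> on \<open>Y\<close>. If
      \<open>c\<close> is attained on \<open>Y\<close>, the closed superlevel set has measure
      \<open>nu c < 1 / s\<close>. If not, the open one suffices, and its measure is bounded through
      levels decreasing to \<open>c\<close>.\<close>
    have Ys: "emeasure lborel Y \<le> ennreal (1 / s - n)" if s: "0 < s" and ne: "Y \<noteq> {}"
    proof (rule le_of[OF _ Y])
      define Z where "Z = Y \<union> {x. b \<le> \<bar>u x\<bar>}"
      define c where "c = Inf ((\<lambda>x. \<bar>u x\<bar>) ` Y)"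
      have bb: "bdd_below ((\<lambda>x. \<bar>u x\<bar>) ` Y)" by (rule bdd_belowI[of _ 0]) auto
      have ne': "(\<lambda>x. \<bar>u x\<bar>) ` Y \<noteq> {}" using ne by auto
      have ca: "a \<le> c" unfolding c_def using Y by (intro cInf_greatest[OF ne']) (auto simp: X_def)
      have cb: "c < b"
      proof -
        obtain y where y: "y \<in> Y" using ne by auto
        then have "c \<le> \<bar>u y\<bar>" unfolding c_def by (intro cInf_lower[OF _ bb]) auto
        then show ?thesis using y Y by (auto simp: X_def)
      qed
      have Zc: "Z \<subseteq> {x. c \<le> \<bar>u x\<bar>}" using cInf_lower[OF _ bb] cb by (auto simp: Z_def c_def)
      have small: "nu \<bar>u y\<bar> < 1 / s" if "y \<in> Y" for y
      proof -
        have "0 < nu \<bar>u y\<bar>" using that nupos by (auto simp: Y_def X_def)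
        then show ?thesis using that s by (auto simp: Y_def field_simps)
      qed
      show "emeasure lborel (Y \<union> {x. b \<le> \<bar>u x\<bar>}) \<le> ennreal (1 / s)"
      proof (cases "\<exists>y\<in>Y. \<bar>u y\<bar> = c")
        case True
        then obtain y where y: "y \<in> Y" "\<bar>u y\<bar> = c" by auto
        then have c0: "0 < c" using ab by (auto simp: Y_def X_def)
        have "emeasure lborel Z \<le> emeasure lborel {x. c \<le> \<bar>u x\<bar>}" by (rule emeasure_mono[OF Zc]) simp
        also have "\<dots> = ennreal (nu c)" using c0 by (rule emeasure_superlevel)
        also have "\<dots> \<le> ennreal (1 / s)" using small[OF y(1)] y(2) by (intro ennreal_leI) simp
        finally show ?thesis by (simp add: Z_def)
      next
        case False
        then have Zc': "Z \<subseteq> {x. c < \<bar>u x\<bar>}" using Zc cb by (force simp: Z_def)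
        have "emeasure lborel Z \<le> emeasure lborel {x. c < \<bar>u x\<bar>}" by (rule emeasure_mono[OF Zc']) simp
        also have "\<dots> = ennreal (mu c)" using ca ab by (intro emeasure_superlevel) simp
        also have "mu c \<le> 1 / s"
        proof (rule mu_le_of_nu_le)
          show "0 \<le> c" using ca ab by simp
          fix l assume "c < l"
          then obtain y where y: "y \<in> Y" "\<bar>u y\<bar> < l" using cInf_less_iff[OF ne' bb] by (auto simp: c_def)
          then have "nu l \<le> nu \<bar>u y\<bar>" using ab Y by (intro nu_antimono) (auto simp: X_def)
          then show "nu l \<le> 1 / s" using small[OF y(1)] by simp
        qed
        finally show ?thesis by (simp add: Z_def ennreal_leI)
      qed
    qed simp
    have Y0: "Y = {}" if "1 / n < s"
    proof (rule ccontr)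
      assume "Y \<noteq> {}"
      then obtain y where y: "y \<in> Y" by auto
      then have "n \<le> nu \<bar>u y\<bar>" using ab unfolding n_def by (intro nu_antimono) (auto simp: Y_def X_def)
      then have "1 / nu \<bar>u y\<bar> \<le> 1 / n" using mn by (intro divide_left_mono) auto
      then show False using y that by (auto simp: Y_def)
    qed
    have "s \<le> 1 / m \<or> 0 < s" using mn'(2) by linarith
    then show ?thesis
      unfolding Y_def[symmetric] \<phi>_def using Ym Ys Y0 by (cases "Y = {}") auto
  qed
  have "(\<integral>\<^sup>+x. ennreal (1 / nu \<bar>u x\<bar>) * indicator X x \<partial>lborel) = (\<integral>\<^sup>+x. ennreal (1 / nu \<bar>u x\<bar> * indicator X x) \<partial>lborel)"
    by (intro nn_integral_cong) (auto simp: indicator_def)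
  also have "\<dots> = (\<integral>\<^sup>+s. emeasure lborel {x \<in> space lborel. s < 1 / nu \<bar>u x\<bar> * indicator X x} * indicator {0..} s \<partial>lborel)"
    by (rule nn_integral_layer_cake) (auto intro: sigma_finite_lborel)
  also have "\<dots> \<le> (\<integral>\<^sup>+s. ennreal (m - n) * indicator {0..1 / m} s + ennreal (1 / s - n) * indicator {1 / m..1 / n} s \<partial>lborel)"
  proof (rule nn_integral_mono)
    fix s :: real
    show "emeasure lborel {x \<in> space lborel. s < 1 / nu \<bar>u x\<bar> * indicator X x} * indicator {0..} s
      \<le> ennreal (m - n) * indicator {0..1 / m} s + ennreal (1 / s - n) * indicator {1 / m..1 / n} s"
    proof (cases "0 \<le> s")
      case True
      then have "{x \<in> space lborel. s < 1 / nu \<bar>u x\<bar> * indicator X x} = {x \<in> X. s < 1 / nu \<bar>u x\<bar>}"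
        by (auto simp: indicator_def split: if_splits)
      moreover have "ennreal (\<phi> s) \<le> ennreal (m - n) * indicator {0..1 / m} s + ennreal (1 / s - n) * indicator {1 / m..1 / n} s"
        using True by (auto simp: \<phi>_def indicator_def)
      ultimately show ?thesis using slice[OF True] True by (auto intro: order_trans)
    qed simp
  qed
  also have "\<dots> = ennreal (m - n) * ennreal (1 / m) + (\<integral>\<^sup>+s. ennreal (1 / s - n) * indicator {1 / m..1 / n} s \<partial>lborel)"
    using mn by (subst nn_integral_add) (auto simp: nn_integral_cmult_indicator)
  also have "(\<integral>\<^sup>+s. ennreal (1 / s - n) * indicator {1 / m..1 / n} s \<partial>lborel) = ennreal ((ln (1 / n) - n * (1 / n)) - (ln (1 / m) - n * (1 / m)))"
  proof (rule nn_integral_FTC_Icc)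
    fix s assume "s \<in> {1 / m..1 / n}"
    then have s: "1 / m \<le> s" "s \<le> 1 / n" by auto
    then have s0: "0 < s" using mn' by linarith
    show "((\<lambda>s. ln s - n * s) has_real_derivative 1 / s - n) (at s)"
      using s0 by (auto intro!: derivative_eq_intros)
    show "0 \<le> 1 / s - n" using s s0 mn by (simp add: field_simps)
  qed (use mn' in auto)
  also have "ennreal (m - n) * ennreal (1 / m) + \<dots> = ennreal (ln (m / n))"
  proof -
    have "0 \<le> ln (m / n) - 1 + n / m"
    proof -
      have "ln (n / m) \<le> n / m - 1" using mn by (intro ln_le_minus_one) auto
      then show ?thesis using mn by (simp add: ln_div)
    qed
    \<comment> \<open>The remainder \<open>- 1 + n / m\<close> cancels against the contribution
      \<open>1 - n / m\<close> of the levels up to \<open>1 / m\<close>, leaving exactly the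
      logarithm.\<close>
    moreover have "(ln (1 / n) - n * (1 / n)) - (ln (1 / m) - n * (1 / m)) = ln (m / n) - 1 + n / m"
      using mn by (simp add: ln_div)
    moreover have "(m - n) * (1 / m) = 1 - n / m" "0 \<le> 1 - n / m" using mn by (auto simp: field_simps)
    ultimately show ?thesis using mn by (simp add: ennreal_mult[symmetric] ennreal_plus[symmetric] del: ennreal_plus)
  qed
  finally show ?thesis by (simp add: m_def n_def)
qed

lemma condenser_inequality:
  fixes a b :: real
  defines "X \<equiv> {x. a < \<bar>u x\<bar> \<and> \<bar>u x\<bar> < b}"
  assumes ab: "0 \<le> a" "a < b" and nb: "0 < nu b"
  shows "ennreal (4 * pi * (b - a)\<^sup>2) \<le>
    (\<integral>\<^sup>+x. ennreal ((norm (G x))\<^sup>2) * indicator X x \<partial>lborel) * ennreal (ln (mu a / nu b))"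
proof -
  have [measurable]: "X \<in> sets borel" unfolding X_def by measurable
  define f g where "f x = ennreal (norm (G x)) * indicator X x" and "g x = ennreal (1 / sqrt (nu \<bar>u x\<bar>)) * indicator X x" for x
  have [measurable]: "f \<in> borel_measurable lborel" "g \<in> borel_measurable lborel" unfolding f_def g_def by measurable
  have "ennreal (4 * pi * (b - a)\<^sup>2) = (ennreal (2 * sqrt pi * (b - a)))\<^sup>2"
    using ab by (simp add: ennreal_power power_mult_distrib)
  also have "\<dots> \<le> (\<integral>\<^sup>+x. f x * g x \<partial>lborel)\<^sup>2"
    using weighted_isoperimetric[OF ab nb] unfolding X_def[symmetric]
    by (intro power_mono) (auto simp: f_def g_def indicator_def intro: order_trans intro!: nn_integral_mono)
  also have "\<dots> \<le> (\<integral>\<^sup>+x. (f x)\<^sup>2 \<partial>lborel) * (\<integral>\<^sup>+x. (g x)\<^sup>2 \<partial>lborel)"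
    by (rule Cauchy_Schwarz_nn_integral) auto
  also have "(\<integral>\<^sup>+x. (f x)\<^sup>2 \<partial>lborel) = (\<integral>\<^sup>+x. ennreal ((norm (G x))\<^sup>2) * indicator X x \<partial>lborel)"
    by (intro nn_integral_cong) (auto simp: f_def indicator_def ennreal_power)
  also have "(\<integral>\<^sup>+x. (g x)\<^sup>2 \<partial>lborel) = (\<integral>\<^sup>+x. ennreal (1 / nu \<bar>u x\<bar>) * indicator X x \<partial>lborel)"
    by (intro nn_integral_cong) (auto simp: g_def indicator_def ennreal_power power_divide)
  finally show ?thesis
    using integral_inverse_nu_le[OF ab nb] unfolding X_def[symmetric]
    by (rule order_trans[OF _ mult_left_mono]) simp
qed

lemma bounded_u: obtains M where "0 < M" "\<And>x. \<bar>u x\<bar> \<le> M"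
proof -
  obtain R where R: "0 < R" "\<And>x. R < norm x \<Longrightarrow> u x = 0" using support_radius by blast
  have "compact (u ` cball 0 R)" by (intro compact_continuous_image continuous_on_subset[OF cont_u]) auto
  then obtain M where M: "0 < M" "\<And>x. norm x \<le> R \<Longrightarrow> \<bar>u x\<bar> \<le> M"
    by (auto simp: bounded_pos dest!: compact_imp_bounded)
  have "\<bar>u x\<bar> \<le> M" for x using M R by (cases "norm x \<le> R") auto
  then show ?thesis using that M(1) by blast
qed

lemma mu_antimono: "0 \<le> l \<Longrightarrow> l \<le> l' \<Longrightarrow> mu l' \<le> mu l"
  by (subst ennreal_le_iff[symmetric], simp, subst (1 2) emeasure_superlevel(2)[symmetric])
    (auto intro!: emeasure_mono)

text \<open>The layer is open at both ends, so energies of adjacent layers are superadditive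
  whatever the gradient does on a level set. The integral is finite, hence \<open>enn2real\<close>
  loses nothing.\<close>

definition energy_below :: "real \<Rightarrow> real" where
  "energy_below l = enn2real (\<integral>\<^sup>+x. ennreal ((norm (G x))\<^sup>2) * indicator {x. 0 < \<bar>u x\<bar> \<and> \<bar>u x\<bar> < l} x \<partial>lborel)"

lemma nn_integral_energy_below:
  "(\<integral>\<^sup>+x. ennreal ((norm (G x))\<^sup>2) * indicator {x. 0 < \<bar>u x\<bar> \<and> \<bar>u x\<bar> < l} x \<partial>lborel) = ennreal (energy_below l)"
proof -
  obtain B where B: "0 < B" "\<And>x. norm (G x) \<le> B" using bounded_G by blast
  have "(\<integral>\<^sup>+x. ennreal ((norm (G x))\<^sup>2) * indicator {x. 0 < \<bar>u x\<bar> \<and> \<bar>u x\<bar> < l} x \<partial>lborel) \<le>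
    (\<integral>\<^sup>+x. ennreal (B\<^sup>2) * indicator {x. 0 < \<bar>u x\<bar>} x \<partial>lborel)"
    using B by (intro nn_integral_mono) (auto simp: indicator_def intro!: ennreal_leI power_mono)
  also have "\<dots> = ennreal (B\<^sup>2 * mu 0)"
    by (simp add: nn_integral_cmult_indicator emeasure_superlevel ennreal_mult del: zero_less_abs_iff)
  finally show ?thesis unfolding energy_below_def by (subst ennreal_enn2real) (auto simp: le_less_trans)
qed

lemma energy_below_nonneg[simp]: "0 \<le> energy_below l" by (simp add: energy_below_def)

lemma energy_below_add_le:
  assumes "0 \<le> a" "a < b" "b \<le> c"
  shows "(\<integral>\<^sup>+x. ennreal ((norm (G x))\<^sup>2) * indicator {x. a < \<bar>u x\<bar> \<and> \<bar>u x\<bar> < b} x \<partial>lborel) \<le> ennreal (energy_below c - energy_below a)"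
    (is "?I \<le> _")
proof -
  have "ennreal (energy_below a) + ?I = (\<integral>\<^sup>+x. ennreal ((norm (G x))\<^sup>2) * indicator {x. 0 < \<bar>u x\<bar> \<and> \<bar>u x\<bar> < a} x +
     ennreal ((norm (G x))\<^sup>2) * indicator {x. a < \<bar>u x\<bar> \<and> \<bar>u x\<bar> < b} x \<partial>lborel)"
    unfolding nn_integral_energy_below[symmetric] by (rule nn_integral_add[symmetric]) measurable
  also have "\<dots> \<le> ennreal (energy_below c)"
    unfolding nn_integral_energy_below[symmetric] using assms by (intro nn_integral_mono) (auto simp: indicator_def)
  finally have *: "ennreal (energy_below a) + ?I \<le> ennreal (energy_below c)" .
  show ?thesis
  proof (cases ?I)
    case (real r)
    with * have "ennreal (energy_below a + r) \<le> ennreal (energy_below c)" by simp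
    then have "energy_below a + r \<le> energy_below c" by (simp only: ennreal_le_iff energy_below_nonneg)
    then show ?thesis using real by (simp add: ennreal_leI)
  qed (use * in \<open>simp add: top_unique\<close>)
qed

lemma energy_below_mono: "l \<le> l' \<Longrightarrow> energy_below l \<le> energy_below l'"
  by (subst ennreal_le_iff[symmetric], simp, unfold nn_integral_energy_below[symmetric])
    (auto simp: indicator_def intro!: nn_integral_mono)

end

section \<open>Moser's inequality in one dimension\<close>

lemma nn_integral_exp_neg:
  fixes c a :: real
  assumes "0 < c"
  shows "(\<integral>\<^sup>+t. ennreal (exp (- c * t)) * indicator {a..} t \<partial>lborel) = ennreal (exp (- c * a) / c)"
proof -
  have "((\<lambda>t. - exp (- c * t) / c) \<longlongrightarrow> 0) at_top"
  proof -
    have "LIM t at_top. - c * t :> at_bot"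
      using assms by (simp add: filterlim_ident filterlim_uminus_at_bot filterlim_tendsto_pos_mult_at_top[OF tendsto_const])
    then have "((\<lambda>t. exp (- c * t)) \<longlongrightarrow> 0) at_top" by (rule filterlim_compose[OF exp_at_bot])
    then have "((\<lambda>t. - exp (- c * t) / c) \<longlongrightarrow> - 0 / c) at_top" by (intro tendsto_intros) (use assms in auto)
    then show ?thesis by simp
  qed
  then have "(\<integral>\<^sup>+t. ennreal (exp (- c * t)) * indicator {a..} t \<partial>lborel) = ennreal (0 - (- exp (- c * a) / c))"
    using assms by (intro nn_integral_FTC_atLeast) (auto intro!: derivative_eq_intros)
  then show ?thesis by simp
qed

text \<open>\<open>F t\<close> stands for the energy of \<open>w\<close> on the interval from 0 to \<open>t\<close>; this is all that
  the one-dimensional argument uses of it.\<close>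

definition energy_pair :: "(real \<Rightarrow> real) \<Rightarrow> (real \<Rightarrow> real) \<Rightarrow> bool" where
  "energy_pair w F \<longleftrightarrow> (\<forall>t\<le>0. w t = 0 \<and> F t = 0) \<and>
     (\<forall>s t. s \<le> t \<longrightarrow> w s \<le> w t \<and> F s \<le> F t \<and> (w t - w s)\<^sup>2 \<le> (t - s) * (F t - F s))"

lemma energy_pairD:
  assumes "energy_pair w F"
  shows "t \<le> 0 \<Longrightarrow> w t = 0" "t \<le> 0 \<Longrightarrow> F t = 0" "s \<le> t \<Longrightarrow> w s \<le> w t" "s \<le> t \<Longrightarrow> F s \<le> F t"
    "s \<le> t \<Longrightarrow> (w t - w s)\<^sup>2 \<le> (t - s) * (F t - F s)" "0 \<le> w t" "0 \<le> F t" "mono w" "mono F"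
    "0 \<le> t \<Longrightarrow> (w t)\<^sup>2 \<le> t * F t"
proof -
  show 1: "t \<le> 0 \<Longrightarrow> w t = 0" "t \<le> 0 \<Longrightarrow> F t = 0" "s \<le> t \<Longrightarrow> w s \<le> w t" "s \<le> t \<Longrightarrow> F s \<le> F t"
    "s \<le> t \<Longrightarrow> (w t - w s)\<^sup>2 \<le> (t - s) * (F t - F s)" for s t
    using assms by (auto simp: energy_pair_def)
  show "0 \<le> w t" "0 \<le> F t" using 1(1)[of "min t 0"] 1(3)[of "min t 0" t] 1(2)[of "min t 0"] 1(4)[of "min t 0" t] by auto
  show "mono w" "mono F" using 1 by (auto intro: monoI)
  show "0 \<le> t \<Longrightarrow> (w t)\<^sup>2 \<le> t * F t" using 1(5)[of 0 t] 1(1,2)[of 0] by simp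
qed

lemma energy_pair_increment:
  assumes "energy_pair w F" "s \<le> t"
  shows "w t - w s \<le> sqrt ((t - s) * (F t - F s))"
  using energy_pairD(5)[OF assms] by (rule real_le_rsqrt)

lemma energy_pair_measurable:
  "energy_pair w F \<Longrightarrow> w \<in> borel_measurable borel"
  by (intro borel_measurable_mono energy_pairD)

text \<open>If \<open>t1 - (w t1)\<^sup>2 \<le> l\<close>, nearly all the energy is spent by
  \<open>t1\<close>: at most \<open>l / t1\<close> remains. So \<open>w\<close> grows by at most the
  root of \<open>d * l / t1\<close> on the next stretch of length \<open>d\<close>, too little for
  its square to keep up with \<open>t\<close>.\<close>

lemma moser_sublevel_diameter:
  assumes wF: "energy_pair w F" and F1: "\<And>t. F t \<le> 1" and l: "0 < l"
    and t: "2 * l \<le> t1" "t1 \<le> t2" and lev: "t1 - (w t1)\<^sup>2 \<le> l" "t2 - (w t2)\<^sup>2 \<le> l"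
  shows "t2 - t1 \<le> 20 * l"
proof -
  define d where "d = t2 - t1"
  have d: "0 \<le> d" using t by (simp add: d_def)
  have t1: "0 < t1" using t l by simp
  have a: "(w t1)\<^sup>2 \<le> t1 * F t1" using energy_pairD(10)[OF wF] t1 by simp
  have "t1 - l \<le> t1 * F t1" using a lev by simp
  then have b: "1 - F t1 \<le> l / t1" using t1 by (simp add: field_simps)
  have c: "(w t2 - w t1)\<^sup>2 \<le> d * (l / t1)"
  proof -
    have "(w t2 - w t1)\<^sup>2 \<le> d * (F t2 - F t1)" using energy_pairD(5)[OF wF t(2)] by (simp add: d_def)
    also have "\<dots> \<le> d * (l / t1)" using b F1[of t2] d by (intro mult_left_mono) auto
    finally show ?thesis .
  qed
  have e: "(w t1)\<^sup>2 \<le> t1" using a mult_left_mono[OF F1[of t1], of t1] t1 by linarith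
  have "(w t1 * (w t2 - w t1))\<^sup>2 \<le> t1 * (d * (l / t1))"
    unfolding power_mult_distrib using c e t1 by (intro mult_mono) auto
  also have "\<dots> = d * l" using t1 by simp
  finally have "w t1 * (w t2 - w t1) \<le> sqrt (d * l)" by (rule real_le_rsqrt)
  \<comment> \<open>The weights leave a quarter of \<open>d\<close> after the terms
    \<open>d / 4\<close> and \<open>d / 2\<close>: in the end
    \<open>d / 4 \<le> 5 * l\<close>.\<close>
  moreover have "2 * sqrt (d * l) \<le> d / 4 + 4 * l"
    using arith_geo_mean_sqrt[of "d/4" "4 * l"] d l by simp
  moreover have "(w t2)\<^sup>2 = (w t1)\<^sup>2 + 2 * (w t1 * (w t2 - w t1)) + (w t2 - w t1)\<^sup>2"
    by (simp add: power2_eq_square algebra_simps)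
  moreover have "d * (l / t1) \<le> d / 2"
  proof -
    have "l / t1 \<le> 1 / 2" using t t1 by (simp add: field_simps)
    then show ?thesis using mult_left_mono[OF _ d] by fastforce
  qed
  ultimately have "t2 - l \<le> t1 + (d / 4 + 4 * l) + d / 2" using lev e c by linarith
  then show ?thesis by (simp add: d_def field_simps)
qed

text \<open>Layer cake with exponential weight: \<open>exp (- (t - (w t)\<^sup>2))\<close> is the
  integral of \<open>exp (- l)\<close> over \<open>l \<ge> t - (w t)\<^sup>2\<close>. It remains to
  integrate \<open>exp (- l)\<close> times the length of \<open>E l\<close>. That length is at most
  \<open>42 * l\<close>, since \<open>2 * l\<close> comes from the start and \<open>40 * l\<close>
  from the diameter bound; \<open>l \<le> 2 * exp (l / 2)\<close> then yields
  \<open>84 * 2 = 168\<close>.\<close>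

lemma moser_inequality:
  assumes wF: "energy_pair w F" and F1: "\<And>t. F t \<le> 1"
  shows "(\<integral>\<^sup>+t. ennreal (exp ((w t)\<^sup>2 - t)) * indicator {0..} t \<partial>lborel) \<le> ennreal 168"
proof -
  have [measurable]: "w \<in> borel_measurable borel" by (rule energy_pair_measurable[OF wF])
  define E where "E l = {t. 0 \<le> t \<and> t - (w t)\<^sup>2 \<le> l}" for l
  have E_m[measurable]: "E l \<in> sets borel" for l unfolding E_def by measurable
  have pos: "0 \<le> t - (w t)\<^sup>2" if "0 \<le> t" for t
    using energy_pairD(10)[OF wF that] mult_left_mono[OF F1[of t] that] by simp
  have E_le: "emeasure lborel (E l) \<le> ennreal (42 * l)" if l: "0 < l" for l
  proof -
    \<comment> \<open>Beyond \<open>2 * l\<close> any one point \<open>t0\<close> of the set has all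
      the others within distance \<open>20 * l\<close>.\<close>
    have "\<exists>t0. E l \<subseteq> {0..2 * l} \<union> {t0 - 20 * l..t0 + 20 * l}"
    proof (cases "E l \<subseteq> {0..2 * l}")
      case False
      then obtain t0 where "t0 \<in> E l" "t0 \<notin> {0..2 * l}" by blast
      then have t0: "t0 \<in> E l" "2 * l < t0" by (auto simp: E_def)
      have "t \<in> {0..2 * l} \<union> {t0 - 20 * l..t0 + 20 * l}" if t: "t \<in> E l" for t
        using moser_sublevel_diameter[OF wF F1 l, of t t0] moser_sublevel_diameter[OF wF F1 l, of t0 t] t t0
        by (cases "t \<le> t0") (auto simp: E_def)
      then show ?thesis by blast
    qed auto
    then obtain t0 where t0: "E l \<subseteq> {0..2 * l} \<union> {t0 - 20 * l..t0 + 20 * l}" by auto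
    have "emeasure lborel (E l) \<le> emeasure lborel ({0..2 * l} \<union> {t0 - 20 * l..t0 + 20 * l})"
      by (rule emeasure_mono[OF t0]) simp
    also have "\<dots> \<le> emeasure lborel {0..2 * l} + emeasure lborel {t0 - 20 * l..t0 + 20 * l}"
      by (rule emeasure_subadditive) auto
    also have "\<dots> = ennreal (42 * l)" using l by (simp flip: ennreal_plus)
    finally show ?thesis .
  qed
  have "(\<integral>\<^sup>+t. ennreal (exp ((w t)\<^sup>2 - t)) * indicator {0..} t \<partial>lborel) =
    (\<integral>\<^sup>+t. \<integral>\<^sup>+l. ennreal (exp (- l)) * indicator {0..} l * indicator (E l) t \<partial>lborel \<partial>lborel)"
  proof (rule nn_integral_cong)
    fix t :: real
    show "ennreal (exp ((w t)\<^sup>2 - t)) * indicator {0..} t = (\<integral>\<^sup>+l. ennreal (exp (- l)) * indicator {0..} l * indicator (E l) t \<partial>lborel)"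
    proof (cases "0 \<le> t")
      case True
      have "(\<integral>\<^sup>+l. ennreal (exp (- l)) * indicator {0..} l * indicator (E l) t \<partial>lborel) =
        (\<integral>\<^sup>+l. ennreal (exp (- 1 * l)) * indicator {t - (w t)\<^sup>2..} l \<partial>lborel)"
        using pos[OF True] True by (intro nn_integral_cong) (auto simp: E_def indicator_def)
      then show ?thesis using True by (subst (asm) nn_integral_exp_neg) auto
    qed (simp add: E_def)
  qed
  also have "\<dots> = (\<integral>\<^sup>+l. \<integral>\<^sup>+t. ennreal (exp (- l)) * indicator {0..} l * indicator (E l) t \<partial>lborel \<partial>lborel)"
  proof -
    have "indicator (E l) t = (indicator {z \<in> space (lborel \<Otimes>\<^sub>M lborel). 0 \<le> snd z \<and> snd z - (w (snd z))\<^sup>2 \<le> fst z} (l, t) :: ennreal)" for l t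
      by (simp add: E_def indicator_def space_pair_measure)
    then show ?thesis by (simp only:, intro lborel_pair.Fubini'[symmetric]) measurable
  qed
  also have "\<dots> = (\<integral>\<^sup>+l. ennreal (exp (- l)) * indicator {0..} l * emeasure lborel (E l) \<partial>lborel)"
    by (intro nn_integral_cong) (subst nn_integral_cmult, auto)
  also have "\<dots> \<le> (\<integral>\<^sup>+l. ennreal 84 * (ennreal (exp (- (1/2) * l)) * indicator {0..} l) \<partial>lborel)"
  proof (rule nn_integral_mono_AE)
    show "AE l in lborel. ennreal (exp (- l)) * indicator {0..} l * emeasure lborel (E l) \<le> ennreal 84 * (ennreal (exp (- (1/2) * l)) * indicator {0..} l)"
      using AE_lborel_singleton[of "0::real"]
    proof eventually_elim
      case (elim l)
      show ?case
      proof (cases "0 < l")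
        case True
        have "ennreal (exp (- l)) * emeasure lborel (E l) \<le> ennreal (exp (- l)) * ennreal (42 * l)"
          by (intro mult_left_mono E_le[OF True]) simp
        also have "\<dots> = ennreal (exp (- l) * (42 * l))" using True by (simp add: ennreal_mult)
        also have "exp (- l) * (42 * l) \<le> 84 * exp (- (1/2) * l)"
        proof -
          have "l / 2 \<le> exp (l / 2)" using exp_ge_add_one_self[of "l / 2"] by linarith
          then have "exp (- l) * (42 * l) \<le> exp (- l) * (84 * exp (l / 2))" by (intro mult_left_mono) auto
          also have "\<dots> = 84 * exp (- (1/2) * l)" by (simp add: mult_exp_exp)
          finally show ?thesis .
        qed
        finally show ?thesis using True by (simp add: ennreal_mult' ennreal_leI)
      qed (use elim in auto)
    qed
  qed
  also have "\<dots> = ennreal 168"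
    by (subst nn_integral_cmult, simp, subst nn_integral_exp_neg) (simp_all flip: ennreal_mult)
  finally show ?thesis .
qed

section \<open>Exponential moments and the choice of the splitting point\<close>

definition exp_moment :: "real \<Rightarrow> (real \<Rightarrow> real) \<Rightarrow> real" where
  "exp_moment p f = enn2real (\<integral>\<^sup>+t. ennreal (f t powr p * exp (- t)) * indicator {0..} t \<partial>lborel)"

text \<open>The moment is the integral of a p-th power over the plane in the logarithmic variable,
  without the factor for the total area. The bound \<open>W\<close> ensures finiteness and does not
  enter any constant.\<close>

lemma nn_integral_exp_moment:
  assumes p: "0 < p" and f: "\<And>t. 0 \<le> f t" "\<And>t. f t \<le> W"
  shows "(\<integral>\<^sup>+t. ennreal (f t powr p * exp (- t)) * indicator {0..} t \<partial>lborel) = ennreal (exp_moment p f)"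
proof -
  have "(\<integral>\<^sup>+t. ennreal (f t powr p * exp (- t)) * indicator {0..} t \<partial>lborel) \<le>
      (\<integral>\<^sup>+t. ennreal (W powr p) * (ennreal (exp (- 1 * t)) * indicator {0..} t) \<partial>lborel)"
    using p f by (intro nn_integral_mono) (auto simp: indicator_def ennreal_mult'[symmetric] intro!: ennreal_leI mult_right_mono powr_mono2)
  also have "\<dots> = ennreal (W powr p)" by (subst nn_integral_cmult) (simp_all only: nn_integral_exp_neg, auto)
  finally show ?thesis unfolding exp_moment_def by (subst ennreal_enn2real) (auto simp: less_top le_less_trans)
qed

lemma exp_moment_nonneg[simp]: "0 \<le> exp_moment p f" by (simp add: exp_moment_def)

text \<open>According to whether \<open>y \<le> \<eta> * x\<close>, one summand dominates. A small
  \<eta> keeps the constant in front of the main term \<open>x\<close> close to 1, at the expense of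
  the other one.\<close>

lemma powr_add_le:
  fixes x y p \<eta> :: real
  assumes "0 \<le> x" "0 \<le> y" "0 < \<eta>" "0 < p"
  shows "(x + y) powr p \<le> (1 + \<eta>) powr p * x powr p + (1 + 1 / \<eta>) powr p * y powr p"
proof (cases "y \<le> \<eta> * x")
  case True
  then have "(x + y) powr p \<le> ((1 + \<eta>) * x) powr p" using assms by (intro powr_mono2) (auto simp: algebra_simps)
  also have "\<dots> = (1 + \<eta>) powr p * x powr p" using assms by (simp add: powr_mult)
  finally show ?thesis by (simp add: add_increasing2)
next
  case False
  then have "(x + y) powr p \<le> ((1 + 1 / \<eta>) * y) powr p" using assms by (intro powr_mono2) (auto simp: field_simps)
  also have "\<dots> = (1 + 1 / \<eta>) powr p * y powr p" using assms by (simp add: powr_mult)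
  finally show ?thesis by (simp add: add_increasing)
qed

text \<open>After division by \<open>x + y\<close> both terms lie in the unit interval, where a
  power with exponent at most 1 only increases.\<close>

lemma powr_subadditive:
  fixes x y q :: real
  assumes "0 \<le> x" "0 \<le> y" "0 < q" "q \<le> 1"
  shows "(x + y) powr q \<le> x powr q + y powr q"
proof (cases "x + y = 0")
  case False
  then have s: "0 < x + y" using assms by simp
  have le: "z / (x + y) \<le> (z / (x + y)) powr q" if "0 \<le> z" "z \<le> x + y" for z
    using powr_mono'[of q 1 "z / (x + y)"] assms that s by simp
  have "1 = x / (x + y) + y / (x + y)" using s by (simp flip: add_divide_distrib)
  also have "\<dots> \<le> (x / (x + y)) powr q + (y / (x + y)) powr q" using assms by (intro add_mono le) auto
  also have "\<dots> = (x powr q + y powr q) / (x + y) powr q" using assms by (simp add: powr_divide add_divide_distrib)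
  finally show ?thesis using s by (simp add: field_simps)
qed (use assms in auto)

text \<open>Without continuity a supremum need not be attained; half of it is. If \<open>f\<close>
  vanishes beyond \<open>a\<close>, any point serves.\<close>

lemma exists_near_maximum:
  fixes f :: "real \<Rightarrow> real"
  assumes f0: "\<And>t. 0 \<le> f t" and fK: "\<And>t. f t \<le> K"
  shows "\<exists>T\<ge>a. \<forall>t\<ge>a. f t \<le> 2 * f T"
proof (cases "\<exists>t\<ge>a. 0 < f t")
  case True
  define S where "S = (SUP t\<in>{a..}. f t)"
  have bd: "bdd_above (f ` {a..})" using fK by (intro bdd_aboveI[of _ K]) auto
  have le: "f t \<le> S" if "a \<le> t" for t unfolding S_def using that bd by (intro cSUP_upper) auto
  then have "S / 2 < S" using True by fastforce
  then have "\<exists>T\<in>{a..}. S / 2 < f T"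
    unfolding S_def by (subst (asm) less_cSUP_iff) (use bd in auto)
  then show ?thesis using le by (metis atLeast_iff less_eq_real_def mult.commute order_trans pos_divide_less_eq zero_less_numeral)
next
  case False
  then show ?thesis using f0 by (meson mult_nonneg_nonneg not_less order_refl order_trans zero_le_numeral)
qed

text \<open>The step from \<open>T0\<close> to \<open>T\<close> is made in unit steps; the energies available on them decay
  geometrically when going backwards from \<open>T\<close>.\<close>

lemma growth_before_near_maximum:
  assumes wF: "energy_pair w F" and k: "0 < k" and T: "T0 \<le> T"
    and dec: "\<And>t. T0 \<le> t \<Longrightarrow> F t * exp (- k * t) \<le> 2 * (F T * exp (- k * T))"
  shows "w T \<le> w T0 + sqrt 2 / (1 - exp (- k / 2)) * sqrt (F T)"
proof -
  define q where "q = exp (- k / 2)"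
  have q: "0 < q" "q < 1" using k by (auto simp: q_def)
  \<comment> \<open>Sum of the geometric series of the step bounds, used through the fixed-point
    equation \<open>A * q + sqrt 2 = A\<close>.\<close>
  define A where "A = sqrt 2 / (1 - q)"
  have A: "A * q + sqrt 2 = A" using q by (simp add: A_def field_simps)
  have A2: "sqrt 2 \<le> A" using q by (simp add: A_def field_simps)
  have sF: "sqrt (F t) \<le> sqrt 2 * (sqrt (F T) * exp (- k * (T - t) / 2))" if "T0 \<le> t" for t
  proof -
    have "F t = F t * exp (- k * t) * exp (k * t)" by (simp add: exp_minus field_simps)
    also have "\<dots> \<le> 2 * (F T * exp (- k * T)) * exp (k * t)" by (intro mult_right_mono dec that) simp
    also have "\<dots> = 2 * (F T * exp (- k * (T - t)))" by (simp add: algebra_simps flip: exp_add)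
    also have "exp (- k * (T - t)) = (exp (- k * (T - t) / 2))\<^sup>2" by (simp flip: exp_double)
    finally have "sqrt (F t) \<le> sqrt (2 * (F T * (exp (- k * (T - t) / 2))\<^sup>2))" by simp
    then show ?thesis by (simp add: real_sqrt_mult)
  qed
  have unit: "w t - w s \<le> sqrt (F t)" if "s \<le> t" "t \<le> s + 1" for s t
  proof -
    have "(t - s) * (F t - F s) \<le> 1 * F t"
      using that energy_pairD(4,7)[OF wF] by (intro mult_mono) (auto simp: energy_pairD(7)[OF wF])
    then show ?thesis using energy_pair_increment[OF wF that(1)] real_sqrt_le_mono order_trans by fastforce
  qed
  \<comment> \<open>Going back one unit gains the factor \<open>q\<close>. The piece next to
    \<open>T0\<close> may be shorter than a unit, which the bound by \<open>sqrt (F t)\<close>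
    covers.\<close>
  have step: "w t \<le> w T0 + A * (sqrt (F T) * exp (- k * (T - t) / 2))" if "T0 \<le> t" "t \<le> T0 + real n" for n t
    using that
  proof (induction n arbitrary: t)
    case 0
    then have "t = T0" by simp
    then show ?case using A2 energy_pairD(7)[OF wF] by (simp add: order_trans[of 0 "sqrt 2" A])
  next
    case (Suc n)
    have nn: "0 \<le> sqrt (F T) * exp (- k * (T - t) / 2)" using energy_pairD(7)[OF wF] by simp
    show ?case
    proof (cases "t \<le> T0 + 1")
      case True
      have "w t - w T0 \<le> sqrt 2 * (sqrt (F T) * exp (- k * (T - t) / 2))"
        using unit[OF Suc.prems(1) True] sF[OF Suc.prems(1)] by simp
      also have "\<dots> \<le> A * (sqrt (F T) * exp (- k * (T - t) / 2))" by (rule mult_right_mono[OF A2 nn])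
      finally show ?thesis by simp
    next
      case False
      have "w (t - 1) \<le> w T0 + A * (sqrt (F T) * exp (- k * (T - (t - 1)) / 2))"
        using Suc False by (intro Suc.IH) auto
      also have "exp (- k * (T - (t - 1)) / 2) = q * exp (- k * (T - t) / 2)"
        unfolding q_def by (simp add: algebra_simps diff_divide_distrib add_divide_distrib flip: exp_add)
      finally have "w (t - 1) \<le> w T0 + A * q * (sqrt (F T) * exp (- k * (T - t) / 2))" by (simp add: algebra_simps)
      moreover have "w t - w (t - 1) \<le> sqrt 2 * (sqrt (F T) * exp (- k * (T - t) / 2))"
        using unit[of "t - 1" t] sF[OF Suc.prems(1)] by simp
      ultimately have "w t \<le> w T0 + (A * q + sqrt 2) * (sqrt (F T) * exp (- k * (T - t) / 2))"
        by (simp add: distrib_right)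
      then show ?thesis unfolding A .
    qed
  qed
  obtain n where "T - T0 \<le> real n" using real_arch_simple by blast
  then show ?thesis using step[of T n] T by (simp add: A_def q_def)
qed

text \<open>With \<open>k = 1 / (2 * p)\<close> and \<open>s = t - T\<close>, both the energy and
  the length \<open>s\<close> grow at most like \<open>exp (k * s)\<close>. Cauchy--Schwarz makes
  the squared increment grow with rate \<open>2 * k\<close>, and its power \<open>p / 2\<close> with
  rate \<open>1 / 2\<close>, so half of the decay of \<open>exp (- t)\<close> is left for the
  integral over \<open>t \<ge> T\<close>.\<close>

lemma tail_moment_le:
  assumes wF: "energy_pair w F" and p: "0 < p" and T: "0 \<le> T" and bd: "\<And>t. w t \<le> W"
    and dec: "\<And>t. T \<le> t \<Longrightarrow> F t * exp (- t / (2 * p)) \<le> 2 * (F T * exp (- T / (2 * p)))"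
  shows "exp_moment p (\<lambda>t. w t - w (min t T)) \<le> (4 * p * F T) powr (p / 2) * (2 * exp (- T))"
proof -
  define k where "k = 1 / (2 * p)"
  have k: "0 < k" using p by (simp add: k_def)
  define f where "f t = w t - w (min t T)" for t
  have f0: "0 \<le> f t" for t using energy_pairD(3)[OF wF, of "min t T" t] by (simp add: f_def)
  have fW: "f t \<le> W" for t using bd[of t] energy_pairD(6)[OF wF, of "min t T"] by (simp add: f_def)
  have FT: "0 \<le> F T" by (rule energy_pairD(7)[OF wF])
  have pw: "f t powr p \<le> (4 * p * F T) powr (p / 2) * exp ((t - T) / 2)" if t: "T \<le> t" for t
  proof -
    define s where "s = t - T"
    have s: "0 \<le> s" using t by (simp add: s_def)
    have "F t = F t * exp (- t / (2 * p)) * exp (t / (2 * p))" by (simp add: exp_minus field_simps)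
    also have "\<dots> \<le> 2 * (F T * exp (- T / (2 * p))) * exp (t / (2 * p))" by (intro mult_right_mono dec t) simp
    also have "\<dots> = 2 * F T * exp (k * s)"
      by (simp add: k_def s_def diff_divide_distrib mult_exp_exp)
    finally have Ft: "F t \<le> 2 * F T * exp (k * s)" .
    have "k * s \<le> exp (k * s)" using exp_ge_add_one_self[of "k * s"] by linarith
    then have sk: "s \<le> 2 * p * exp (k * s)" using p by (simp add: k_def field_simps)
    have "(f t)\<^sup>2 \<le> s * (F t - F T)" using energy_pairD(5)[OF wF t] t by (simp add: f_def s_def min_def)
    also have "\<dots> \<le> (2 * p * exp (k * s)) * (2 * F T * exp (k * s))"
      using s sk Ft FT p energy_pairD(4)[OF wF t] by (intro mult_mono) auto
    also have "\<dots> = (4 * p * F T) * exp (2 * k * s)" by (simp add: mult_exp_exp algebra_simps)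
    finally have "(f t)\<^sup>2 \<le> (4 * p * F T) * exp (2 * k * s)" .
    then have "((f t)\<^sup>2) powr (p / 2) \<le> ((4 * p * F T) * exp (2 * k * s)) powr (p / 2)"
      using p by (intro powr_mono2) auto
    moreover have "((f t)\<^sup>2) powr (p / 2) = f t powr p"
      using f0[of t] by (cases "f t = 0") (auto simp: powr_powr simp flip: powr_numeral)
    moreover have "exp (2 * k * s) powr (p / 2) = exp (s / 2)" using p by (simp add: exp_powr_real k_def)
    ultimately show ?thesis using p FT by (simp add: powr_mult s_def)
  qed
  have "ennreal (exp_moment p f) = (\<integral>\<^sup>+t. ennreal (f t powr p * exp (- t)) * indicator {0..} t \<partial>lborel)"
    by (rule nn_integral_exp_moment[OF p f0 fW, symmetric])
  also have "\<dots> \<le> (\<integral>\<^sup>+t. ennreal ((4 * p * F T) powr (p / 2) * exp (- T / 2)) * (ennreal (exp (- (1/2) * t)) * indicator {T..} t) \<partial>lborel)"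
  proof (rule nn_integral_mono)
    fix t :: real
    show "ennreal (f t powr p * exp (- t)) * indicator {0..} t \<le> ennreal ((4 * p * F T) powr (p / 2) * exp (- T / 2)) * (ennreal (exp (- (1/2) * t)) * indicator {T..} t)"
    proof (cases "T \<le> t")
      case True
      have "f t powr p * exp (- t) \<le> (4 * p * F T) powr (p / 2) * exp ((t - T) / 2) * exp (- t)"
        by (intro mult_right_mono pw True) simp
      also have "\<dots> = (4 * p * F T) powr (p / 2) * exp (- T / 2) * exp (- (1/2) * t)"
        by (simp add: mult.assoc mult_exp_exp diff_divide_distrib)
      finally show ?thesis using True T by (simp add: ennreal_leI flip: ennreal_mult)
    next
      case False
      then have "f t = 0" by (simp add: f_def)
      then show ?thesis using p by simp
    qed
  qed
  also have "\<dots> = ennreal ((4 * p * F T) powr (p / 2) * exp (- T / 2)) * ennreal (exp (- (1/2) * T) / (1/2))"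
    by (subst nn_integral_cmult, simp, subst nn_integral_exp_neg) simp_all
  also have "\<dots> = ennreal ((4 * p * F T) powr (p / 2) * (2 * exp (- T)))"
    by (simp add: mult_exp_exp algebra_simps flip: ennreal_mult)
  finally show ?thesis unfolding f_def by (subst (asm) ennreal_le_iff) auto
qed

text \<open>A substitute for the triangle inequality, for squares of norms. The p-th powers are
  split first; the outer exponent \<open>2 / p\<close> is at most 1, hence subadditive, and it turns
  the constants into squares.\<close>

lemma moment_split:
  assumes wF: "energy_pair w F" and p: "2 < p" and \<eta>: "0 < \<eta>" and bd: "\<And>t. w t \<le> W"
  shows "exp_moment p w powr (2 / p) \<le>
    (1 + \<eta>)\<^sup>2 * exp_moment p (\<lambda>t. w (min t T)) powr (2 / p) +
    (1 + 1 / \<eta>)\<^sup>2 * exp_moment p (\<lambda>t. w t - w (min t T)) powr (2 / p)"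
proof -
  have [measurable]: "w \<in> borel_measurable borel" by (rule energy_pair_measurable[OF wF])
  define X Y where "X = exp_moment p (\<lambda>t. w (min t T))" and "Y = exp_moment p (\<lambda>t. w t - w (min t T))"
  have p0: "0 < p" using p by simp
  define a b where "a = (1 + \<eta>) powr p" and "b = (1 + 1 / \<eta>) powr p"
  have w0: "0 \<le> w t" for t by (rule energy_pairD(6)[OF wF])
  have d0: "0 \<le> w t - w (min t T)" for t using energy_pairD(3)[OF wF, of "min t T" t] by simp
  have dW: "w t - w (min t T) \<le> W" for t using bd[of t] w0[of "min t T"] by linarith
  have "ennreal (exp_moment p w) = (\<integral>\<^sup>+t. ennreal (w t powr p * exp (- t)) * indicator {0..} t \<partial>lborel)"
    by (rule nn_integral_exp_moment[OF p0 w0 bd, symmetric])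
  also have "\<dots> \<le> (\<integral>\<^sup>+t. ennreal a * (ennreal (w (min t T) powr p * exp (- t)) * indicator {0..} t) +
     ennreal b * (ennreal ((w t - w (min t T)) powr p * exp (- t)) * indicator {0..} t) \<partial>lborel)"
  proof (rule nn_integral_mono)
    fix t
    have "w t powr p * exp (- t) \<le> (a * w (min t T) powr p + b * (w t - w (min t T)) powr p) * exp (- t)"
      using powr_add_le[OF w0[of "min t T"] d0[of t] \<eta> p0] by (intro mult_right_mono) (simp_all add: a_def b_def)
    also have "\<dots> = a * (w (min t T) powr p * exp (- t)) + b * ((w t - w (min t T)) powr p * exp (- t))"
      by (simp add: algebra_simps)
    finally show "ennreal (w t powr p * exp (- t)) * indicator {0..} t \<le> ennreal a * (ennreal (w (min t T) powr p * exp (- t)) * indicator {0..} t) +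
     ennreal b * (ennreal ((w t - w (min t T)) powr p * exp (- t)) * indicator {0..} t)"
      by (auto simp: indicator_def a_def b_def simp flip: ennreal_mult ennreal_plus intro!: ennreal_leI)
  qed
  also have "\<dots> = ennreal a * ennreal X + ennreal b * ennreal Y"
    unfolding X_def Y_def nn_integral_exp_moment[OF p0 w0 bd, symmetric] nn_integral_exp_moment[OF p0 d0 dW, symmetric]
    by (subst nn_integral_add) (auto simp: nn_integral_cmult)
  also have "\<dots> = ennreal (a * X + b * Y)" by (simp add: a_def b_def X_def Y_def ennreal_mult)
  finally have "exp_moment p w \<le> a * X + b * Y" by (subst (asm) ennreal_le_iff) (auto simp: a_def b_def X_def Y_def)
  then have "exp_moment p w powr (2 / p) \<le> (a * X + b * Y) powr (2 / p)" using p by (intro powr_mono2) auto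
  also have "\<dots> \<le> (a * X) powr (2 / p) + (b * Y) powr (2 / p)"
    using p by (intro powr_subadditive) (auto simp: a_def b_def X_def Y_def)
  also have "(a * X) powr (2 / p) = (1 + \<eta>)\<^sup>2 * X powr (2 / p)"
    using p \<eta> by (simp add: a_def X_def powr_mult powr_powr)
  also have "(b * Y) powr (2 / p) = (1 + 1 / \<eta>)\<^sup>2 * Y powr (2 / p)"
    using p \<eta> by (simp add: b_def Y_def powr_mult powr_powr add_pos_pos)
  finally show ?thesis by (simp add: X_def Y_def)
qed

text \<open>Moser's inequality beyond a point \<open>T\<close> at which \<open>w\<close> is controlled by the energy already spent:
  \<open>(a + v)\<^sup>2 \<le> a\<^sup>2 / \<theta> + v\<^sup>2 / (1 - \<theta>)\<close>, and the energy of \<open>v\<close> leaves room for the factor \<open>1 - \<theta>\<close>.\<close>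

lemma moser_after:
  assumes wF: "energy_pair w F" and T: "0 \<le> T" and \<theta>: "0 \<le> \<theta>" "2 * \<theta> \<le> 1"
    and F1: "\<And>t. F t \<le> F T + 1 - 2 * \<theta>" and a: "(w T)\<^sup>2 \<le> c * \<theta>" and c: "0 \<le> c"
  shows "(\<integral>\<^sup>+t. ennreal (exp ((w t)\<^sup>2 - t)) * indicator {0..} t \<partial>lborel) \<le>
    ennreal (exp (c * \<theta>) + 168 * exp c)"
proof -
  have [measurable]: "w \<in> borel_measurable borel" by (rule energy_pair_measurable[OF wF])
  define r where "r = 1 - \<theta>"
  have r: "0 < r" "1 - 2 * \<theta> \<le> r" using \<theta> by (auto simp: r_def)
  \<comment> \<open>The part of \<open>w\<close> after \<open>T\<close>, extended by 0 to negative
    arguments through \<open>max s 0\<close>. Dividing the energy by \<open>r = 1 - \<theta>\<close>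
    keeps it at most 1, because \<open>1 - 2 * \<theta> \<le> r\<close>.\<close>
  define v G where "v s = (w (T + max s 0) - w T) / sqrt r" and "G s = (F (T + max s 0) - F T) / r" for s
  have vG: "energy_pair v G"
    unfolding energy_pair_def
  proof (intro conjI allI impI)
    fix s t :: real assume st: "s \<le> t"
    define s' t' where "s' = T + max s 0" and "t' = T + max t 0"
    have st': "s' \<le> t'" "t' - s' \<le> t - s" using st by (auto simp: s'_def t'_def)
    show "v s \<le> v t" "G s \<le> G t"
      using energy_pairD(3,4)[OF wF st'(1)] r unfolding v_def G_def s'_def t'_def by (auto intro!: divide_right_mono)
    have "(v t - v s)\<^sup>2 = (w t' - w s')\<^sup>2 / r"
      using r by (simp add: v_def s'_def t'_def power_divide flip: diff_divide_distrib)
    also have "\<dots> \<le> ((t' - s') * (F t' - F s')) / r"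
      using energy_pairD(5)[OF wF st'(1)] r by (intro divide_right_mono) auto
    also have "\<dots> \<le> ((t - s) * (F t' - F s')) / r"
      using st' r energy_pairD(4)[OF wF st'(1)] by (intro divide_right_mono mult_right_mono) auto
    also have "\<dots> = (t - s) * (G t - G s)" by (simp add: G_def s'_def t'_def flip: diff_divide_distrib)
    finally show "(v t - v s)\<^sup>2 \<le> (t - s) * (G t - G s)" .
  qed (auto simp: v_def G_def)
  have G1: "G s \<le> 1" for s using F1[of "T + max s 0"] r by (simp add: G_def)
  have wle: "(w t)\<^sup>2 \<le> c + (v (t - T))\<^sup>2" if t: "T \<le> t" for t
  proof -
    define y where "y = w t - w T"
    have v: "(v (t - T))\<^sup>2 = y\<^sup>2 / r" using t r by (simp add: v_def y_def power_divide max_def)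
    have "(w t)\<^sup>2 \<le> c + y\<^sup>2 / r"
    proof (cases "\<theta> = 0")
      case True
      then have "w T = 0" using a by simp
      then show ?thesis using True c by (simp add: y_def r_def)
    next
      case False
      then have \<theta>0: "0 < \<theta>" using \<theta> by simp
      have "(w t)\<^sup>2 \<le> (w T)\<^sup>2 / \<theta> + y\<^sup>2 / r"
      proof -
        \<comment> \<open>Multiplied by \<open>\<theta> * r\<close>, the two sides of the weighted
          Young inequality differ by exactly this square.\<close>
        have "0 \<le> (r * w T - \<theta> * y)\<^sup>2" by simp
        then have "\<theta> * r * (w T + y)\<^sup>2 \<le> r * (w T)\<^sup>2 + \<theta> * y\<^sup>2"
          unfolding r_def by (simp add: power2_eq_square algebra_simps)
        then show ?thesis using \<theta>0 r(1) by (simp add: y_def field_simps)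
      qed
      also have "(w T)\<^sup>2 / \<theta> \<le> c" using a \<theta>0 by (simp add: field_simps)
      finally show ?thesis by simp
    qed
    then show ?thesis unfolding v .
  qed
  have [measurable]: "v \<in> borel_measurable borel" by (rule energy_pair_measurable[OF vG])
  have "(\<integral>\<^sup>+t. ennreal (exp ((w t)\<^sup>2 - t)) * indicator {0..} t \<partial>lborel) \<le>
    (\<integral>\<^sup>+t. ennreal (exp (c * \<theta>)) * (ennreal (exp (- 1 * t)) * indicator {0..} t) +
       ennreal (exp c) * (ennreal (exp ((v (t - T))\<^sup>2 - (t - T))) * indicator {0..} (t - T)) \<partial>lborel)"
  proof (rule nn_integral_mono)
    fix t :: real
    show "ennreal (exp ((w t)\<^sup>2 - t)) * indicator {0..} t \<le> ennreal (exp (c * \<theta>)) * (ennreal (exp (- 1 * t)) * indicator {0..} t) +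
       ennreal (exp c) * (ennreal (exp ((v (t - T))\<^sup>2 - (t - T))) * indicator {0..} (t - T))"
    proof (cases "T \<le> t")
      case True
      have "exp ((w t)\<^sup>2 - t) \<le> exp (c + ((v (t - T))\<^sup>2 - (t - T)))" using wle[OF True] T by simp
      also have "\<dots> = exp c * exp ((v (t - T))\<^sup>2 - (t - T))" by (rule exp_add)
      finally have "ennreal (exp ((w t)\<^sup>2 - t)) \<le> ennreal (exp c) * ennreal (exp ((v (t - T))\<^sup>2 - (t - T)))"
        by (simp add: ennreal_leI flip: ennreal_mult)
      then show ?thesis using True T by (simp add: add_increasing)
    next
      case False
      have "(w t)\<^sup>2 \<le> c * \<theta>" 
        using energy_pairD(3)[OF wF, of t T] energy_pairD(6)[OF wF, of t] False a
        by (intro order_trans[OF power_mono a]) auto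
      then have "exp ((w t)\<^sup>2 - t) \<le> exp (c * \<theta>) * exp (- 1 * t)" by (simp add: mult_exp_exp)
      then have "ennreal (exp ((w t)\<^sup>2 - t)) \<le> ennreal (exp (c * \<theta>)) * ennreal (exp (- 1 * t))"
        by (simp add: ennreal_leI flip: ennreal_mult)
      then show ?thesis using False by (auto simp: indicator_def)
    qed
  qed
  also have "\<dots> = ennreal (exp (c * \<theta>)) * (\<integral>\<^sup>+t. ennreal (exp (- 1 * t)) * indicator {0..} t \<partial>lborel) +
    ennreal (exp c) * (\<integral>\<^sup>+t. ennreal (exp ((v (t - T))\<^sup>2 - (t - T))) * indicator {0..} (t - T) \<partial>lborel)"
    by (subst nn_integral_add; (subst nn_integral_cmult)?; (subst nn_integral_cmult)?; measurable)
  also have "(\<integral>\<^sup>+t. ennreal (exp (- 1 * t)) * indicator {0..} t \<partial>lborel) = 1"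
    by (subst nn_integral_exp_neg) auto
  also have "(\<integral>\<^sup>+t. ennreal (exp ((v (t - T))\<^sup>2 - (t - T))) * indicator {0..} (t - T) \<partial>lborel) =
      (\<integral>\<^sup>+t. ennreal (exp ((v t)\<^sup>2 - t)) * indicator {0..} t \<partial>lborel)"
    by (subst nn_integral_real_affine[of _ 1 T]) (simp_all add: algebra_simps)
  also have "ennreal (exp (c * \<theta>)) * 1 + ennreal (exp c) * \<dots> \<le> ennreal (exp (c * \<theta>)) * 1 + ennreal (exp c) * ennreal 168"
    by (intro add_left_mono mult_left_mono moser_inequality[OF vG G1]) simp
  also have "\<dots> = ennreal (exp (c * \<theta>) + 168 * exp c)"
    by (simp add: ennreal_mult mult.commute)
  finally show ?thesis .
qed

text \<open>The room between \<open>L\<close> and \<open>L1\<close> is shared out: \<eta> pays for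
  the constant of the moment splitting, and \<sigma> is the fraction of the energy that is kept as
  gain.\<close>

lemma spectral_gap_split:
  fixes L L1 :: real
  assumes "0 \<le> L" "L = 0 \<or> L < L1"
  obtains \<eta> \<sigma> where "0 < \<eta>" "0 < \<sigma>" "\<sigma> < 1"
    "\<And>N f. 0 \<le> N \<Longrightarrow> 0 \<le> f \<Longrightarrow> L1 * N \<le> f \<Longrightarrow> L * (1 + \<eta>)\<^sup>2 * N \<le> (1 - \<sigma>) * f"
proof (cases "L = 0")
  case True
  then show ?thesis using that[of 1 "1/2"] by simp
next
  case False
  \<comment> \<open>\<open>1 - \<sigma>\<close> is the midpoint of \<open>r\<close> and 1. With
    \<eta> taken from the remaining quotient, \<open>L * (1 + \<eta>)\<^sup>2\<close> equals
    \<open>(1 - \<sigma>) * L1\<close>.\<close>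
  define r \<sigma> where "r = L / L1" and "\<sigma> = (1 - r) / 2"
  have L: "0 < L" "L < L1" using assms False by auto
  have r: "0 < r" "r < 1" using L by (auto simp: r_def)
  have "1 < (1 - \<sigma>) / r" using r by (simp add: \<sigma>_def field_simps)
  then have \<eta>: "0 < sqrt ((1 - \<sigma>) / r) - 1" by simp
  have "L * (1 + (sqrt ((1 - \<sigma>) / r) - 1))\<^sup>2 * N \<le> (1 - \<sigma>) * f" if "0 \<le> N" "L1 * N \<le> f" for N f
  proof -
    have "L * (1 + (sqrt ((1 - \<sigma>) / r) - 1))\<^sup>2 = (1 - \<sigma>) * L1"
      using \<open>1 < (1 - \<sigma>) / r\<close> L by (simp add: r_def)
    then show ?thesis using r mult_left_mono[OF that(2), of "1 - \<sigma>"] by (simp add: \<sigma>_def mult.assoc)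
  qed
  then show ?thesis using that[OF \<eta>, of \<sigma>] r by (simp add: \<sigma>_def)
qed

text \<open>\<open>L\<close> and \<open>L1\<close> stand for \<open>lam\<close> and
  \<open>lambda_p\<close> in the units of the one-dimensional problem. \<open>C\<close> is fixed
  before \<open>w\<close>, \<open>F\<close> and \<open>W\<close>; this uniformity is the
  content.\<close>

theorem perturbed_moser_inequality:
  fixes p L L1 :: real
  assumes p: "2 < p" and L: "0 \<le> L" "L = 0 \<or> L < L1"
  obtains C where "\<And>w F W. energy_pair w F \<Longrightarrow> (\<And>t. w t \<le> W) \<Longrightarrow>
    (\<And>T. 0 \<le> T \<Longrightarrow> L1 * exp_moment p (\<lambda>t. w (min t T)) powr (2 / p) \<le> F T) \<Longrightarrow>
    (\<And>t. F t \<le> 1 + L * exp_moment p w powr (2 / p)) \<Longrightarrow>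
    (\<integral>\<^sup>+t. ennreal (exp ((w t)\<^sup>2 - t)) * indicator {0..} t \<partial>lborel) \<le> ennreal C"
proof -
  obtain \<eta> \<sigma> where \<eta>: "0 < \<eta>" and \<sigma>: "0 < \<sigma>" "\<sigma> < 1"
    and gap: "\<And>N f. 0 \<le> N \<Longrightarrow> 0 \<le> f \<Longrightarrow> L1 * N \<le> f \<Longrightarrow> L * (1 + \<eta>)\<^sup>2 * N \<le> (1 - \<sigma>) * f"
    using spectral_gap_split[OF L] by blast
  \<comment> \<open>Coefficient of the tail term: \<open>8 * p\<close> collects \<open>4 * p\<close>
    from the tail moment and \<open>2 powr (2 / p) \<le> 2\<close>.\<close>
  define D where "D = L * (1 + 1 / \<eta>)\<^sup>2 * (8 * p)"
  have D: "0 \<le> D" using L p by (simp add: D_def)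
  obtain T0 where T0: "0 \<le> T0" "D * exp (- (2 / p) * T0) \<le> \<sigma> / 2"
  proof -
    have "((\<lambda>t. D * exp (- (2 / p) * t)) \<longlongrightarrow> D * 0) at_top"
      using p by (intro tendsto_intros filterlim_compose[OF exp_at_bot]
        filterlim_tendsto_neg_mult_at_bot[OF tendsto_const _ filterlim_ident]) auto
    then have "\<forall>\<^sub>F t in at_top. D * exp (- (2 / p) * t) < \<sigma> / 2" using \<sigma> by (intro order_tendstoD) auto
    then have "\<forall>\<^sub>F t in at_top. 0 \<le> t \<and> D * exp (- (2 / p) * t) < \<sigma> / 2"
      using eventually_ge_at_top[of 0] by eventually_elim auto
    then obtain t where "0 \<le> t" "D * exp (- (2 / p) * t) < \<sigma> / 2"
      using eventually_happens'[OF trivial_limit_at_top_linorder] by blast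
    then show ?thesis using that[of t] by simp
  qed
  define k where "k = 1 / (2 * p)"
  have k: "0 < k" using p by (simp add: k_def)
  \<comment> \<open>In \<open>w T \<le> sqrt A * sqrt (F T)\<close> the summand
    \<open>sqrt T0\<close> is Cauchy--Schwarz up to \<open>T0\<close>, the other one the geometric
    sum of the unit steps after it. \<open>c\<close> is then such that
    \<open>A * f = c * \<theta>\<close> for \<open>\<theta> = \<sigma> * f / 4\<close>.\<close>
  define A where "A = (sqrt T0 + sqrt 2 / (1 - exp (- k / 2)))\<^sup>2"
  define c where "c = 4 * A / \<sigma>"
  have c: "0 \<le> c" using \<sigma> by (simp add: c_def A_def)
  show ?thesis
  proof (rule that[of "exp (c / 2) + 168 * exp c"])
    fix w F W
    assume wF: "energy_pair w F" and bd: "\<And>t. w t \<le> W"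
      and gap1: "\<And>T. 0 \<le> T \<Longrightarrow> L1 * exp_moment p (\<lambda>t. w (min t T)) powr (2 / p) \<le> F T"
      and con: "\<And>t. F t \<le> 1 + L * exp_moment p w powr (2 / p)"
    have F0: "0 \<le> F t" for t by (rule energy_pairD(7)[OF wF])
    define K where "K = 1 + L * exp_moment p w powr (2 / p)"
    have K: "0 \<le> K" using L by (simp add: K_def)
    \<comment> \<open>\<open>max t 0\<close> keeps the exponential at most 1 on the whole line,
      where the upper bound is required.\<close>
    have "\<exists>T\<ge>T0. \<forall>t\<ge>T0. F (max t 0) * exp (- k * max t 0) \<le> 2 * (F (max T 0) * exp (- k * max T 0))"
    proof (rule exists_near_maximum)
      fix t
      show "0 \<le> F (max t 0) * exp (- k * max t 0)" using F0 by simp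
      show "F (max t 0) * exp (- k * max t 0) \<le> K"
        using con[of "max t 0"] K k F0 mult_mono[of "F (max t 0)" K "exp (- k * max t 0)" 1] by (simp add: K_def)
    qed
    then obtain T where T: "T0 \<le> T" and dec': "\<forall>t\<ge>T0. F (max t 0) * exp (- k * max t 0) \<le> 2 * (F (max T 0) * exp (- k * max T 0))"
      by blast
    have dec: "F t * exp (- k * t) \<le> 2 * (F T * exp (- k * T))" if "T0 \<le> t" for t
    proof -
      have "max t 0 = t" "max T 0 = T" using that T T0(1) by auto
      then show ?thesis using dec' that by metis
    qed
    have Tpos: "0 \<le> T" using T T0 by simp
    define f where "f = F T"
    have f0: "0 \<le> f" using F0 by (simp add: f_def)
    define N1 N2 where "N1 = exp_moment p (\<lambda>t. w (min t T)) powr (2 / p)"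
      and "N2 = exp_moment p (\<lambda>t. w t - w (min t T)) powr (2 / p)"
    have N2: "N2 \<le> 8 * p * f * exp (- (2 / p) * T)"
    proof -
      have "exp_moment p (\<lambda>t. w t - w (min t T)) \<le> (4 * p * F T) powr (p / 2) * (2 * exp (- T))"
        using p by (intro tail_moment_le[OF wF _ Tpos bd]) (use dec T in \<open>auto simp: k_def\<close>)
      then have "N2 \<le> ((4 * p * F T) powr (p / 2) * (2 * exp (- T))) powr (2 / p)"
        unfolding N2_def using p by (intro powr_mono2) auto
      also have "\<dots> = (4 * p * f) * (2 powr (2 / p) * exp (- (2 / p) * T))"
        using p f0 by (simp add: powr_mult powr_powr f_def exp_powr_real mult.commute)
      also have "\<dots> \<le> (4 * p * f) * (2 * exp (- (2 / p) * T))"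
        using p f0 powr_mono[of "2 / p" 1 2] by (intro mult_left_mono mult_right_mono) auto
      finally show ?thesis by simp
    qed
    have Fle: "F t \<le> 1 + (1 - \<sigma> / 2) * f" for t
    proof -
      have "F t \<le> 1 + L * ((1 + \<eta>)\<^sup>2 * N1 + (1 + 1 / \<eta>)\<^sup>2 * N2)"
        using con[of t] mult_left_mono[OF moment_split[OF wF p \<eta> bd, of T] L(1)] by (simp add: N1_def N2_def)
      also have "\<dots> = 1 + L * (1 + \<eta>)\<^sup>2 * N1 + L * (1 + 1 / \<eta>)\<^sup>2 * N2" by (simp add: algebra_simps)
      also have "L * (1 + \<eta>)\<^sup>2 * N1 \<le> (1 - \<sigma>) * f"
        using gap1[OF Tpos] f0 by (intro gap) (auto simp: N1_def f_def)
      also have "L * (1 + 1 / \<eta>)\<^sup>2 * N2 \<le> L * (1 + 1 / \<eta>)\<^sup>2 * (8 * p * f * exp (- (2 / p) * T))"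
        using L by (intro mult_left_mono N2) auto
      also have "\<dots> = D * exp (- (2 / p) * T) * f" by (simp add: D_def)
      also have "\<dots> \<le> D * exp (- (2 / p) * T0) * f"
        using D T p f0 by (intro mult_right_mono mult_left_mono) (auto intro!: divide_right_mono)
      also have "\<dots> \<le> \<sigma> / 2 * f" using f0 by (intro mult_right_mono T0)
      finally show ?thesis by (simp add: algebra_simps)
    qed
    define \<theta> where "\<theta> = \<sigma> * f / 4"
    \<comment> \<open>At \<open>t = T\<close> itself the energy bound reads
      \<open>\<sigma> * f / 2 \<le> 1\<close>.\<close>
    have \<theta>: "0 \<le> \<theta>" "2 * \<theta> \<le> 1" using \<sigma> f0 Fle[of T] by (auto simp: \<theta>_def f_def algebra_simps)
    have "w T \<le> sqrt A * sqrt f"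
    proof -
      have "w T \<le> w T0 + sqrt 2 / (1 - exp (- k / 2)) * sqrt f"
        unfolding f_def by (rule growth_before_near_maximum[OF wF k T dec])
      also have "w T0 \<le> sqrt (T0 * F T0)" using energy_pairD(10)[OF wF T0(1)] by (rule real_le_rsqrt)
      also have "\<dots> \<le> sqrt T0 * sqrt f"
        using energy_pairD(4)[OF wF T] T0(1) unfolding real_sqrt_mult f_def by (intro mult_left_mono) auto
      finally show ?thesis using k T0 by (simp add: A_def distrib_right)
    qed
    then have "(w T)\<^sup>2 \<le> (sqrt A * sqrt f)\<^sup>2" by (intro power_mono energy_pairD(6)[OF wF])
    also have "\<dots> = c * \<theta>" using f0 \<sigma> by (simp add: power_mult_distrib A_def c_def \<theta>_def)
    finally have "(w T)\<^sup>2 \<le> c * \<theta>" .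
    moreover have "F t \<le> F T + 1 - 2 * \<theta>" for t using Fle[of t] by (simp add: f_def \<theta>_def algebra_simps)
    ultimately have "(\<integral>\<^sup>+t. ennreal (exp ((w t)\<^sup>2 - t)) * indicator {0..} t \<partial>lborel) \<le> ennreal (exp (c * \<theta>) + 168 * exp c)"
      using wF Tpos \<theta> c by (intro moser_after) auto
    also have "\<dots> \<le> ennreal (exp (c / 2) + 168 * exp c)"
      using mult_left_mono[OF \<theta>(2), of "c / 2"] c by (intro ennreal_leI) simp
    finally show "(\<integral>\<^sup>+t. ennreal (exp ((w t)\<^sup>2 - t)) * indicator {0..} t \<partial>lborel) \<le> ennreal (exp (c / 2) + 168 * exp c)" .
  qed
qed

section \<open>Radial competitors\<close>

lemma emeasure_ball_plane: "0 \<le> r \<Longrightarrow> emeasure lborel (ball (0 :: plane) r) = ennreal (pi * r\<^sup>2)"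
  using emeasure_ball[of r "0 :: plane"] by (simp add: unit_ball_vol_2)

text \<open>The \<open>t\<close> for which \<open>pi * R\<^sup>2 * exp (- t)\<close> is the area of
  the disc around 0 through \<open>x\<close>. At the origin the value is a meaningless default, so
  that point is always excluded or treated apart.\<close>

definition log_radius :: "real \<Rightarrow> plane \<Rightarrow> real" where
  "log_radius R x = ln (R\<^sup>2 / (x \<bullet> x))"

lemma log_radius_measurable[measurable]: "log_radius R \<in> borel_measurable borel"
  unfolding log_radius_def by measurable

lemma log_radius_gt_iff:
  assumes "0 < R" "x \<noteq> 0"
  shows "t < log_radius R x \<longleftrightarrow> norm x < R * exp (- t / 2)"
proof -
  have x: "0 < x \<bullet> x" using assms by simp
  have "t < log_radius R x \<longleftrightarrow> exp t < R\<^sup>2 / (x \<bullet> x)"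
    unfolding log_radius_def using assms x by (subst exp_less_cancel_iff[symmetric]) simp
  also have "\<dots> \<longleftrightarrow> (norm x)\<^sup>2 < (R * exp (- t / 2))\<^sup>2"
    using x by (simp add: power_mult_distrib exp_minus field_simps power2_norm_eq_inner flip: exp_double)
  also have "\<dots> \<longleftrightarrow> norm x < R * exp (- t / 2)" 
    using assms by (auto intro: power_strict_mono power_less_imp_less_base[where n = 2])
  finally show ?thesis .
qed

text \<open>On a half-line both measures give the area of the disc of radius
  \<open>R * exp (- s / 2)\<close>; for negative \<open>t\<close>, where \<open>s = 0\<close>, this
  is the whole disc.\<close>

lemma distr_log_radius:
  assumes R: "0 < R"
  shows "distr (density lborel (indicator (ball 0 R - {0 :: plane}))) borel (log_radius R) =
    density lborel (\<lambda>t. ennreal (pi * R\<^sup>2 * exp (- t)) * indicator {0..} t)"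
    (is "?M = ?N")
proof (rule measure_eqI_lessThan)
  have S: "ball 0 R - {0 :: plane} \<in> sets borel" by (intro sets.Diff borel_open) auto
  fix t :: real
  define s where "s = max t 0"
  have "emeasure ?M {t<..} = emeasure (density lborel (indicator (ball 0 R - {0 :: plane}))) (log_radius R -` {t<..})"
    by (subst emeasure_distr) auto
  also have "\<dots> = (\<integral>\<^sup>+x. indicator (ball 0 R - {0 :: plane}) x * indicator (log_radius R -` {t<..}) x \<partial>lborel)"
    by (rule emeasure_density) (use S measurable_sets_borel[of "log_radius R" borel "{t<..}"] in \<open>auto intro!: borel_measurable_indicator\<close>)
  also have "\<dots> = (\<integral>\<^sup>+x. indicator (ball (0 :: plane) (R * exp (- s / 2)) - {0}) x \<partial>lborel)"
  proof (rule nn_integral_cong)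
    fix x :: plane
    show "indicator (ball 0 R - {0 :: plane}) x * indicator (log_radius R -` {t<..}) x = (indicator (ball (0 :: plane) (R * exp (- s / 2)) - {0}) x :: ennreal)"
    proof (cases "x = 0")
      case False
      have "x \<in> ball 0 R \<and> t < log_radius R x \<longleftrightarrow> x \<in> ball 0 (R * exp (- s / 2))"
        using log_radius_gt_iff[OF R False, of 0] log_radius_gt_iff[OF R False, of t] by (auto simp: s_def max_def)
      then show ?thesis using False by (auto simp: indicator_def)
    qed simp
  qed
  also have "\<dots> = emeasure lborel (ball (0 :: plane) (R * exp (- s / 2)) - {0})" by simp
  also have "\<dots> = emeasure lborel (ball (0 :: plane) (R * exp (- s / 2)))"
    by (rule emeasure_Diff_null_set) auto
  also have "\<dots> = ennreal (pi * R\<^sup>2 * exp (- s))"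
    using R by (subst emeasure_ball_plane) (auto simp: power_mult_distrib simp flip: exp_double)
  finally have M: "emeasure ?M {t<..} = ennreal (pi * R\<^sup>2 * exp (- s))" .
  then show "emeasure ?M {t<..} < \<infinity>" by simp
  have "emeasure ?N {t<..} = (\<integral>\<^sup>+t'. ennreal (pi * R\<^sup>2 * exp (- t')) * indicator {0..} t' * indicator {t<..} t' \<partial>lborel)"
    by (rule emeasure_density) auto
  also have "\<dots> = (\<integral>\<^sup>+t'. ennreal (pi * R\<^sup>2) * (ennreal (exp (- 1 * t')) * indicator {s..} t') \<partial>lborel)"
  proof (rule nn_integral_cong_AE)
    show "AE t' in lborel. ennreal (pi * R\<^sup>2 * exp (- t')) * indicator {0..} t' * indicator {t<..} t' = ennreal (pi * R\<^sup>2) * (ennreal (exp (- 1 * t')) * indicator {s..} t')"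
      using AE_lborel_singleton[of t] by eventually_elim (auto simp: s_def indicator_def ennreal_mult)
  qed
  also have "\<dots> = ennreal (pi * R\<^sup>2 * exp (- s))"
    by (subst nn_integral_cmult, simp, subst nn_integral_exp_neg) (simp_all flip: ennreal_mult)
  finally show "emeasure ?M {t<..} = emeasure ?N {t<..}" by (simp add: M)
qed auto

lemma nn_integral_radial:
  assumes R: "0 < R" and [measurable]: "g \<in> borel_measurable borel"
  shows "(\<integral>\<^sup>+x. indicator (ball (0 :: plane) R - {0}) x * g (log_radius R x) \<partial>lborel) =
    (\<integral>\<^sup>+t. ennreal (pi * R\<^sup>2 * exp (- t)) * indicator {0..} t * g t \<partial>lborel)"
proof -
  have [measurable]: "ball 0 R - {0 :: plane} \<in> sets borel" by (intro sets.Diff borel_open) auto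
  have "(\<integral>\<^sup>+x. indicator (ball (0 :: plane) R - {0}) x * g (log_radius R x) \<partial>lborel) =
    (\<integral>\<^sup>+t. g t \<partial>distr (density lborel (indicator (ball 0 R - {0 :: plane}))) borel (log_radius R))"
    by (subst nn_integral_distr, simp, simp, subst nn_integral_density) simp_all
  also have "\<dots> = (\<integral>\<^sup>+t. ennreal (pi * R\<^sup>2 * exp (- t)) * indicator {0..} t * g t \<partial>lborel)"
    unfolding distr_log_radius[OF R] by (subst nn_integral_density) auto
  finally show ?thesis .
qed

section \<open>Gradients and the homogeneous form of the variational problem\<close>

lemma C_class_Suc_0_iff:
  assumes "\<And>x. (u has_derivative (\<lambda>h. G x \<bullet> h)) (at x)"
  shows "C_class (Suc 0) u \<longleftrightarrow> continuous_on UNIV G"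
proof -
  have fd: "frechet_derivative u (at x) = (\<lambda>h. G x \<bullet> h)" for x
    using frechet_derivative_at[OF assms] by simp
  have "u differentiable_on UNIV" using assms by (auto simp: differentiable_on_def differentiable_def)
  moreover have "continuous_on UNIV G \<longleftrightarrow> (\<forall>b\<in>Basis. continuous_on UNIV (\<lambda>x. G x \<bullet> b))"
    by (rule continuous_on_componentwise)
  ultimately show ?thesis by (simp add: fd)
qed

lemma grad_eq:
  assumes "(u has_derivative (\<lambda>h. g \<bullet> h)) (at x)"
  shows "grad u x = g"
  unfolding grad_def frechet_derivative_at[OF assms, symmetric] by (rule euclidean_representation)

lemma C0_Suc_0_D:
  assumes "u \<in> C0 (Suc 0) S"
  shows "(u has_derivative (\<lambda>h. grad u x \<bullet> h)) (at x)" "continuous_on UNIV (grad u)"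
proof -
  have d: "u differentiable (at x)" for x
    using assms by (auto simp: C0_def differentiable_on_def)
  have "frechet_derivative u (at x) h = grad u x \<bullet> h" for x h
  proof -
    have "linear (frechet_derivative u (at x))" by (rule linear_frechet_derivative[OF d])
    then have "frechet_derivative u (at x) (\<Sum>b\<in>Basis. (h \<bullet> b) *\<^sub>R b) = (\<Sum>b\<in>Basis. (h \<bullet> b) * frechet_derivative u (at x) b)"
      by (simp add: linear_sum linear_cmul o_def)
    then show ?thesis by (simp add: euclidean_representation grad_def inner_sum_right mult.commute inner_commute[of _ h])
  qed
  then have "frechet_derivative u (at x) = (\<lambda>h. grad u x \<bullet> h)" for x by auto
  then show D: "(u has_derivative (\<lambda>h. grad u x \<bullet> h)) (at x)" for x
    using d[of x] frechet_derivative_works by metis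
  show "continuous_on UNIV (grad u)" using C_class_Suc_0_iff[OF D] assms by (simp add: C0_def)
qed

lemma dirichlet_energy_nonneg: "0 \<le> dirichlet_energy S u"
  unfolding dirichlet_energy_def set_lebesgue_integral_def by (rule Bochner_Integration.integral_nonneg) auto

lemma C0_Suc_0_scale:
  assumes u: "u \<in> C0 (Suc 0) S" and c: "c \<noteq> 0"
  shows "(\<lambda>x. c * u x) \<in> C0 (Suc 0) S" "dirichlet_energy S (\<lambda>x. c * u x) = c\<^sup>2 * dirichlet_energy S u"
proof -
  have D: "((\<lambda>x. c * u x) has_derivative (\<lambda>h. (c *\<^sub>R grad u x) \<bullet> h)) (at x)" for x
    by (auto intro!: derivative_eq_intros C0_Suc_0_D[OF u])
  have "{x. c * u x \<noteq> 0} = {x. u x \<noteq> 0}" using c by simp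
  then show "(\<lambda>x. c * u x) \<in> C0 (Suc 0) S"
    using u C_class_Suc_0_iff[OF D] by (auto simp: C0_def intro!: continuous_intros C0_Suc_0_D[OF u])
  show "dirichlet_energy S (\<lambda>x. c * u x) = c\<^sup>2 * dirichlet_energy S u"
    unfolding dirichlet_energy_def grad_eq[OF D] by (simp add: power_mult_distrib)
qed

text \<open>Dividing \<open>v\<close> by its norm makes it admissible. Nonnegativity of the energy
  bounds the set from below, as an infimum of reals requires.\<close>

lemma lambda_p_le:
  assumes p: "0 < p" and v: "v \<in> C0 (Suc 0) (symm_ball S)"
  shows "lambda_p p S * (Lp_norm p (symm_ball S) v)\<^sup>2 \<le> dirichlet_energy (symm_ball S) v"
proof (cases "Lp_norm p (symm_ball S) v = 0")
  case False
  define B where "B = symm_ball S"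
  define n where "n = Lp_norm p B v"
  have n: "0 < n" using False unfolding n_def B_def Lp_norm_def by (metis powr_ge_zero less_eq_real_def)
  define z where "z x = (1 / n) * v x" for x
  have z: "z \<in> C0 (Suc 0) B" "dirichlet_energy B z = (1 / n)\<^sup>2 * dirichlet_energy B v"
    unfolding z_def using C0_Suc_0_scale[OF v[folded B_def], of "1 / n"] n by auto
  have I0: "0 \<le> (LINT x:B|lborel. \<bar>v x\<bar> powr p)"
    unfolding set_lebesgue_integral_def by (rule Bochner_Integration.integral_nonneg) auto
  have "(LINT x:B|lborel. \<bar>z x\<bar> powr p) = (1 / n) powr p * (LINT x:B|lborel. \<bar>v x\<bar> powr p)"
  proof -
    have "(\<lambda>x. \<bar>z x\<bar> powr p) = (\<lambda>x. (1 / n) powr p * \<bar>v x\<bar> powr p)"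
      unfolding z_def using n by (simp add: abs_mult powr_mult[symmetric])
    then show ?thesis by simp
  qed
  then have "Lp_norm p B z = (1 / n) * Lp_norm p B v"
    unfolding Lp_norm_def using n p I0 by (simp add: powr_mult powr_powr)
  then have "Lp_norm p B z = 1" using n by (simp add: n_def)
  then have "lambda_p p S \<le> dirichlet_energy B z"
    unfolding lambda_p_def B_def[symmetric] using z
    by (intro cINF_lower bdd_belowI2[where m = 0]) (auto simp: dirichlet_energy_nonneg)
  then show ?thesis using n unfolding B_def[symmetric] n_def[symmetric] z by (simp add: field_simps)
qed (simp add: dirichlet_energy_nonneg)

definition radial :: "real \<Rightarrow> real \<Rightarrow> (real \<Rightarrow> real) \<Rightarrow> plane \<Rightarrow> real" where
  "radial R c f x = (if x = 0 then c else f (log_radius R x))"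

text \<open>Chain rule with the gradient \<open>- 2 * x / norm x ^ 2\<close> of the logarithm. At
  the origin the factor \<open>x\<close> gives 0, whatever the quotient is.\<close>

definition radial_grad :: "real \<Rightarrow> (real \<Rightarrow> real) \<Rightarrow> plane \<Rightarrow> plane" where
  "radial_grad R f' x = (- 2 * f' (log_radius R x) / (x \<bullet> x)) *\<^sub>R x"

lemma log_radius_large_near_0:
  assumes R: "0 < R"
  shows "\<forall>\<^sub>F x in nhds 0. x \<noteq> 0 \<longrightarrow> T < log_radius R x"
proof -
  have "\<forall>\<^sub>F x in nhds (0 :: plane). x \<in> ball 0 (R * exp (- T / 2))"
    using R by (intro eventually_nhds_in_open) auto
  then show ?thesis
    by eventually_elim (use log_radius_gt_iff[OF R] in auto)
qed

lemma log_radius_has_derivative: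
  assumes "0 < R" "x \<noteq> 0"
  shows "(log_radius R has_derivative (\<lambda>h. (- 2 / (x \<bullet> x)) * (x \<bullet> h))) (at x)"
proof -
  have "((\<lambda>x. ln (R\<^sup>2) - ln (x \<bullet> x)) has_derivative (\<lambda>h. (- 2 / (x \<bullet> x)) * (x \<bullet> h))) (at x)"
    using assms by (auto intro!: derivative_eq_intros simp: inner_commute field_simps)
  then show ?thesis
    by (rule has_derivative_transform_within_open[where s = "- {0}"])
      (use assms in \<open>auto simp: log_radius_def ln_div\<close>)
qed

text \<open>The logarithmic variable tends to infinity at the origin, so constancy of
  \<open>f\<close> beyond \<open>T\<close> makes the function constant near 0. Elsewhere the chain
  rule applies.\<close>

lemma radial_has_derivative:
  assumes R: "0 < R" and f: "\<And>t. (f has_real_derivative f' t) (at t)"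
    and const: "\<And>t. T \<le> t \<Longrightarrow> f t = c" "\<And>t. T \<le> t \<Longrightarrow> f' t = 0"
  shows "(radial R c f has_derivative (\<lambda>h. radial_grad R f' x \<bullet> h)) (at x)"
proof (cases "x = 0")
  case True
  have "\<forall>\<^sub>F x in nhds 0. radial R c f x = c"
    using log_radius_large_near_0[OF R, of T] by eventually_elim (auto simp: radial_def const)
  then obtain U where "open U" "0 \<in> U" "\<And>x. x \<in> U \<Longrightarrow> c = radial R c f x" by (auto simp: eventually_nhds)
  then have "(radial R c f has_derivative (\<lambda>h. 0)) (at 0)"
    by (intro has_derivative_transform_within_open[OF has_derivative_const[of c]])
  then show ?thesis using True by (simp add: radial_grad_def)
next
  case False
  have "((\<lambda>x. f (log_radius R x)) has_derivative (\<lambda>h. f' (log_radius R x) * ((- 2 / (x \<bullet> x)) * (x \<bullet> h)))) (at x)"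
    using has_derivative_compose[OF log_radius_has_derivative[OF R False], of f] f
    unfolding has_field_derivative_def by blast
  then have "(radial R c f has_derivative (\<lambda>h. f' (log_radius R x) * ((- 2 / (x \<bullet> x)) * (x \<bullet> h)))) (at x)"
    by (rule has_derivative_transform_within_open[where s = "- {0}"]) (use False in \<open>auto simp: radial_def\<close>)
  then show ?thesis by (simp add: radial_grad_def algebra_simps)
qed

lemma continuous_radial_grad:
  assumes R: "0 < R" and f': "continuous_on UNIV f'" and const: "\<And>t. T \<le> t \<Longrightarrow> f' t = 0"
  shows "continuous_on UNIV (radial_grad R f')"
proof (intro continuous_at_imp_continuous_on ballI)
  fix x :: plane
  show "isCont (radial_grad R f') x"
  proof (cases "x = 0")
    case True
    have "\<forall>\<^sub>F x in nhds 0. radial_grad R f' x = 0"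
      using log_radius_large_near_0[OF R, of T] by eventually_elim (auto simp: radial_grad_def const)
    then show ?thesis unfolding True by (subst isCont_cong) auto
  next
    case False
    have "isCont (log_radius R) x" by (rule has_derivative_continuous[OF log_radius_has_derivative[OF R False]])
    moreover have "isCont f' (log_radius R x)" using f' by (simp add: continuous_on_eq_continuous_at)
    ultimately have "isCont (\<lambda>x. f' (log_radius R x)) x" by (rule isCont_o2)
    then show ?thesis unfolding radial_grad_def using False by (intro continuous_intros) auto
  qed
qed

lemma nn_integral_radial':
  assumes R: "0 < R" and g[measurable]: "g \<in> borel_measurable borel"
    and eq: "\<And>x. x \<noteq> 0 \<Longrightarrow> norm x < R \<Longrightarrow> k x = g (log_radius R x)"
  shows "(\<integral>\<^sup>+x. k x * indicator (ball (0 :: plane) R) x \<partial>lborel) =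
    (\<integral>\<^sup>+t. ennreal (pi * R\<^sup>2 * exp (- t)) * indicator {0..} t * g t \<partial>lborel)"
  unfolding nn_integral_radial[OF R g, symmetric]
proof (rule nn_integral_cong_AE)
  show "AE x in lborel. k x * indicator (ball 0 R) x = indicator (ball 0 R - {0}) x * g (log_radius R x)"
    using AE_lborel_singleton[of "0 :: plane"] by eventually_elim (auto simp: indicator_def eq)
qed

text \<open>The planar Dirichlet energy loses its weight in the logarithmic variable: the squared
  gradient is \<open>4 * (f' t)\<^sup>2 * exp t / R\<^sup>2\<close>, and the area density cancels
  all but \<open>4 * pi\<close> times the square of \<open>f'\<close>.\<close>

lemma radial_competitor:
  assumes R: "0 < R" and p: "0 < p" and f: "\<And>t. (f has_real_derivative f' t) (at t)"
    and f': "continuous_on UNIV f'" and h: "0 < h"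
    and f0: "\<And>t. 0 \<le> f t" "\<And>t. f t \<le> c" "\<And>t. t \<le> h \<Longrightarrow> f t = 0"
    and const: "\<And>t. T \<le> t \<Longrightarrow> f t = c" "\<And>t. T \<le> t \<Longrightarrow> f' t = 0"
    and E: "(\<integral>\<^sup>+t. ennreal ((f' t)\<^sup>2) * indicator {0..} t \<partial>lborel) \<le> ennreal e" "0 \<le> e"
  shows "radial R c f \<in> C0 (Suc 0) (ball 0 R)"
    and "dirichlet_energy (ball 0 R) (radial R c f) \<le> 4 * pi * e"
    and "(Lp_norm p (ball 0 R) (radial R c f))\<^sup>2 = (pi * R\<^sup>2 * exp_moment p f) powr (2 / p)"
proof -
  have [measurable]: "f' \<in> borel_measurable borel" by (rule borel_measurable_continuous_onI[OF f'])
  have cont_f: "continuous_on UNIV f"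
    by (intro continuous_at_imp_continuous_on ballI DERIV_isCont[OF f])
  have [measurable]: "f \<in> borel_measurable borel" by (rule borel_measurable_continuous_onI[OF cont_f])
  have D: "(radial R c f has_derivative (\<lambda>h. radial_grad R f' x \<bullet> h)) (at x)" for x
    by (rule radial_has_derivative[where T = T]) (fact R f const)+
  have gr: "grad (radial R c f) x = radial_grad R f' x" for x by (rule grad_eq[OF D])
  have cont_G: "continuous_on UNIV (radial_grad R f')" by (rule continuous_radial_grad[OF R f', of T]) (rule const(2))
  have cont_v: "continuous_on UNIV (radial R c f)"
    by (intro continuous_at_imp_continuous_on ballI has_derivative_continuous[OF D])
  have [measurable]: "radial_grad R f' \<in> borel_measurable borel" "radial R c f \<in> borel_measurable borel"
    by (auto intro: borel_measurable_continuous_onI cont_G cont_v)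
  \<comment> \<open>That \<open>f\<close> vanishes up to \<open>h > 0\<close> keeps the support at a
    positive distance from the boundary circle.\<close>
  have sub: "{x. radial R c f x \<noteq> 0} \<subseteq> cball 0 (R * exp (- h / 2))"
  proof
    fix x assume x: "x \<in> {x. radial R c f x \<noteq> 0}"
    show "x \<in> cball 0 (R * exp (- h / 2))"
    proof (cases "x = 0")
      case False
      then have "h < log_radius R x" using x f0(3)[of "log_radius R x"] by (force simp: radial_def)
      then show ?thesis using log_radius_gt_iff[OF R False] by simp
    qed (use R in auto)
  qed
  have cl: "closure {x. radial R c f x \<noteq> 0} \<subseteq> cball 0 (R * exp (- h / 2))"
    by (rule closure_minimal[OF sub]) simp
  moreover have "cball (0 :: plane) (R * exp (- h / 2)) \<subseteq> ball 0 R"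
  proof
    fix x :: plane assume x: "x \<in> cball 0 (R * exp (- h / 2))"
    have "R * exp (- h / 2) < R * 1" using R h by (intro mult_strict_left_mono) auto
    then show "x \<in> ball 0 R" using x by simp
  qed
  moreover have "compact (closure {x. radial R c f x \<noteq> 0})"
    using bounded_subset[OF bounded_cball sub] by simp
  ultimately show "radial R c f \<in> C0 (Suc 0) (ball 0 R)"
    unfolding C0_def using C_class_Suc_0_iff[OF D] cont_G by blast
  have "dirichlet_energy (ball 0 R) (radial R c f) = enn2real (\<integral>\<^sup>+x. ennreal ((norm (radial_grad R f' x))\<^sup>2 * indicator (ball 0 R) x) \<partial>lborel)"
    unfolding dirichlet_energy_def set_lebesgue_integral_def gr
  proof (subst integral_eq_nn_integral)
    show "(\<lambda>x. indicat_real (ball 0 R) x *\<^sub>R (norm (radial_grad R f' x))\<^sup>2) \<in> borel_measurable lborel"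
      using borel_open[OF open_ball, of "0 :: plane" R] by measurable
  qed (auto simp: mult.commute)
  also have "\<dots> \<le> 4 * pi * e"
  proof -
    have "(\<integral>\<^sup>+x. ennreal ((norm (radial_grad R f' x))\<^sup>2 * indicator (ball 0 R) x) \<partial>lborel) =
      (\<integral>\<^sup>+x. ennreal ((norm (radial_grad R f' x))\<^sup>2) * indicator (ball 0 R) x \<partial>lborel)"
      by (intro nn_integral_cong) (auto simp: indicator_def)
    also have "\<dots> = (\<integral>\<^sup>+t. ennreal (pi * R\<^sup>2 * exp (- t)) * indicator {0..} t * ennreal (4 * (f' t)\<^sup>2 * (exp t / R\<^sup>2)) \<partial>lborel)"
    proof (rule nn_integral_radial'[OF R])
      fix x :: plane assume x: "x \<noteq> 0"
      have "exp (log_radius R x) = R\<^sup>2 / (x \<bullet> x)" using x R by (simp add: log_radius_def)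
      then have "exp (log_radius R x) / R\<^sup>2 = 1 / (x \<bullet> x)" using R by simp
      moreover have "(norm (radial_grad R f' x))\<^sup>2 = 4 * (f' (log_radius R x))\<^sup>2 * (1 / (x \<bullet> x))"
        using x by (simp add: radial_grad_def power_mult_distrib power_divide power2_norm_eq_inner power2_eq_square[of "x \<bullet> x"])
      ultimately show "ennreal ((norm (radial_grad R f' x))\<^sup>2) = ennreal (4 * (f' (log_radius R x))\<^sup>2 * (exp (log_radius R x) / R\<^sup>2))"
        by simp
    qed measurable
    also have "\<dots> = (\<integral>\<^sup>+t. ennreal (4 * pi) * (ennreal ((f' t)\<^sup>2) * indicator {0..} t) \<partial>lborel)"
    proof (rule nn_integral_cong)
      fix t
      have "pi * R\<^sup>2 * exp (- t) * (4 * (f' t)\<^sup>2 * (exp t / R\<^sup>2)) = 4 * pi * (f' t)\<^sup>2"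
        using R by (simp add: exp_minus field_simps)
      then show "ennreal (pi * R\<^sup>2 * exp (- t)) * indicator {0..} t * ennreal (4 * (f' t)\<^sup>2 * (exp t / R\<^sup>2)) =
        ennreal (4 * pi) * (ennreal ((f' t)\<^sup>2) * indicator {0..} t)"
        by (auto simp: indicator_def simp flip: ennreal_mult)
    qed
    also have "\<dots> = ennreal (4 * pi) * (\<integral>\<^sup>+t. ennreal ((f' t)\<^sup>2) * indicator {0..} t \<partial>lborel)"
      by (rule nn_integral_cmult) measurable
    also have "\<dots> \<le> ennreal (4 * pi) * ennreal e" by (rule mult_left_mono[OF E(1)]) simp
    also have "\<dots> = ennreal (4 * pi * e)" using E(2) by (simp add: ennreal_mult)
    finally have "(\<integral>\<^sup>+x. ennreal ((norm (radial_grad R f' x))\<^sup>2 * indicator (ball 0 R) x) \<partial>lborel) \<le> ennreal (4 * pi * e)" .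
    then have "enn2real (\<integral>\<^sup>+x. ennreal ((norm (radial_grad R f' x))\<^sup>2 * indicator (ball 0 R) x) \<partial>lborel) \<le> enn2real (ennreal (4 * pi * e))"
      by (rule enn2real_mono) simp
    then show ?thesis using E(2) by simp
  qed
  finally show "dirichlet_energy (ball 0 R) (radial R c f) \<le> 4 * pi * e" .
  have "(LINT x:ball 0 R|lborel. \<bar>radial R c f x\<bar> powr p) = enn2real (\<integral>\<^sup>+x. ennreal (\<bar>radial R c f x\<bar> powr p * indicator (ball 0 R) x) \<partial>lborel)"
    unfolding set_lebesgue_integral_def
  proof (subst integral_eq_nn_integral)
    show "(\<lambda>x. indicat_real (ball 0 R) x *\<^sub>R \<bar>radial R c f x\<bar> powr p) \<in> borel_measurable lborel"
      using borel_open[OF open_ball, of "0 :: plane" R] by measurable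
  qed (auto simp: mult.commute)
  also have "(\<integral>\<^sup>+x. ennreal (\<bar>radial R c f x\<bar> powr p * indicator (ball 0 R) x) \<partial>lborel) =
      (\<integral>\<^sup>+x. ennreal (\<bar>radial R c f x\<bar> powr p) * indicator (ball 0 R) x \<partial>lborel)"
    by (intro nn_integral_cong) (auto simp: indicator_def)
  also have "\<dots> = (\<integral>\<^sup>+t. ennreal (pi * R\<^sup>2 * exp (- t)) * indicator {0..} t * ennreal (f t powr p) \<partial>lborel)"
    by (rule nn_integral_radial'[OF R]) (use f0(1) in \<open>auto simp: radial_def\<close>)
  also have "\<dots> = (\<integral>\<^sup>+t. ennreal (pi * R\<^sup>2) * (ennreal (f t powr p * exp (- t)) * indicator {0..} t) \<partial>lborel)"
    by (intro nn_integral_cong) (auto simp: indicator_def ac_simps simp flip: ennreal_mult)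
  also have "\<dots> = ennreal (pi * R\<^sup>2) * (\<integral>\<^sup>+t. ennreal (f t powr p * exp (- t)) * indicator {0..} t \<partial>lborel)"
    by (rule nn_integral_cmult) measurable
  also have "\<dots> = ennreal (pi * R\<^sup>2 * exp_moment p f)"
    unfolding nn_integral_exp_moment[OF p f0(1,2)] by (simp add: ennreal_mult)
  finally have "(LINT x:ball 0 R|lborel. \<bar>radial R c f x\<bar> powr p) = pi * R\<^sup>2 * exp_moment p f" by simp
  then have "(Lp_norm p (ball 0 R) (radial R c f))\<^sup>2 = ((pi * R\<^sup>2 * exp_moment p f) powr (1 / p))\<^sup>2"
    by (simp add: Lp_norm_def)
  also have "\<dots> = (pi * R\<^sup>2 * exp_moment p f) powr (2 / p)"
    by (simp add: power2_eq_square flip: powr_add)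
  finally show "(Lp_norm p (ball 0 R) (radial R c f))\<^sup>2 = (pi * R\<^sup>2 * exp_moment p f) powr (2 / p)" .
qed

section \<open>From energy pairs to test functions\<close>

lemma energy_pair_truncate:
  assumes wF: "energy_pair w F" and T: "0 \<le> T"
  shows "energy_pair (\<lambda>t. w (min t T)) (\<lambda>t. F (min t T))"
  unfolding energy_pair_def
proof (intro conjI allI impI)
  fix s t :: real assume st: "s \<le> t"
  have m: "min s T \<le> min t T" using st by auto
  show "w (min s T) \<le> w (min t T)" "F (min s T) \<le> F (min t T)" using energy_pairD(3,4)[OF wF m] by auto
  have "(w (min t T) - w (min s T))\<^sup>2 \<le> (min t T - min s T) * (F (min t T) - F (min s T))"
    by (rule energy_pairD(5)[OF wF m])
  also have "\<dots> \<le> (t - s) * (F (min t T) - F (min s T))"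
    using energy_pairD(4)[OF wF m] st by (intro mult_right_mono) auto
  finally show "(w (min t T) - w (min s T))\<^sup>2 \<le> (t - s) * (F (min t T) - F (min s T))" .
qed (use energy_pairD[OF wF] in \<open>auto simp: min_def\<close>)

lemma energy_pair_continuous:
  assumes wF: "energy_pair w F" and K: "\<And>t. F t \<le> K"
  shows "continuous_on UNIV w"
proof (intro continuous_at_imp_continuous_on ballI)
  fix t
  have K0: "0 \<le> K" using K[of 0] energy_pairD(7)[OF wF, of 0] by linarith
  have le: "\<bar>w s - w t\<bar> \<le> sqrt (\<bar>s - t\<bar> * K)" for s
  proof -
    have *: "w b - w a \<le> sqrt ((b - a) * K)" if "a \<le> b" for a b
    proof -
      have "(b - a) * (F b - F a) \<le> (b - a) * K"
        using that K[of b] energy_pairD(7)[OF wF, of a] by (intro mult_left_mono) auto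
      then show ?thesis using energy_pair_increment[OF wF that] real_sqrt_le_mono order_trans by blast
    qed
    show ?thesis
      using *[of s t] *[of t s] energy_pairD(3)[OF wF, of s t] energy_pairD(3)[OF wF, of t s]
      by (cases "s \<le> t") auto
  qed
  have "((\<lambda>s. sqrt (\<bar>s - t\<bar> * K)) \<longlongrightarrow> sqrt (\<bar>t - t\<bar> * K)) (at t)" by (intro tendsto_intros)
  then have "((\<lambda>s. w s - w t) \<longlongrightarrow> 0) (at t)"
    by (intro Lim_null_comparison[of "\<lambda>s. w s - w t" "\<lambda>s. sqrt (\<bar>s - t\<bar> * K)"]) (use le in auto)
  then show "isCont w t" unfolding isCont_def by (rule LIM_zero_cancel)
qed

text \<open>A translation makes the two integrals cancel except over an interval of length
  \<open>h\<close> on which \<open>F\<close> has its final value. Both are cut off on the right, so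
  that the cancelled integral is finite. This plays the part of integrating a derivative of
  \<open>F\<close>.\<close>

lemma nn_integral_increment_le:
  fixes F :: "real \<Rightarrow> real"
  assumes mono: "mono F" and F0: "\<And>t. t \<le> 0 \<Longrightarrow> F t = 0" and K: "\<And>t. F t \<le> K" and const: "\<And>t. T \<le> t \<Longrightarrow> F t = K"
    and h: "0 < h" and T: "0 \<le> T"
  shows "(\<integral>\<^sup>+t. ennreal (F t - F (t - h)) \<partial>lborel) \<le> ennreal (h * K)"
proof -
  have [measurable]: "F \<in> borel_measurable borel" by (rule borel_measurable_mono[OF mono])
  have F_nn: "0 \<le> F t" for t using F0[of "min t 0"] monoD[OF mono, of "min t 0" t] by auto
  have inc: "0 \<le> F t - F (t - h)" for t using monoD[OF mono, of "t - h" t] h by simp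
  define X where "X = (\<integral>\<^sup>+t. ennreal (F t - F (t - h)) * indicator {..T + h} t \<partial>lborel)"
  define Y where "Y = (\<integral>\<^sup>+t. ennreal (F t) * indicator {..T} t \<partial>lborel)"
  have "Y \<le> (\<integral>\<^sup>+t. ennreal K * indicator {0..T} t \<partial>lborel)"
    unfolding Y_def using F0 K by (intro nn_integral_mono) (auto simp: indicator_def intro!: ennreal_leI)
  also have "\<dots> < \<infinity>" using T by (simp add: nn_integral_cmult_indicator ennreal_mult_less_top)
  finally have Y: "Y \<noteq> \<infinity>" by simp
  have "X + Y = X + (\<integral>\<^sup>+t. ennreal (F (t - h)) * indicator {..T + h} t \<partial>lborel)"
    unfolding Y_def by (subst nn_integral_real_affine[of _ 1 "- h"]) (simp_all add: algebra_simps indicator_def)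
  also have "\<dots> = (\<integral>\<^sup>+t. ennreal (F t - F (t - h)) * indicator {..T + h} t + ennreal (F (t - h)) * indicator {..T + h} t \<partial>lborel)"
    unfolding X_def by (rule nn_integral_add[symmetric]) measurable
  also have "\<dots> = (\<integral>\<^sup>+t. ennreal (F t) * indicator {..T} t + ennreal K * indicator {T<..T + h} t \<partial>lborel)"
  proof (rule nn_integral_cong)
    fix t
    have "ennreal (F t - F (t - h)) + ennreal (F (t - h)) = ennreal (F t)"
      using inc[of t] F_nn[of "t - h"] by (simp flip: ennreal_plus)
    then show "ennreal (F t - F (t - h)) * indicator {..T + h} t + ennreal (F (t - h)) * indicator {..T + h} t =
      ennreal (F t) * indicator {..T} t + ennreal K * indicator {T<..T + h} t"
      using const[of t] h by (auto simp: indicator_def)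
  qed
  also have "\<dots> = Y + ennreal K * ennreal h"
    unfolding Y_def using h by (subst nn_integral_add) (auto simp: nn_integral_cmult_indicator)
  finally have "X = ennreal K * ennreal h" using Y
    by (subst (asm) add.commute, subst (asm) ennreal_add_left_cancel) auto
  moreover have "(\<integral>\<^sup>+t. ennreal (F t - F (t - h)) \<partial>lborel) = X"
    unfolding X_def using const h by (intro nn_integral_cong) (auto simp: indicator_def)
  moreover have "0 \<le> K" using F_nn[of T] const[of T] by simp
  ultimately show ?thesis using h by (simp add: mult.commute ennreal_mult)
qed

text \<open>\<open>f\<close> is the average of \<open>w\<close> over the interval from \<open>t - 2 h\<close> to \<open>t - h\<close>; the delay makes it vanish near 0, as
  the compact support of the competitor requires.\<close>

lemma energy_pair_mollify:
  assumes wF: "energy_pair w F" and T: "0 \<le> T" and const: "\<And>t. T \<le> t \<Longrightarrow> w t = w T" "\<And>t. T \<le> t \<Longrightarrow> F t = F T"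
    and h: "0 < h" and p: "0 < p"
  obtains f f' where "\<And>t. (f has_real_derivative f' t) (at t)" "continuous_on UNIV f'"
    "\<And>t. 0 \<le> f t" "\<And>t. f t \<le> w T" "\<And>t. t \<le> h \<Longrightarrow> f t = 0"
    "\<And>t. T + 2 * h \<le> t \<Longrightarrow> f t = w T" "\<And>t. T + 2 * h \<le> t \<Longrightarrow> f' t = 0"
    "(\<integral>\<^sup>+t. ennreal ((f' t)\<^sup>2) * indicator {0..} t \<partial>lborel) \<le> ennreal (F T)"
    "exp (- 2 * h) * exp_moment p w \<le> exp_moment p f"
proof -
  have FK: "F t \<le> F T" for t using energy_pairD(4)[OF wF, of t T] const(2)[of t] by (cases "t \<le> T") auto
  have wK: "w t \<le> w T" for t using energy_pairD(3)[OF wF, of t T] const(1)[of t] by (cases "t \<le> T") auto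
  have cw: "continuous_on UNIV w" by (rule energy_pair_continuous[OF wF FK])
  have [measurable]: "w \<in> borel_measurable borel" "F \<in> borel_measurable borel"
    by (auto intro: energy_pair_measurable[OF wF] borel_measurable_mono energy_pairD(9)[OF wF])
  define W where "W t = (LBINT y=0..t. w y)" for t :: real
  have W: "(W has_real_derivative w t) (at t)" for t
  proof -
    define a b where "a = min t 0 - 1" and "b = max t 0 + 1"
    have "((\<lambda>u. LBINT y=0..u. w y) has_vector_derivative w t) (at t within {a..b})"
      unfolding zero_ereal_def
      by (rule interval_integral_FTC2) (auto simp: a_def b_def intro: continuous_on_subset[OF cw])
    moreover have "at t within {a..b} = at t" by (rule at_within_interior) (auto simp: a_def b_def)
    ultimately show ?thesis by (simp add: W_def[abs_def] has_real_derivative_iff_has_vector_derivative)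
  qed
  define f where "f t = (W (t - h) - W (t - 2 * h)) / h" for t
  define f' where "f' t = (w (t - h) - w (t - 2 * h)) / h" for t
  have f: "(f has_real_derivative f' t) (at t)" for t
    unfolding f_def f'_def using h by (auto intro!: derivative_eq_intros DERIV_chain2[OF W])
  have cf': "continuous_on UNIV f'"
    unfolding f'_def using h by (intro continuous_intros continuous_on_compose2[OF cw]) auto
  \<comment> \<open>By the mean value theorem the average is a value of \<open>w\<close> in between.
    All pointwise properties of \<open>f\<close> follow from these two bounds and
    monotonicity.\<close>
  have bd: "w (t - 2 * h) \<le> f t \<and> f t \<le> w (t - h)" for t
  proof -
    obtain z where z: "t - 2 * h < z" "z < t - h" "W (t - h) - W (t - 2 * h) = ((t - h) - (t - 2 * h)) * w z"
      using MVT2[of "t - 2 * h" "t - h" W w] h W by auto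
    then have "f t = w z" using h by (simp add: f_def)
    then show ?thesis using z energy_pairD(3)[OF wF] by auto
  qed
  show ?thesis
  proof (rule that[of f f'])
    show f0: "0 \<le> f t" for t using bd[of t] energy_pairD(6)[OF wF, of "t - 2 * h"] by linarith
    show fK: "f t \<le> w T" for t using bd[of t] wK[of "t - h"] by linarith
    show "f t = 0" if "t \<le> h" for t using bd[of t] f0[of t] energy_pairD(1)[OF wF, of "t - h"] that by auto
    show "f t = w T" if "T + 2 * h \<le> t" for t using bd[of t] const(1)[of "t - h"] const(1)[of "t - 2 * h"] that h by auto
    show "f' t = 0" if "T + 2 * h \<le> t" for t using const(1)[of "t - h"] const(1)[of "t - 2 * h"] that h by (auto simp: f'_def)
    have "(\<integral>\<^sup>+t. ennreal ((f' t)\<^sup>2) * indicator {0..} t \<partial>lborel) \<le> (\<integral>\<^sup>+t. ennreal (1 / h) * ennreal (F (t - h) - F (t - 2 * h)) \<partial>lborel)"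
    proof (rule nn_integral_mono)
      fix t
      have "(w (t - h) - w (t - 2 * h))\<^sup>2 \<le> h * (F (t - h) - F (t - 2 * h))"
        using energy_pairD(5)[OF wF, of "t - 2 * h" "t - h"] h by simp
      then have "(w (t - h) - w (t - 2 * h))\<^sup>2 / h\<^sup>2 \<le> h * (F (t - h) - F (t - 2 * h)) / h\<^sup>2"
        by (rule divide_right_mono) simp
      also have "\<dots> = 1 / h * (F (t - h) - F (t - 2 * h))" using h by (simp add: power2_eq_square)
      finally have "(f' t)\<^sup>2 \<le> 1 / h * (F (t - h) - F (t - 2 * h))"
        by (simp add: f'_def power_divide)
      then have "ennreal ((f' t)\<^sup>2) \<le> ennreal (1 / h) * ennreal (F (t - h) - F (t - 2 * h))"
        using h by (subst ennreal_mult'[symmetric]) (auto intro: ennreal_leI)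
      then show "ennreal ((f' t)\<^sup>2) * indicator {0..} t \<le> ennreal (1 / h) * ennreal (F (t - h) - F (t - 2 * h))"
        by (auto simp: indicator_def)
    qed
    also have "\<dots> = ennreal (1 / h) * (\<integral>\<^sup>+t. ennreal (F (t - h) - F (t - 2 * h)) \<partial>lborel)"
      by (rule nn_integral_cmult) measurable
    also have "(\<integral>\<^sup>+t. ennreal (F (t - h) - F (t - 2 * h)) \<partial>lborel) = (\<integral>\<^sup>+t. ennreal (F t - F (t - h)) \<partial>lborel)"
      by (subst nn_integral_real_affine[of _ 1 h]) (simp_all add: algebra_simps)
    also have "ennreal (1 / h) * \<dots> \<le> ennreal (1 / h) * ennreal (h * F T)"
      by (intro mult_left_mono nn_integral_increment_le[where T = T] energy_pairD(9)[OF wF] energy_pairD(2)[OF wF] FK const(2) h T) auto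
    also have "\<dots> = ennreal (F T)" using h by (simp flip: ennreal_mult')
    finally show "(\<integral>\<^sup>+t. ennreal ((f' t)\<^sup>2) * indicator {0..} t \<partial>lborel) \<le> ennreal (F T)" .
    \<comment> \<open>\<open>f\<close> lies above \<open>w\<close> delayed by \<open>2 * h\<close>;
      translating back costs the factor \<open>exp (- 2 * h)\<close>.\<close>
    have "ennreal (exp (- 2 * h) * exp_moment p w) = ennreal (exp (- 2 * h)) * (\<integral>\<^sup>+t. ennreal (w t powr p * exp (- t)) * indicator {0..} t \<partial>lborel)"
      unfolding nn_integral_exp_moment[OF p energy_pairD(6)[OF wF] wK] by (simp add: ennreal_mult)
    also have "\<dots> = (\<integral>\<^sup>+t. ennreal (exp (- 2 * h)) * (ennreal (w t powr p * exp (- t)) * indicator {0..} t) \<partial>lborel)"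
      by (rule nn_integral_cmult[symmetric]) measurable
    also have "\<dots> = (\<integral>\<^sup>+t. ennreal (exp (- 2 * h)) * (ennreal (w (t - 2 * h) powr p * exp (- (t - 2 * h))) * indicator {0..} (t - 2 * h)) \<partial>lborel)"
      by (subst nn_integral_real_affine[of _ 1 "- 2 * h"]) (simp_all add: algebra_simps)
    also have "\<dots> \<le> (\<integral>\<^sup>+t. ennreal (f t powr p * exp (- t)) * indicator {0..} t \<partial>lborel)"
    proof (rule nn_integral_mono)
      fix t
      have "exp (- 2 * h) * (w (t - 2 * h) powr p * exp (- (t - 2 * h))) = w (t - 2 * h) powr p * exp (- t)"
        by (simp add: exp_diff exp_minus field_simps)
      also have "\<dots> \<le> f t powr p * exp (- t)"
        using bd[of t] p energy_pairD(6)[OF wF] by (intro mult_right_mono powr_mono2) auto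
      finally show "ennreal (exp (- 2 * h)) * (ennreal (w (t - 2 * h) powr p * exp (- (t - 2 * h))) * indicator {0..} (t - 2 * h))
        \<le> ennreal (f t powr p * exp (- t)) * indicator {0..} t"
        using h by (auto simp: indicator_def intro!: ennreal_leI simp flip: ennreal_mult)
    qed
    also have "\<dots> = ennreal (exp_moment p f)" by (rule nn_integral_exp_moment[OF p f0 fK])
    finally show "exp (- 2 * h) * exp_moment p w \<le> exp_moment p f" by (subst (asm) ennreal_le_iff) auto
  qed (fact f cf')+
qed

text \<open>Truncation at \<open>T\<close> makes \<open>w\<close> and \<open>F\<close> constant from
  there on, as the averaging and the behaviour of the competitor at the origin require. The radius
  is chosen to give the disc the measure of \<open>S\<close>.\<close>

lemma lambda_p_moment_le:
  assumes S: "0 < measure lborel S" and wF: "energy_pair w F" and T: "0 \<le> T" and p: "0 < p"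
  shows "lambda_p p S * (measure lborel S * exp_moment p (\<lambda>t. w (min t T))) powr (2 / p) \<le> 4 * pi * F T"
proof (cases "0 \<le> lambda_p p S")
  case False
  then have "lambda_p p S * (measure lborel S * exp_moment p (\<lambda>t. w (min t T))) powr (2 / p) \<le> 0"
    by (intro mult_nonpos_nonneg) auto
  also have "0 \<le> 4 * pi * F T" using energy_pairD(7)[OF wF] by simp
  finally show ?thesis .
next
  case True
  define V where "V = measure lborel S"
  define R where "R = sqrt (V / pi)"
  have V: "0 < V" and R: "0 < R" and VR: "pi * R\<^sup>2 = V" and B: "symm_ball S = ball 0 R"
    using S by (auto simp: V_def R_def symm_ball_def)
  define X where "X = exp_moment p (\<lambda>t. w (min t T))"
  have X: "0 \<le> X" by (simp add: X_def)
  note tr = energy_pair_truncate[OF wF T]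
  have *: "lambda_p p S * (V * (exp (- 2 * h) * X)) powr (2 / p) \<le> 4 * pi * F T" if h: "0 < h" for h
  proof -
    obtain f f' where f: "\<And>t. (f has_real_derivative f' t) (at t)" "continuous_on UNIV f'"
      "\<And>t. 0 \<le> f t" "\<And>t. f t \<le> w (min T T)" "\<And>t. t \<le> h \<Longrightarrow> f t = 0"
      "\<And>t. T + 2 * h \<le> t \<Longrightarrow> f t = w (min T T)" "\<And>t. T + 2 * h \<le> t \<Longrightarrow> f' t = 0"
      "(\<integral>\<^sup>+t. ennreal ((f' t)\<^sup>2) * indicator {0..} t \<partial>lborel) \<le> ennreal (F (min T T))"
      and m: "exp (- 2 * h) * X \<le> exp_moment p f"
      unfolding X_def by (rule energy_pair_mollify[OF tr T _ _ h p]) auto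
    define v where "v = radial R (w (min T T)) f"
    have FT: "0 \<le> F (min T T)" by (rule energy_pairD(7)[OF wF])
    have comp: "v \<in> C0 (Suc 0) (ball 0 R)" "dirichlet_energy (ball 0 R) v \<le> 4 * pi * F (min T T)"
      "(Lp_norm p (ball 0 R) v)\<^sup>2 = (pi * R\<^sup>2 * exp_moment p f) powr (2 / p)"
      unfolding v_def by (rule radial_competitor[where h = h and T = "T + 2 * h" and f' = f' and p = p]; fact R p h f FT)+
    have "lambda_p p S * (V * (exp (- 2 * h) * X)) powr (2 / p) \<le> lambda_p p S * (pi * R\<^sup>2 * exp_moment p f) powr (2 / p)"
      unfolding VR using m p V True X by (intro mult_left_mono powr_mono2) auto
    also have "\<dots> = lambda_p p S * (Lp_norm p (symm_ball S) v)\<^sup>2"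
      unfolding B comp(3) ..
    also have "\<dots> \<le> dirichlet_energy (symm_ball S) v"
      by (rule lambda_p_le[OF p]) (unfold B, rule comp(1))
    also have "\<dots> \<le> 4 * pi * F (min T T)" unfolding B by (rule comp(2))
    finally show ?thesis by simp
  qed
  \<comment> \<open>As the averaging length tends to 0, the loss caused by the delay
    disappears.\<close>
  have "((\<lambda>h. lambda_p p S * (V * (exp (- 2 * h) * X)) powr (2 / p)) \<longlongrightarrow>
      lambda_p p S * (V * (exp (- 2 * 0) * X)) powr (2 / p)) (at_right 0)"
    using p V X by (intro tendsto_intros tendsto_powr') auto
  then have "lambda_p p S * (V * (exp (- 2 * 0) * X)) powr (2 / p) \<le> 4 * pi * F T"
    by (rule tendsto_upperbound[OF _ eventually_mono[OF eventually_at_right_less]]) (use * in auto)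
  then show ?thesis by (simp add: V_def X_def)
qed

section \<open>Rearrangement\<close>

text \<open>Decreasing rearrangement, as a function of the logarithmic variable \<open>t\<close> for which
  \<open>V * exp (- t)\<close> is the measure of the superlevel set.\<close>

locale rearrangement = C1_bump +
  fixes V :: real
  assumes V: "0 < V" and mu_le: "mu 0 \<le> V"
begin

text \<open>The generalised inverse of \<open>mu\<close> at \<open>V * exp (- t)\<close>. The level
  0 is put in so that the supremum is never taken over the empty set.\<close>

definition rearr :: "real \<Rightarrow> real" where
  "rearr t = Sup {l. l = 0 \<or> 0 \<le> l \<and> V * exp (- t) < mu l}"

lemma rearr_set_le:
  assumes M: "\<And>x. \<bar>u x\<bar> \<le> M" "l \<in> {l. l = 0 \<or> 0 \<le> l \<and> V * exp (- t) < mu l}"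
  shows "l \<le> M"
proof (rule ccontr)
  assume "\<not> l \<le> M"
  then have "{x. l < \<bar>u x\<bar>} = {}" using M(1) by (auto simp: not_less not_le intro: less_imp_le le_less_trans)
  then have "mu l = 0" by (simp add: mu_def)
  moreover have "0 \<le> M" using M(1)[of 0] by linarith
  moreover have "0 < V * exp (- t)" using V by simp
  ultimately show False using M(2) \<open>\<not> l \<le> M\<close> by auto
qed

lemma rearr_bdd: "bdd_above {l. l = 0 \<or> 0 \<le> l \<and> V * exp (- t) < mu l}"
  using rearr_set_le bounded_u by (meson bdd_above.I)

lemma rearr_le: "(\<And>x. \<bar>u x\<bar> \<le> M) \<Longrightarrow> rearr t \<le> M"
  unfolding rearr_def by (rule cSup_least, blast, rule rearr_set_le)

lemma rearr_nonneg[simp]: "0 \<le> rearr t"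
  unfolding rearr_def by (rule cSup_upper[OF _ rearr_bdd]) simp

text \<open>The implication from right to left rests on right continuity of \<open>mu\<close>: a
  strict inequality at \<open>l\<close> persists at a slightly larger level. Everything below uses
  the rearrangement through this equivalence.\<close>

lemma less_rearr_iff:
  assumes l: "0 \<le> l"
  shows "l < rearr t \<longleftrightarrow> V * exp (- t) < mu l"
proof
  assume "l < rearr t"
  then obtain l' where "l' = 0 \<or> 0 \<le> l' \<and> V * exp (- t) < mu l'" "l < l'"
    unfolding rearr_def using less_cSup_iff[OF _ rearr_bdd] by blast
  then show "V * exp (- t) < mu l" using l mu_antimono[of l l'] by auto
next
  assume *: "V * exp (- t) < mu l"
  have "\<not> (\<forall>l'>l. nu l' \<le> V * exp (- t))" using mu_le_of_nu_le[OF l, of "V * exp (- t)"] * by auto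
  then obtain l' where l': "l < l'" "V * exp (- t) < nu l'" by (auto simp: not_le)
  have "nu l' \<le> mu ((l + l') / 2)" using l l' by (intro nu_le_mu) auto
  then have "(l + l') / 2 \<le> rearr t" unfolding rearr_def using l l' by (intro cSup_upper[OF _ rearr_bdd]) auto
  then show "l < rearr t" using l' by simp
qed

lemma rearr_mono: "s \<le> t \<Longrightarrow> rearr s \<le> rearr t"
proof (rule ccontr)
  assume st: "s \<le> t" and "\<not> rearr s \<le> rearr t"
  then have "V * exp (- s) < mu (rearr t)" "\<not> V * exp (- t) < mu (rearr t)"
    using less_rearr_iff[of "rearr t" s] less_rearr_iff[of "rearr t" t] by (simp_all only: rearr_nonneg not_le less_irrefl simp_thms)
  moreover have "V * exp (- t) \<le> V * exp (- s)" using V st by simp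
  ultimately show False by linarith
qed

lemma rearr_eq_0: "t \<le> 0 \<Longrightarrow> rearr t = 0"
proof (rule ccontr)
  assume t: "t \<le> 0" and "rearr t \<noteq> 0"
  then have "0 < rearr t" using rearr_nonneg[of t] by linarith
  then have "V * exp (- t) < mu 0" by (simp add: less_rearr_iff)
  moreover have "V * 1 \<le> V * exp (- t)" using t V by (intro mult_left_mono) auto
  ultimately show False using mu_le by simp
qed

text \<open>\<open>V * exp (- s)\<close> bounds \<open>mu a\<close> from above, and
  \<open>V * exp (- t)\<close> bounds \<open>nu c\<close> strictly from below at every level
  \<open>c\<close> under \<open>b\<close>. So the condenser inequality is applied up to such
  \<open>c\<close>, and \<open>c\<close> tends to \<open>b\<close>.\<close>

lemma rearr_energy:
  assumes st: "s \<le> t"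
  shows "4 * pi * (rearr t - rearr s)\<^sup>2 \<le> (t - s) * (energy_below (rearr t) - energy_below (rearr s))"
proof (cases "rearr s = rearr t")
  case True
  then show ?thesis by simp
next
  case False
  define a b where "a = rearr s" and "b = rearr t"
  have ab: "0 \<le> a" "a < b" using False rearr_mono[OF st] by (auto simp: a_def b_def)
  have E: "0 \<le> energy_below b - energy_below a" using energy_below_mono[of a b] ab by simp
  have "4 * pi * (c - a)\<^sup>2 \<le> (t - s) * (energy_below b - energy_below a)" if c: "a < c" "c < b" for c
  proof -
    define d where "d = (c + b) / 2"
    have d: "a < d" "c < d" "d < b" using c by (auto simp: d_def)
    have m: "mu a \<le> V * exp (- s)" using less_rearr_iff[OF ab(1), of s] by (simp add: a_def)
    have "V * exp (- t) < mu d" using less_rearr_iff[of d t] d ab by (simp add: b_def)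
    also have "mu d \<le> nu c'" if "c' \<le> d" "0 < c'" for c'
      by (subst ennreal_le_iff[symmetric], simp, subst emeasure_superlevel(1)[symmetric], fact,
          subst emeasure_superlevel(2)[symmetric]) (use that in \<open>auto intro!: emeasure_mono\<close>)
    finally have n: "V * exp (- t) < nu c" using d c ab by auto
    have n0: "0 < nu c" using n V by (meson exp_gt_zero less_trans mult_pos_pos)
    have m0: "nu c \<le> mu a" using ab c by (intro nu_le_mu) auto
    have "ln (mu a / nu c) \<le> ln ((V * exp (- s)) / (V * exp (- t)))"
      using n m n0 m0 V by (intro ln_mono frac_le divide_pos_pos) auto
    also have "(V * exp (- s)) / (V * exp (- t)) = exp (t - s)" using V by (simp add: exp_diff exp_minus field_simps)
    finally have l: "ln (mu a / nu c) \<le> t - s" by simp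
    have "ennreal (4 * pi * (c - a)\<^sup>2) \<le>
      (\<integral>\<^sup>+x. ennreal ((norm (G x))\<^sup>2) * indicator {x. a < \<bar>u x\<bar> \<and> \<bar>u x\<bar> < c} x \<partial>lborel) * ennreal (ln (mu a / nu c))"
      by (rule condenser_inequality[OF ab(1) c(1) n0])
    also have "\<dots> \<le> ennreal (energy_below b - energy_below a) * ennreal (t - s)"
      by (intro mult_mono energy_below_add_le ennreal_leI l) (use ab c in auto)
    also have "\<dots> = ennreal ((t - s) * (energy_below b - energy_below a))"
      using E st by (simp add: ennreal_mult mult.commute)
    finally show ?thesis using E st by (subst (asm) ennreal_le_iff) auto
  qed
  moreover have "((\<lambda>c. 4 * pi * (c - a)\<^sup>2) \<longlongrightarrow> 4 * pi * (b - a)\<^sup>2) (at_left b)"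
    by (intro tendsto_intros)
  moreover have "\<forall>\<^sub>F c in at_left b. c \<in> {a<..<b}" by (rule eventually_at_left_real[OF ab(2)])
  ultimately have "4 * pi * (b - a)\<^sup>2 \<le> (t - s) * (energy_below b - energy_below a)"
    by (intro tendsto_upperbound[of "\<lambda>c. 4 * pi * (c - a)\<^sup>2" _ "at_left b"]) (simp_all add: eventually_mono)
  then show ?thesis by (simp add: a_def b_def)
qed

lemma energy_pair_rearr:
  "energy_pair (\<lambda>t. sqrt (4 * pi) * rearr t) (\<lambda>t. energy_below (rearr t))"
  unfolding energy_pair_def
proof (intro conjI allI impI)
  fix t :: real assume "t \<le> 0"
  moreover have "{x. 0 < \<bar>u x\<bar> \<and> \<bar>u x\<bar> < 0} = {}" by auto
  ultimately show "energy_below (rearr t) = 0" "sqrt (4 * pi) * rearr t = 0"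
    using rearr_eq_0[of t] by (auto simp: energy_below_def)
next
  fix s t :: real assume st: "s \<le> t"
  show "sqrt (4 * pi) * rearr s \<le> sqrt (4 * pi) * rearr t" by (intro mult_left_mono rearr_mono st) simp
  show "energy_below (rearr s) \<le> energy_below (rearr t)" by (intro energy_below_mono rearr_mono st)
  show "(sqrt (4 * pi) * rearr t - sqrt (4 * pi) * rearr s)\<^sup>2 \<le> (t - s) * (energy_below (rearr t) - energy_below (rearr s))"
    using rearr_energy[OF st] by (simp add: power_mult_distrib flip: right_diff_distrib)
qed

lemma rearr_measurable[measurable]: "rearr \<in> borel_measurable borel"
  by (intro borel_measurable_mono monoI rearr_mono)

text \<open>Equimeasurability, compared on half-lines. Since \<open>S\<close> contains all points
  where \<open>u\<close> is nonzero and has measure \<open>V\<close>, the zeros of \<open>u\<close>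
  in \<open>S\<close> are counted too: below level 0 both sides have total mass
  \<open>V\<close>.\<close>

lemma distr_rearr:
  assumes S[measurable]: "S \<in> sets borel" and supp: "\<And>x. u x \<noteq> 0 \<Longrightarrow> x \<in> S" and VS: "emeasure lborel S = ennreal V"
  shows "distr (density lborel (indicator S)) borel (\<lambda>x. \<bar>u x\<bar>) =
    distr (density lborel (\<lambda>t. ennreal (V * exp (- t)) * indicator {0..} t)) borel rearr"
    (is "?M = ?N")
proof (rule measure_eqI_lessThan)
  fix l :: real
  have M: "emeasure ?M {l<..} = emeasure lborel {x \<in> S. l < \<bar>u x\<bar>}"
  proof -
    have "emeasure ?M {l<..} = emeasure (density lborel (indicator S)) ((\<lambda>x. \<bar>u x\<bar>) -` {l<..})"
      by (subst emeasure_distr) auto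
    also have "\<dots> = (\<integral>\<^sup>+x. indicator S x * indicator ((\<lambda>x. \<bar>u x\<bar>) -` {l<..}) x \<partial>lborel)"
      by (rule emeasure_density) (use S measurable_sets_borel[of "\<lambda>x. \<bar>u x\<bar>" borel "{l<..}"] in \<open>auto intro!: borel_measurable_indicator\<close>)
    also have "\<dots> = (\<integral>\<^sup>+x. indicator {x \<in> S. l < \<bar>u x\<bar>} x \<partial>lborel)"
      by (intro nn_integral_cong) (auto simp: indicator_def)
    also have "\<dots> = emeasure lborel {x \<in> S. l < \<bar>u x\<bar>}" by (rule nn_integral_indicator) measurable
    finally show ?thesis .
  qed
  have "emeasure lborel {x \<in> S. l < \<bar>u x\<bar>} \<le> emeasure lborel S" by (rule emeasure_mono) auto
  then show "emeasure ?M {l<..} < \<infinity>" unfolding M by (simp add: VS le_less_trans)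
  have N: "emeasure ?N {l<..} = (\<integral>\<^sup>+t. ennreal (V * exp (- t)) * indicator {0..} t * indicator {t. l < rearr t} t \<partial>lborel)"
  proof -
    have "emeasure ?N {l<..} = emeasure (density lborel (\<lambda>t. ennreal (V * exp (- t)) * indicator {0..} t)) (rearr -` {l<..})"
      by (subst emeasure_distr) auto
    also have "rearr -` {l<..} = {t. l < rearr t}" by auto
    also have "emeasure (density lborel (\<lambda>t. ennreal (V * exp (- t)) * indicator {0..} t)) {t. l < rearr t} = 
      (\<integral>\<^sup>+t. ennreal (V * exp (- t)) * indicator {0..} t * indicator {t. l < rearr t} t \<partial>lborel)"
      by (rule emeasure_density) auto
    finally show ?thesis .
  qed
  have tail: "(\<integral>\<^sup>+t. ennreal V * (ennreal (exp (- 1 * t)) * indicator {c..} t) \<partial>lborel) = ennreal (V * exp (- c))" for c :: real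
    using V by (subst nn_integral_cmult, simp, subst nn_integral_exp_neg) (simp_all add: ennreal_mult)
  show "emeasure ?M {l<..} = emeasure ?N {l<..}"
  proof (cases "l < 0")
    case True
    then have "l < \<bar>u x\<bar>" "l < rearr t" for x t using rearr_nonneg[of t] by linarith+
    then have eqs: "{x \<in> S. l < \<bar>u x\<bar>} = S" "{t. l < rearr t} = UNIV" by auto
    have "emeasure ?N {l<..} = (\<integral>\<^sup>+t. ennreal V * (ennreal (exp (- 1 * t)) * indicator {0..} t) \<partial>lborel)"
      unfolding N eqs using V by (intro nn_integral_cong) (simp add: ennreal_mult mult.assoc)
    then show ?thesis unfolding M eqs VS tail by simp
  next
    case False
    then have l: "0 \<le> l" by simp
    have "{x \<in> S. l < \<bar>u x\<bar>} = {x. l < \<bar>u x\<bar>}" using supp l by auto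
    then have M': "emeasure ?M {l<..} = ennreal (mu l)" unfolding M using l by (simp add: emeasure_superlevel)
    show ?thesis
    proof (cases "mu l = 0")
      case True
      have "\<not> l < rearr t" for t using less_rearr_iff[OF l, of t] True V by (simp add: not_less)
      then show ?thesis unfolding M' N using True by simp
    next
      case False
      then have m: "0 < mu l" using mu_nonneg[of l] by linarith
      define c where "c = ln (V / mu l)"
      have iff: "l < rearr t \<longleftrightarrow> c < t" for t
      proof -
        have "V * exp (- t) < mu l \<longleftrightarrow> V / mu l < exp t" using m by (simp add: exp_minus field_simps)
        also have "\<dots> \<longleftrightarrow> c < t" unfolding c_def using m V by (subst exp_less_cancel_iff[symmetric]) simp
        finally show ?thesis using less_rearr_iff[OF l] by simp
      qed
      have c: "0 \<le> c" unfolding c_def using m mu_le mu_antimono[of 0 l] l by simp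
      have "emeasure ?N {l<..} = (\<integral>\<^sup>+t. ennreal V * (ennreal (exp (- 1 * t)) * indicator {c..} t) \<partial>lborel)"
        unfolding N
      proof (rule nn_integral_cong_AE)
        show "AE t in lborel. ennreal (V * exp (- t)) * indicator {0..} t * indicator {t. l < rearr t} t =
          ennreal V * (ennreal (exp (- 1 * t)) * indicator {c..} t)"
          using AE_lborel_singleton[of c]
          by eventually_elim (use V c in \<open>auto simp: iff indicator_def ennreal_mult\<close>)
      qed
      also have "\<dots> = ennreal (mu l)" unfolding tail c_def using m V by (simp add: exp_minus)
      finally show ?thesis by (simp add: M')
    qed
  qed
qed auto

lemma nn_integral_rearr:
  assumes S[measurable]: "S \<in> sets borel" and supp: "\<And>x. u x \<noteq> 0 \<Longrightarrow> x \<in> S" and VS: "emeasure lborel S = ennreal V"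
    and g[measurable]: "g \<in> borel_measurable borel"
  shows "(\<integral>\<^sup>+x. ennreal (g \<bar>u x\<bar>) * indicator S x \<partial>lborel) =
    ennreal V * (\<integral>\<^sup>+t. ennreal (g (rearr t) * exp (- t)) * indicator {0..} t \<partial>lborel)"
proof -
  have "(\<integral>\<^sup>+x. ennreal (g \<bar>u x\<bar>) * indicator S x \<partial>lborel) = (\<integral>\<^sup>+l. ennreal (g l) \<partial>distr (density lborel (indicator S)) borel (\<lambda>x. \<bar>u x\<bar>))"
    by (subst nn_integral_distr, simp, simp, subst nn_integral_density) (simp_all add: mult.commute)
  also have "\<dots> = (\<integral>\<^sup>+t. ennreal (V * exp (- t)) * indicator {0..} t * ennreal (g (rearr t)) \<partial>lborel)"
  proof -
    have "distr (density lborel (indicator S)) borel (\<lambda>x. \<bar>u x\<bar>) =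
        distr (density lborel (\<lambda>t. ennreal (V * exp (- t)) * indicator {0..} t)) borel rearr"
      by (rule distr_rearr[OF S _ VS]) (fact supp)
    then show ?thesis by (simp only:) (subst nn_integral_distr, simp, simp, subst nn_integral_density, simp_all)
  qed
  also have "\<dots> = (\<integral>\<^sup>+t. ennreal V * (ennreal (g (rearr t) * exp (- t)) * indicator {0..} t) \<partial>lborel)"
    using V by (intro nn_integral_cong) (auto simp: indicator_def ennreal_mult'' ennreal_mult' mult_ac)
  also have "\<dots> = ennreal V * (\<integral>\<^sup>+t. ennreal (g (rearr t) * exp (- t)) * indicator {0..} t \<partial>lborel)"
    by (rule nn_integral_cmult) measurable
  finally show ?thesis .
qed

end

section \<open>Reduction of the planar problem to the one-dimensional inequality\<close>

lemma measure_plane_pos: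
  fixes S :: "plane set"
  assumes "open S" "S \<noteq> {}" "bounded S"
  shows "0 < measure lborel S" "emeasure lborel S = ennreal (measure lborel S)"
proof -
  show e: "emeasure lborel S = ennreal (measure lborel S)"
    using emeasure_bounded_finite[OF assms(3)] by (intro emeasure_eq_ennreal_measure) (auto simp: less_top)
  obtain x e where x: "0 < e" "ball x e \<subseteq> S" using assms openE by blast
  have "0 < emeasure lborel (ball x e)" using x(1) by (simp add: emeasure_ball)
  also have "\<dots> \<le> emeasure lborel S" using x assms by (intro emeasure_mono) auto
  finally show "0 < measure lborel S" unfolding e by simp
qed

lemma C0_infinity_C1_bump:
  assumes u: "u \<in> C0_infinity S"
  shows "C1_bump u (grad u)" "u x \<noteq> 0 \<Longrightarrow> x \<in> S"
proof -
  have u1: "u \<in> C0 (Suc 0) S" using u by (auto simp: C0_infinity_def)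
  then have c: "compact (closure {x. u x \<noteq> 0})" "closure {x. u x \<noteq> 0} \<subseteq> S" by (auto simp: C0_def)
  show "u x \<noteq> 0 \<Longrightarrow> x \<in> S" using c(2) closure_subset[of "{x. u x \<noteq> 0}"] by blast
  have "bounded {x. u x \<noteq> 0}" by (rule bounded_subset[OF compact_imp_bounded[OF c(1)] closure_subset])
  then show "C1_bump u (grad u)" by (intro C1_bump.intro C0_Suc_0_D[OF u1])
qed

lemma set_integral_eq_enn2real:
  fixes f :: "plane \<Rightarrow> real"
  assumes [measurable]: "S \<in> sets borel" "f \<in> borel_measurable borel" and f0: "\<And>x. 0 \<le> f x"
  shows "(LINT x:S|lborel. f x) = enn2real (\<integral>\<^sup>+x. ennreal (f x) * indicator S x \<partial>lborel)"
proof -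
  have "(LINT x:S|lborel. f x) = enn2real (\<integral>\<^sup>+x. ennreal (indicator S x *\<^sub>R f x) \<partial>lborel)"
    unfolding set_lebesgue_integral_def by (rule integral_eq_nn_integral) (auto simp: f0)
  also have "(\<integral>\<^sup>+x. ennreal (indicator S x *\<^sub>R f x) \<partial>lborel) = (\<integral>\<^sup>+x. ennreal (f x) * indicator S x \<partial>lborel)"
    by (intro nn_integral_cong) (auto simp: indicator_def)
  finally show ?thesis .
qed

theorem theorem3p3:
  fixes \<Omega> :: "(real ^ 2) set" and p lam :: real
  assumes "open \<Omega>" and "connected \<Omega>" and "\<Omega> \<noteq> {}" and "bounded \<Omega>"
    and "2 < p"
    and "lam < lambda_p p \<Omega>"
  shows "(SUP u \<in> {u \<in> C0_infinity \<Omega>.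
              dirichlet_energy \<Omega> u - lam * (Lp_norm p \<Omega> u)\<^sup>2 \<le> 1}.
            \<integral>\<^sup>+ x \<in> \<Omega>. ennreal (exp (4 * pi * (u x)\<^sup>2)) \<partial>lborel) < \<infinity>"
proof -
  define V where "V = measure lborel \<Omega>"
  have V: "0 < V" and VO: "emeasure lborel \<Omega> = ennreal V"
    using measure_plane_pos assms by (auto simp: V_def)
  have O[measurable]: "\<Omega> \<in> sets borel" using assms by simp
  have p: "0 < p" using assms by simp
  \<comment> \<open>Conversion factor between the squared norm of \<open>u\<close> and the moment of
    \<open>w\<close>: the area enters with the power \<open>2 / p\<close>, and \<open>4 * pi\<close>
    undoes the scaling of \<open>w\<close>.\<close>
  define k where "k = V powr (2 / p) / (4 * pi)"
  have k: "0 < k" using V by (simp add: k_def)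
  \<comment> \<open>A negative \<open>lam\<close> is replaced by 0, which only weakens the
    constraint on \<open>u\<close>; the gap condition then holds through
    \<open>L = 0\<close>.\<close>
  define L L1 where "L = max lam 0 * k" and "L1 = lambda_p p \<Omega> * k"
  have "0 \<le> L" "L = 0 \<or> L < L1" using k assms by (auto simp: L_def L1_def max_def)
  with assms(5) obtain C where C: "\<And>w F W. energy_pair w F \<Longrightarrow> (\<And>t. w t \<le> W) \<Longrightarrow>
    (\<And>T. 0 \<le> T \<Longrightarrow> L1 * exp_moment p (\<lambda>t. w (min t T)) powr (2 / p) \<le> F T) \<Longrightarrow>
    (\<And>t. F t \<le> 1 + L * exp_moment p w powr (2 / p)) \<Longrightarrow>
    (\<integral>\<^sup>+t. ennreal (exp ((w t)\<^sup>2 - t)) * indicator {0..} t \<partial>lborel) \<le> ennreal C"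
    using perturbed_moser_inequality[of p L L1] by blast
  have bound: "(\<integral>\<^sup>+ x \<in> \<Omega>. ennreal (exp (4 * pi * (u x)\<^sup>2)) \<partial>lborel) \<le> ennreal V * ennreal C"
    if u: "u \<in> C0_infinity \<Omega>" and con: "dirichlet_energy \<Omega> u - lam * (Lp_norm p \<Omega> u)\<^sup>2 \<le> 1" for u
  proof -
    interpret C1_bump u "grad u" by (rule C0_infinity_C1_bump[OF u])
    have supp: "x \<in> \<Omega>" if "u x \<noteq> 0" for x by (rule C0_infinity_C1_bump(2)[OF u that])
    have "emeasure lborel {x. 0 < \<bar>u x\<bar>} \<le> emeasure lborel \<Omega>" using supp by (intro emeasure_mono) auto
    then have "mu 0 \<le> V" using V by (simp add: emeasure_superlevel VO del: zero_less_abs_iff)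
    then interpret rearrangement u "grad u" V using V by unfold_locales
    define w F where "w t = sqrt (4 * pi) * rearr t" and "F t = energy_below (rearr t)" for t
    have wF: "energy_pair w F" unfolding w_def F_def by (rule energy_pair_rearr)
    obtain M where M: "\<And>x. \<bar>u x\<bar> \<le> M" using bounded_u by blast
    have wM: "w t \<le> sqrt (4 * pi) * M" for t unfolding w_def by (intro mult_left_mono rearr_le M) simp
    have tr: "(\<integral>\<^sup>+x. ennreal (g \<bar>u x\<bar>) * indicator \<Omega> x \<partial>lborel) =
        ennreal V * (\<integral>\<^sup>+t. ennreal (g (rearr t) * exp (- t)) * indicator {0..} t \<partial>lborel)"
      if "g \<in> borel_measurable borel" for g :: "real \<Rightarrow> real"
      by (rule nn_integral_rearr[OF O _ VO that]) (fact supp)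
    have Lp: "(Lp_norm p \<Omega> u)\<^sup>2 = k * exp_moment p w powr (2 / p)"
    proof -
      define c where "c = (1 / sqrt (4 * pi)) powr p"
      have c: "0 < c" by (simp add: c_def)
      have "(LINT x:\<Omega>|lborel. \<bar>u x\<bar> powr p) = enn2real (\<integral>\<^sup>+x. ennreal (\<bar>u x\<bar> powr p) * indicator \<Omega> x \<partial>lborel)"
        by (rule set_integral_eq_enn2real) auto
      also have "(\<integral>\<^sup>+x. ennreal (\<bar>u x\<bar> powr p) * indicator \<Omega> x \<partial>lborel) =
          ennreal V * (\<integral>\<^sup>+t. ennreal (rearr t powr p * exp (- t)) * indicator {0..} t \<partial>lborel)"
        by (rule tr) measurable
      also have "(\<integral>\<^sup>+t. ennreal (rearr t powr p * exp (- t)) * indicator {0..} t \<partial>lborel) =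
         (\<integral>\<^sup>+t. ennreal c * (ennreal (w t powr p * exp (- t)) * indicator {0..} t) \<partial>lborel)"
      proof (rule nn_integral_cong)
        fix t
        have "rearr t = (1 / sqrt (4 * pi)) * w t" by (simp add: w_def)
        then have "rearr t powr p = c * w t powr p"
          unfolding c_def using energy_pairD(6)[OF wF, of t] by (simp only:) (subst powr_mult, simp_all)
        then show "ennreal (rearr t powr p * exp (- t)) * indicator {0..} t = ennreal c * (ennreal (w t powr p * exp (- t)) * indicator {0..} t)"
          using c by (auto simp: indicator_def mult.assoc simp flip: ennreal_mult)
      qed
      also have "\<dots> = ennreal c * (\<integral>\<^sup>+t. ennreal (w t powr p * exp (- t)) * indicator {0..} t \<partial>lborel)"
        by (rule nn_integral_cmult) (use energy_pair_measurable[OF wF] in measurable)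
      also have "\<dots> = ennreal (c * exp_moment p w)"
        unfolding nn_integral_exp_moment[OF p energy_pairD(6)[OF wF] wM] using c by (simp add: ennreal_mult)
      also have "enn2real (ennreal V * \<dots>) = V * (c * exp_moment p w)"
        using V c by (simp flip: ennreal_mult)
      finally have "(Lp_norm p \<Omega> u)\<^sup>2 = ((V * (c * exp_moment p w)) powr (1 / p))\<^sup>2" by (simp add: Lp_norm_def)
      also have "\<dots> = (V * (c * exp_moment p w)) powr (2 / p)" by (simp add: power2_eq_square flip: powr_add)
      also have "\<dots> = V powr (2 / p) * (c powr (2 / p) * exp_moment p w powr (2 / p))"
        using V c by (simp add: powr_mult)
      also have "c powr (2 / p) = (1 / sqrt (4 * pi))\<^sup>2"
        unfolding c_def using p by (simp add: powr_powr del: real_sqrt_mult)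
      also have "\<dots> = 1 / (4 * pi)" by (simp add: power_divide del: real_sqrt_mult)
      finally show ?thesis by (simp add: k_def)
    qed
    have D: "energy_below l \<le> dirichlet_energy \<Omega> u" for l
    proof -
      obtain B where B: "0 < B" "\<And>x. norm (grad u x) \<le> B" using bounded_G by blast
      have "(\<integral>\<^sup>+x. ennreal ((norm (grad u x))\<^sup>2) * indicator \<Omega> x \<partial>lborel) \<le> (\<integral>\<^sup>+x. ennreal (B\<^sup>2) * indicator \<Omega> x \<partial>lborel)"
        using B by (intro nn_integral_mono mult_right_mono ennreal_leI power_mono) auto
      also have "\<dots> < \<infinity>" by (simp add: nn_integral_cmult_indicator VO ennreal_mult_less_top)
      finally have fin: "(\<integral>\<^sup>+x. ennreal ((norm (grad u x))\<^sup>2) * indicator \<Omega> x \<partial>lborel) < top" by simp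
      have "dirichlet_energy \<Omega> u = enn2real (\<integral>\<^sup>+x. ennreal ((norm (grad u x))\<^sup>2) * indicator \<Omega> x \<partial>lborel)"
        unfolding dirichlet_energy_def by (rule set_integral_eq_enn2real) auto
      moreover have "energy_below l \<le> enn2real (\<integral>\<^sup>+x. ennreal ((norm (grad u x))\<^sup>2) * indicator \<Omega> x \<partial>lborel)"
        unfolding energy_below_def
        by (intro enn2real_mono nn_integral_mono fin mult_left_mono) (auto simp: indicator_def supp)
      ultimately show ?thesis by simp
    qed
    have "(\<integral>\<^sup>+t. ennreal (exp ((w t)\<^sup>2 - t)) * indicator {0..} t \<partial>lborel) \<le> ennreal C"
    proof (rule C[OF wF wM])
      fix T :: real assume T: "0 \<le> T"
      have "lambda_p p \<Omega> * (V * exp_moment p (\<lambda>t. w (min t T))) powr (2 / p) \<le> 4 * pi * F T"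
        unfolding V_def by (rule lambda_p_moment_le[OF _ wF T p]) (use V V_def in simp)
      then show "L1 * exp_moment p (\<lambda>t. w (min t T)) powr (2 / p) \<le> F T"
        using V by (simp add: L1_def k_def powr_mult field_simps)
    next
      fix t
      have "F t \<le> 1 + lam * (Lp_norm p \<Omega> u)\<^sup>2" using D[of "rearr t"] con by (simp add: F_def)
      also have "lam * (Lp_norm p \<Omega> u)\<^sup>2 \<le> max lam 0 * (Lp_norm p \<Omega> u)\<^sup>2" by (intro mult_right_mono) auto
      finally show "F t \<le> 1 + L * exp_moment p w powr (2 / p)" by (simp add: Lp L_def)
    qed
    moreover have "(\<integral>\<^sup>+ x \<in> \<Omega>. ennreal (exp (4 * pi * (u x)\<^sup>2)) \<partial>lborel) =
        ennreal V * (\<integral>\<^sup>+t. ennreal (exp (4 * pi * (rearr t)\<^sup>2) * exp (- t)) * indicator {0..} t \<partial>lborel)"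
      using tr[of "\<lambda>l. exp (4 * pi * l\<^sup>2)"] by simp
    moreover have "exp (4 * pi * (rearr t)\<^sup>2) * exp (- t) = exp ((w t)\<^sup>2 - t)" for t
      by (simp add: w_def power_mult_distrib mult_exp_exp)
    ultimately show ?thesis by (simp add: mult_left_mono)
  qed
  have "(SUP u \<in> {u \<in> C0_infinity \<Omega>. dirichlet_energy \<Omega> u - lam * (Lp_norm p \<Omega> u)\<^sup>2 \<le> 1}.
            \<integral>\<^sup>+ x \<in> \<Omega>. ennreal (exp (4 * pi * (u x)\<^sup>2)) \<partial>lborel) \<le> ennreal V * ennreal C"
    by (rule SUP_least) (use bound in auto)
  also have "\<dots> < \<infinity>" by (simp add: ennreal_mult_less_top)
  finally show ?thesis .
qed

end
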